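(* Let $\Omega$ be a countable set and let $P$ and $Q$ be stochastic matrices over $\Omega$. The following are equivalent: (1) there exist a *-automorphism $\rho$ of $\ell^{\infty}(\Omega)$ and a $\rho$-unitary isomorphism from $Arv(P)$ to $Arv(Q)$; (2) there exists a graded completely isometric isomorphism $\varphi:\mathcal{T}_+(P)\to\mathcal{T}_+(Q)$; (3) there exists an isometric (algebra) isomorphism $\varphi:\mathcal{T}_+(P)\to\mathcal{T}_+(Q)$. If moreover $P$ and $Q$ are recurrent, then these conditions are equivalent to the existence of a permutation $\sigma$ of $\Omega$ with $P_{ij}=Q_{\sigma(i)\sigma(j)}$ for all $i,j\in\Omega$.
   Context: A stochastic matrix over a countable set $\Omega$ is a function $P:\Omega\times\Omega\to[0,\infty)$ with $\sum_j P_{ij}=1$ for every $i$; $P^{(n)}_{ij}$ denotes the $(i,j)$ entry of $P^n$ ($P^0$ the identity). $P$ is recurrent if $\sum_{n\ge1}P^{(n)}_{ii}=\infty$ for every $i$. Let $p_i\in\ell^\infty(\Omega)$ be the indicator of $\{i\}$. The subproduct system $Arv(P)$ (the Arveson–Stinespring subproduct system of the unital normal positive map on $\ell^\infty(\Omega)$ determined by $P$, in its standard presentation): $Arv(P)_0=\ell^\infty(\Omega)$; for $n\ge1$, $Arv(P)_n$ is the set of complex $\Omega\times\Omega$ matrices $A=[a_{ij}]$ with $a_{ij}=0$ whenever $P^{(n)}_{ij}=0$ and $\sup_j\sum_i|a_{ij}|^2<\infty$. It is a W*-correspondence over $\ell^\infty(\Omega)$, with left and right actions given by matrix multiplication by elements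 of $\ell^\infty(\Omega)$ viewed as diagonal matrices and inner product $\langle A,B\rangle=\mathrm{Diag}(A^*B)$ (the diagonal part). The maps $U^P_{n,m}:Arv(P)_n\otimes Arv(P)_m\to Arv(P)_{n+m}$ (self-dual interior tensor product) are, for $n,m\ge1$, $U^P_{n,m}(A\otimes B)=(\sqrt{P^{n+m}})^{\flat}*[(\sqrt{P^n}*A)(\sqrt{P^m}*B)]$, where $*$ is the entrywise (Schur) product, $\sqrt{M}$ is the entrywise square root, and $M^\flat_{ik}=M_{ik}^{-1}$ if $M_{ik}>0$ and $0$ otherwise; $U_{0,n}$ and $U_{n,0}$ are the left and right module actions. Fock correspondence: $\mathcal{F}=\bigoplus_{n\ge0}Arv(P)_n$ (ultraweak direct sum). For $A\in Arv(P)_n$, the shift $S^{(n)}_A\in\mathcal{L}(\mathcal{F})$ is $S^{(n)}_A(B)=U_{n,m}(A\otimes B)$ for $B\in Arv(P)_m$. The tensor algebra $\mathcal{T}_+(P)$ is the norm-closed subalgebra of the C*-algebra $\mathcal{L}(\mathcal{F})$ generated by $\ell^\infty(\Omega)$ and all shifts. Gauge action: $W_\lambda(\oplus\xi_n)=\oplus\lambda^n\xi_n$, $\alpha_\lambda(T)=W_\lambda TW_\lambda^*$ for $\lambda\in\mathbb{T}$; Fourier coefficients $\Phi_n(T)=\int_{\mathbb{T}}\alpha_\lambda(T)\lambda^{-n}d\lambda$ (normalized Haar measure). An isomorphism $\varphi$ of tensor algebras is graded if $\Phi_n\varphi\Phi_n=\varphi\Phi_n$ for all $n$. For a *-automorphism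 $\rho$ of $\ell^\infty(\Omega)$, a $\rho$-unitary isomorphism $V:Arv(P)\to Arv(Q)$ is a family $V=(V_n)_{n\ge0}$ with $V_0=\rho$ and, for $n\ge1$, $V_n:Arv(P)_n\to Arv(Q)_n$ a surjective linear map satisfying $V_n(a\xi b)=\rho(a)V_n(\xi)\rho(b)$ and $\rho^{-1}(\langle V_n\xi,V_n\eta\rangle)=\langle\xi,\eta\rangle$ for $a,b\in\ell^\infty(\Omega)$, $\xi,\eta\in Arv(P)_n$, such that $V_{n+m}\circ U^P_{n,m}=U^Q_{n,m}\circ(V_n\otimes V_m)$ for all $n,m$. *)

theory Defs
  imports "HOL-Analysis.Analysis" "HOL-Library.Countable"
begin

type_synonym 'a mat = "'a \<Rightarrow> 'a \<Rightarrow> complex"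
type_synonym 'a fvec = "nat \<Rightarrow> 'a mat"
type_synonym 'a fop = "'a fvec \<Rightarrow> 'a fvec"

definition stochastic :: "('a \<Rightarrow> 'a \<Rightarrow> real) \<Rightarrow> bool" where
  "stochastic P \<longleftrightarrow> (\<forall>i j. 0 \<le> P i j) \<and> (\<forall>i. ((\<lambda>j. P i j) has_sum 1) UNIV)"

fun mpow :: "('a \<Rightarrow> 'a \<Rightarrow> real) \<Rightarrow> nat \<Rightarrow> 'a \<Rightarrow> 'a \<Rightarrow> real" where
  "mpow P 0 i j = (if i = j then 1 else 0)"
| "mpow P (Suc n) i j = infsum (\<lambda>k. mpow P n i k * P k j) UNIV"

definition recurrent :: "('a \<Rightarrow> 'a \<Rightarrow> real) \<Rightarrow> bool" where
  "recurrent P \<longleftrightarrow> (\<forall>i. \<not> summable (\<lambda>n. mpow P (Suc n) i i))"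

definition linf :: "('a \<Rightarrow> complex) set" where
  "linf = {a. bounded (range a)}"

definition diag_of :: "('a \<Rightarrow> complex) \<Rightarrow> 'a mat" where
  "diag_of a = (\<lambda>i j. if i = j then a i else 0)"

definition lmul :: "('a \<Rightarrow> complex) \<Rightarrow> 'a mat \<Rightarrow> 'a mat" where
  "lmul a A = (\<lambda>i j. a i * A i j)"

definition rmul :: "'a mat \<Rightarrow> ('a \<Rightarrow> complex) \<Rightarrow> 'a mat" where
  "rmul A b = (\<lambda>i j. A i j * b j)"

definition colsq :: "'a mat \<Rightarrow> 'a \<Rightarrow> real" where
  "colsq A j = infsum (\<lambda>i. (cmod (A i j))\<^sup>2) UNIV"

text \<open>Arv(P)_n. For n = 0 (P^0 = identity) this is exactly the bounded
  diagonal matrices, i.e. l-infinity viewed as diagonal matrices.\<close>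
definition arv :: "('a \<Rightarrow> 'a \<Rightarrow> real) \<Rightarrow> nat \<Rightarrow> 'a mat set" where
  "arv P n = {A. (\<forall>i j. mpow P n i j = 0 \<longrightarrow> A i j = 0)
      \<and> (\<forall>j. (\<lambda>i. (cmod (A i j))\<^sup>2) summable_on UNIV)
      \<and> bdd_above (range (colsq A))}"

definition ip :: "'a mat \<Rightarrow> 'a mat \<Rightarrow> 'a \<Rightarrow> complex" where
  "ip A B = (\<lambda>j. infsum (\<lambda>i. cnj (A i j) * B i j) UNIV)"

definition mmul :: "'a mat \<Rightarrow> 'a mat \<Rightarrow> 'a mat" where
  "mmul X Y = (\<lambda>i k. infsum (\<lambda>j. X i j * Y j k) UNIV)"

text \<open>The product maps U_{n,m} on elementary tensors.\<close>
definition U :: "('a \<Rightarrow> 'a \<Rightarrow> real) \<Rightarrow> nat \<Rightarrow> nat \<Rightarrow> 'a mat \<Rightarrow> 'a mat \<Rightarrow> 'a mat" where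
  "U P n m A B =
    (if n = 0 then lmul (\<lambda>i. A i i) B
     else if m = 0 then rmul A (\<lambda>k. B k k)
     else (\<lambda>i k. if mpow P (n + m) i k > 0 then
              mmul (\<lambda>i j. complex_of_real (sqrt (mpow P n i j)) * A i j)
                   (\<lambda>j k. complex_of_real (sqrt (mpow P m j k)) * B j k) i k
              / complex_of_real (sqrt (mpow P (n + m) i k))
            else 0))"

definition star_automorphism :: "(('a \<Rightarrow> complex) \<Rightarrow> ('a \<Rightarrow> complex)) \<Rightarrow> bool" where
  "star_automorphism \<rho> \<longleftrightarrow> bij_betw \<rho> linf linf
     \<and> (\<forall>a\<in>linf. \<forall>b\<in>linf. \<rho> (\<lambda>i. a i + b i) = (\<lambda>i. \<rho> a i + \<rho> b i))
     \<and> (\<forall>a\<in>linf. \<forall>c. \<rho> (\<lambda>i. c * a i) = (\<lambda>i. c * \<rho> a i))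
     \<and> (\<forall>a\<in>linf. \<forall>b\<in>linf. \<rho> (\<lambda>i. a i * b i) = (\<lambda>i. \<rho> a i * \<rho> b i))
     \<and> (\<forall>a\<in>linf. \<rho> (\<lambda>i. cnj (a i)) = (\<lambda>i. cnj (\<rho> a i)))"

definition rho_unitary_iso ::
  "('a \<Rightarrow> 'a \<Rightarrow> real) \<Rightarrow> ('a \<Rightarrow> 'a \<Rightarrow> real) \<Rightarrow> (('a \<Rightarrow> complex) \<Rightarrow> ('a \<Rightarrow> complex))
   \<Rightarrow> (nat \<Rightarrow> 'a mat \<Rightarrow> 'a mat) \<Rightarrow> bool" where
  "rho_unitary_iso P Q \<rho> V \<longleftrightarrow>
     (\<forall>A\<in>arv P 0. V 0 A = diag_of (\<rho> (\<lambda>i. A i i)))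
   \<and> (\<forall>n\<ge>1. V n ` arv P n = arv Q n
        \<and> (\<forall>A\<in>arv P n. \<forall>B\<in>arv P n. V n (\<lambda>i j. A i j + B i j) = (\<lambda>i j. V n A i j + V n B i j))
        \<and> (\<forall>A\<in>arv P n. \<forall>c. V n (\<lambda>i j. c * A i j) = (\<lambda>i j. c * V n A i j))
        \<and> (\<forall>a\<in>linf. \<forall>b\<in>linf. \<forall>A\<in>arv P n.
              V n (rmul (lmul a A) b) = rmul (lmul (\<rho> a) (V n A)) (\<rho> b))
        \<and> (\<forall>A\<in>arv P n. \<forall>B\<in>arv P n. ip (V n A) (V n B) = \<rho> (ip A B)))
   \<and> (\<forall>n m. \<forall>A\<in>arv P n. \<forall>B\<in>arv P m.
        V (n + m) (U P n m A B) = U Q n m (V n A) (V m B))"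

definition fcolsq :: "'a fvec \<Rightarrow> 'a \<Rightarrow> real" where
  "fcolsq \<xi> j = infsum (\<lambda>(n, i). (cmod (\<xi> n i j))\<^sup>2) UNIV"

text \<open>Ultraweak direct sum of the Arv(P)_n.\<close>
definition fock :: "('a \<Rightarrow> 'a \<Rightarrow> real) \<Rightarrow> 'a fvec set" where
  "fock P = {\<xi>. (\<forall>n i j. mpow P n i j = 0 \<longrightarrow> \<xi> n i j = 0)
      \<and> (\<forall>j. (\<lambda>(n, i). (cmod (\<xi> n i j))\<^sup>2) summable_on UNIV)
      \<and> bdd_above (range (fcolsq \<xi>))}"

definition fip :: "'a fvec \<Rightarrow> 'a fvec \<Rightarrow> 'a \<Rightarrow> complex" where
  "fip \<xi> \<eta> = (\<lambda>j. infsum (\<lambda>(n, i). cnj (\<xi> n i j) * \<eta> n i j) UNIV)"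

definition fnorm :: "'a fvec \<Rightarrow> real" where
  "fnorm \<xi> = sqrt (Sup (range (fcolsq \<xi>)))"

definition fzero :: "'a fvec" where "fzero = (\<lambda>n i j. 0)"

text \<open>Operators are represented as maps vanishing outside the Fock module.\<close>
definition adjointable :: "('a \<Rightarrow> 'a \<Rightarrow> real) \<Rightarrow> 'a fop \<Rightarrow> bool" where
  "adjointable P T \<longleftrightarrow> (\<forall>\<xi>. \<xi> \<notin> fock P \<longrightarrow> T \<xi> = fzero)
     \<and> T ` fock P \<subseteq> fock P
     \<and> (\<exists>S. S ` fock P \<subseteq> fock P \<and> (\<forall>\<xi>\<in>fock P. \<forall>\<eta>\<in>fock P. fip (T \<xi>) \<eta> = fip \<xi> (S \<eta>)))"

definition opnorm :: "('a \<Rightarrow> 'a \<Rightarrow> real) \<Rightarrow> 'a fop \<Rightarrow> real" where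
  "opnorm P T = Sup {fnorm (T \<xi>) | \<xi>. \<xi> \<in> fock P \<and> fnorm \<xi> \<le> 1}"

definition op_add :: "'a fop \<Rightarrow> 'a fop \<Rightarrow> 'a fop" where
  "op_add T S = (\<lambda>\<xi> n i j. T \<xi> n i j + S \<xi> n i j)"

definition op_diff :: "'a fop \<Rightarrow> 'a fop \<Rightarrow> 'a fop" where
  "op_diff T S = (\<lambda>\<xi> n i j. T \<xi> n i j - S \<xi> n i j)"

definition op_smul :: "complex \<Rightarrow> 'a fop \<Rightarrow> 'a fop" where
  "op_smul c T = (\<lambda>\<xi> n i j. c * T \<xi> n i j)"

definition lmult_op :: "('a \<Rightarrow> 'a \<Rightarrow> real) \<Rightarrow> ('a \<Rightarrow> complex) \<Rightarrow> 'a fop" where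
  "lmult_op P a = (\<lambda>\<xi>. if \<xi> \<in> fock P then (\<lambda>n i j. a i * \<xi> n i j) else fzero)"

definition shift_op :: "('a \<Rightarrow> 'a \<Rightarrow> real) \<Rightarrow> nat \<Rightarrow> 'a mat \<Rightarrow> 'a fop" where
  "shift_op P n A = (\<lambda>\<xi>. if \<xi> \<in> fock P then
      (\<lambda>k. if n \<le> k then U P n (k - n) A (\<xi> (k - n)) else (\<lambda>i j. 0)) else fzero)"

inductive_set tensor_alg :: "('a \<Rightarrow> 'a \<Rightarrow> real) \<Rightarrow> 'a fop set" for P where
  gen_linf: "a \<in> linf \<Longrightarrow> lmult_op P a \<in> tensor_alg P"
| gen_shift: "A \<in> arv P n \<Longrightarrow> shift_op P n A \<in> tensor_alg P"
| add: "T \<in> tensor_alg P \<Longrightarrow> S \<in> tensor_alg P \<Longrightarrow> op_add T S \<in> tensor_alg P"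
| smul: "T \<in> tensor_alg P \<Longrightarrow> op_smul c T \<in> tensor_alg P"
| comp: "T \<in> tensor_alg P \<Longrightarrow> S \<in> tensor_alg P \<Longrightarrow> T \<circ> S \<in> tensor_alg P"
| lim: "(\<And>k. Ts k \<in> tensor_alg P) \<Longrightarrow> adjointable P T
        \<Longrightarrow> (\<lambda>k. opnorm P (op_diff (Ts k) T)) \<longlonglongrightarrow> 0 \<Longrightarrow> T \<in> tensor_alg P"

definition gaugeW :: "complex \<Rightarrow> 'a fop" where
  "gaugeW z = (\<lambda>\<xi> n i j. z ^ n * \<xi> n i j)"

definition gauge_alpha :: "complex \<Rightarrow> 'a fop \<Rightarrow> 'a fop" where
  "gauge_alpha z T = gaugeW z \<circ> T \<circ> gaugeW (cnj z)"

text \<open>Phi_n(T) = integral over the circle (normalized Haar measure, parametrized by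
  t in [0,1]) of alpha_lambda(T) lambda^(-n), computed entrywise (weak integral).\<close>
definition Phi :: "('a \<Rightarrow> 'a \<Rightarrow> real) \<Rightarrow> int \<Rightarrow> 'a fop \<Rightarrow> 'a fop" where
  "Phi P n T = (\<lambda>\<xi>. if \<xi> \<in> fock P then
      (\<lambda>m i j. integral {0..1::real}
          (\<lambda>t. cis (- 2 * pi * of_int n * t) * gauge_alpha (cis (2 * pi * t)) T \<xi> m i j))
    else fzero)"

definition alg_iso :: "('a \<Rightarrow> 'a \<Rightarrow> real) \<Rightarrow> ('a \<Rightarrow> 'a \<Rightarrow> real) \<Rightarrow> ('a fop \<Rightarrow> 'a fop) \<Rightarrow> bool" where
  "alg_iso P Q \<phi> \<longleftrightarrow> bij_betw \<phi> (tensor_alg P) (tensor_alg Q)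
     \<and> (\<forall>T\<in>tensor_alg P. \<forall>S\<in>tensor_alg P. \<phi> (op_add T S) = op_add (\<phi> T) (\<phi> S))
     \<and> (\<forall>T\<in>tensor_alg P. \<forall>c. \<phi> (op_smul c T) = op_smul c (\<phi> T))
     \<and> (\<forall>T\<in>tensor_alg P. \<forall>S\<in>tensor_alg P. \<phi> (T \<circ> S) = \<phi> T \<circ> \<phi> S)"

definition isometric :: "('a \<Rightarrow> 'a \<Rightarrow> real) \<Rightarrow> ('a \<Rightarrow> 'a \<Rightarrow> real) \<Rightarrow> ('a fop \<Rightarrow> 'a fop) \<Rightarrow> bool" where
  "isometric P Q \<phi> \<longleftrightarrow> (\<forall>T\<in>tensor_alg P. opnorm Q (\<phi> T) = opnorm P T)"

text \<open>Norm on F^k (C*-module direct sum) and the induced norm on k x k operator matrices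
  (M_k(L(F)) = L(F^k)).\<close>
definition fknorm :: "nat \<Rightarrow> (nat \<Rightarrow> 'a fvec) \<Rightarrow> real" where
  "fknorm k \<xi> = sqrt (Sup (range (\<lambda>j. \<Sum>s<k. fcolsq (\<xi> s) j)))"

definition matnorm :: "('a \<Rightarrow> 'a \<Rightarrow> real) \<Rightarrow> nat \<Rightarrow> (nat \<Rightarrow> nat \<Rightarrow> 'a fop) \<Rightarrow> real" where
  "matnorm P k M = Sup {fknorm k (\<lambda>r n i j. \<Sum>s<k. M r s (\<xi> s) n i j) | \<xi>.
       (\<forall>s<k. \<xi> s \<in> fock P) \<and> fknorm k \<xi> \<le> 1}"

definition completely_isometric ::
  "('a \<Rightarrow> 'a \<Rightarrow> real) \<Rightarrow> ('a \<Rightarrow> 'a \<Rightarrow> real) \<Rightarrow> ('a fop \<Rightarrow> 'a fop) \<Rightarrow> bool" where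
  "completely_isometric P Q \<phi> \<longleftrightarrow> (\<forall>k\<ge>1. \<forall>M. (\<forall>r<k. \<forall>s<k. M r s \<in> tensor_alg P) \<longrightarrow>
       matnorm Q k (\<lambda>r s. \<phi> (M r s)) = matnorm P k M)"

definition graded :: "('a \<Rightarrow> 'a \<Rightarrow> real) \<Rightarrow> ('a \<Rightarrow> 'a \<Rightarrow> real) \<Rightarrow> ('a fop \<Rightarrow> 'a fop) \<Rightarrow> bool" where
  "graded P Q \<phi> \<longleftrightarrow> (\<forall>n::int. \<forall>T\<in>tensor_alg P. Phi Q n (\<phi> (Phi P n T)) = \<phi> (Phi P n T))"

end

(*
  The k-th column of the Fock module is the Hilbert space with orthonormal basis e(n,i,k),
  P^n_ik > 0, and an element of the tensor algebra is determined by its values on the vacuum: it is a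
  "matrix of power series".  All three conditions turn out to be equivalent to the existence of a
  permutation that matches the supports of all powers and the ratios
  P^n_ij P^m_jk / P^(n+m)_ik.

  Unitary isomorphisms are Schur multiplications by unimodular scalars after a permutation, so (1) gives
  the ratios; conversely a ratio preserving permutation acts unitarily on the Fock modules, which gives
  (1) and (2).  For (3), contractive idempotents of a tensor algebra are diagonal, so an isometric
  isomorphism permutes the vertex projections and maps corners to corners.  If it preserves
  the degree filtration, comparing leading coefficients (of modulus one after normalization) gives the
  ratios.  It can fail to preserve the filtration only at vertices w that carry a loop and have a trivial
  communicating class; there the corner is a disc algebra and the isomorphism acts as a Moebius
  transformation.  All such w lying between two given vertices move the origin by the same
  hyperbolic distance, and hence one composition with gauge automorphisms, as in the work of Davidson,
  Ramsey and Shalit, repairs all of them simultaneously.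

  For recurrent P and Q the quotient P^n_ij / Q^n_ij depends only on i and j; as a function of j it is
  positive and harmonic for Q, hence constant along edges, hence 1.
*)
theory Submission
  imports Defs "HOL-Complex_Analysis.Complex_Analysis"
begin

section \<open>Square-summable families and powers of stochastic matrices\<close>

text \<open>The property \<open>same_ratios\<close> does not mention the isomorphism. Hence the
  repair of an isomorphism that breaks the filtration is chosen afresh for each pair of end points
  i, k; one that preserves the whole filtration is never built. The repair has the form \<phi>
  \<circ> gauge a \<circ> \<phi>^-1 \<circ> gauge b \<circ> \<phi>. A bad loop acts as a disc
  automorphism with a zero c, and the conditions on a and b involve c only through its modulus. This
  modulus is shared by all bad loops between i and k: the image of a monomial depends only on its
  end points and length, so inserting loops at either of two vertices of a route shows that both
  loops have the same power series, and the series determines |c|. Operators are compared through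
  one device: a bounded functional that vanishes on the monomials of a corner vanishes on the whole
  corner. Instead of Fejer means this rests on the density of the elements of finite degree, which
  follows by induction on the closure rules of \<open>tensor_alg\<close>.\<close>

definition l2b :: "('b \<Rightarrow> complex) \<Rightarrow> real \<Rightarrow> bool" where
  "l2b f b \<longleftrightarrow> 0 \<le> b \<and> (\<forall>F. finite F \<longrightarrow> L2_set (\<lambda>x. cmod (f x)) F \<le> b)"

lemma l2b_sum: "l2b f b \<Longrightarrow> finite F \<Longrightarrow> (\<Sum>x\<in>F. (cmod (f x))\<^sup>2) \<le> b\<^sup>2"
  unfolding l2b_def L2_set_def using sqrt_le_D by blast

lemma l2bI: "0 \<le> b \<Longrightarrow> (\<And>F. finite F \<Longrightarrow> (\<Sum>x\<in>F. (cmod (f x))\<^sup>2) \<le> b\<^sup>2) \<Longrightarrow> l2b f b"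
  unfolding l2b_def L2_set_def by (simp add: real_le_lsqrt sum_nonneg)

lemma l2b_nonneg: "l2b f b \<Longrightarrow> 0 \<le> b" by (simp add: l2b_def)

lemma l2b_summable: assumes "l2b f b" shows "(\<lambda>x. (cmod (f x))\<^sup>2) summable_on UNIV"
  by (rule nonneg_bdd_above_summable_on) (use l2b_sum[OF assms] in \<open>auto intro!: bdd_aboveI[of _ "b\<^sup>2"]\<close>)

lemma l2b_infsum: assumes "l2b f b" shows "infsum (\<lambda>x. (cmod (f x))\<^sup>2) UNIV \<le> b\<^sup>2"
  by (rule infsum_le_finite_sums) (use l2b_sum[OF assms] l2b_summable[OF assms] in auto)

lemma l2b_infsumI:
  assumes "(\<lambda>x. (cmod (f x))\<^sup>2) summable_on UNIV" "infsum (\<lambda>x. (cmod (f x))\<^sup>2) UNIV \<le> b\<^sup>2" "0 \<le> b"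
  shows "l2b f b"
  by (rule l2bI[OF assms(3)]) (use assms in \<open>auto intro: order_trans[OF finite_sum_le_infsum]\<close>)

lemma l2b_mono: "l2b f a \<Longrightarrow> a \<le> b \<Longrightarrow> l2b f b"
  unfolding l2b_def by (meson order_trans)

lemma l2b_component: "l2b f b \<Longrightarrow> cmod (f x) \<le> b"
  using l2b_sum[of f b "{x}"] l2b_nonneg[of f b] by (simp add: power2_le_iff_abs_le)

lemma l2b_add: assumes "l2b f a" "l2b g b" shows "l2b (\<lambda>x. f x + g x) (a + b)"
  unfolding l2b_def
proof (intro conjI allI impI)
  fix F :: "'a set" assume F: "finite F"
  have "L2_set (\<lambda>x. cmod (f x + g x)) F \<le> L2_set (\<lambda>x. cmod (f x) + cmod (g x)) F"
    by (intro L2_set_mono norm_triangle_ineq) simp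
  also have "\<dots> \<le> L2_set (\<lambda>x. cmod (f x)) F + L2_set (\<lambda>x. cmod (g x)) F"
    by (rule L2_set_triangle_ineq)
  also have "\<dots> \<le> a + b" using assms F by (auto simp: l2b_def intro!: add_mono)
  finally show "L2_set (\<lambda>x. cmod (f x + g x)) F \<le> a + b" .
qed (use assms in \<open>auto simp: l2b_def\<close>)

lemma l2b_scale: assumes "l2b f a" shows "l2b (\<lambda>x. c * f x) (cmod c * a)"
proof (rule l2bI)
  fix F :: "'a set" assume "finite F"
  have "(\<Sum>x\<in>F. (cmod (c * f x))\<^sup>2) = (cmod c)\<^sup>2 * (\<Sum>x\<in>F. (cmod (f x))\<^sup>2)"
    by (simp add: norm_mult power_mult_distrib sum_distrib_left)
  also have "\<dots> \<le> (cmod c * a)\<^sup>2"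
    using l2b_sum[OF assms \<open>finite F\<close>] by (simp add: power_mult_distrib mult_left_mono)
  finally show "(\<Sum>x\<in>F. (cmod (c * f x))\<^sup>2) \<le> (cmod c * a)\<^sup>2" .
qed (use l2b_nonneg[OF assms] in auto)

lemma l2b_zero: "l2b (\<lambda>x. 0) 0"
  by (simp add: l2b_def L2_set_def)

lemma l2b_dominated: assumes "l2b f a" "\<And>x. cmod (g x) \<le> cmod (f x)" shows "l2b g a"
proof (rule l2bI)
  fix F :: "'a set" assume F: "finite F"
  have "(\<Sum>x\<in>F. (cmod (g x))\<^sup>2) \<le> (\<Sum>x\<in>F. (cmod (f x))\<^sup>2)"
    by (intro sum_mono power_mono assms) simp
  also note l2b_sum[OF assms(1) F]
  finally show "(\<Sum>x\<in>F. (cmod (g x))\<^sup>2) \<le> a\<^sup>2" .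
qed (rule l2b_nonneg[OF assms(1)])

text \<open>Each finite sum passes to the pointwise limit: Fatou's lemma for counting measure. This
  is what phrasing \<open>l2b\<close> with finite sets buys.\<close>

lemma l2b_limit:
  assumes "\<And>n. l2b (fs n) b" "\<And>x. (\<lambda>n. fs n x) \<longlonglongrightarrow> f x"
  shows "l2b f b"
proof (rule l2bI)
  show "0 \<le> b" using assms(1) l2b_nonneg by blast
  fix F :: "'a set" assume F: "finite F"
  have "(\<lambda>n. \<Sum>x\<in>F. (cmod (fs n x))\<^sup>2) \<longlonglongrightarrow> (\<Sum>x\<in>F. (cmod (f x))\<^sup>2)"
    by (intro tendsto_intros assms)
  then show "(\<Sum>x\<in>F. (cmod (f x))\<^sup>2) \<le> b\<^sup>2"
    by (rule LIMSEQ_le_const2) (use l2b_sum[OF assms(1) F] in auto)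
qed

lemma l2b_CS_summable: assumes "l2b f a" "l2b g b" shows "(\<lambda>x. cmod (f x * g x)) summable_on UNIV"
proof (rule Infinite_Sum.abs_summable_product)
  show "(\<lambda>i. cmod (f i * f i)) summable_on UNIV" "(\<lambda>i. cmod (g i * g i)) summable_on UNIV"
    using l2b_summable[OF assms(1)] l2b_summable[OF assms(2)] by (simp_all add: norm_mult power2_eq_square)
qed

lemma l2b_CS: assumes "l2b f a" "l2b g b"
  shows "infsum (\<lambda>x. cmod (f x * g x)) UNIV \<le> a * b"
proof (rule infsum_le_finite_sums)
  show "(\<lambda>x. cmod (f x * g x)) summable_on UNIV" using l2b_CS_summable[OF assms] .
  fix F :: "'a set" assume F: "finite F"
  have "(\<Sum>x\<in>F. cmod (f x * g x)) \<le> L2_set (\<lambda>x. cmod (f x)) F * L2_set (\<lambda>x. cmod (g x)) F"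
    using L2_set_mult_ineq[of "\<lambda>x. cmod (f x)" "\<lambda>x. cmod (g x)" F] by (simp add: norm_mult)
  also have "\<dots> \<le> a * b" using assms F by (auto simp: l2b_def intro!: mult_mono)
  finally show "(\<Sum>x\<in>F. cmod (f x * g x)) \<le> a * b" .
qed

lemma l2b_CS_norm: assumes "l2b f a" "l2b g b"
  shows "cmod (infsum (\<lambda>x. f x * g x) UNIV) \<le> a * b"
  using norm_infsum_bound[OF l2b_CS_summable[OF assms]] l2b_CS[OF assms] by linarith

lemma summable_on_prod_nonneg:
  fixes f :: "'b \<Rightarrow> 'c \<Rightarrow> real"
  assumes "\<And>x y. 0 \<le> f x y" "\<And>x. (f x) summable_on UNIV" "(\<lambda>x. infsum (f x) UNIV) summable_on UNIV"
  shows "(\<lambda>(x, y). f x y) summable_on UNIV \<times> UNIV"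
  by (rule summable_on_SigmaI[where g="\<lambda>x. infsum (f x) UNIV"]) (use assms in auto)

lemma infsum_swap_nonneg:
  fixes f :: "'b \<Rightarrow> 'c \<Rightarrow> real"
  assumes "\<And>x y. 0 \<le> f x y" "\<And>x. (f x) summable_on UNIV" "(\<lambda>x. infsum (f x) UNIV) summable_on UNIV"
  shows "infsum (\<lambda>x. infsum (f x) UNIV) UNIV = infsum (\<lambda>y. infsum (\<lambda>x. f x y) UNIV) UNIV"
  by (rule infsum_swap_banach) (use summable_on_prod_nonneg[of f] assms in auto)

text \<open>Tonelli in \<open>has_sum\<close> form: nonnegativity and convergent row sums make the
  family summable over the product, so each column is summable and the order of summation is
  free.\<close>

lemma swap_nonneg_has_sum:
  fixes f :: "'b \<Rightarrow> 'c \<Rightarrow> real"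
  assumes "\<And>x y. 0 \<le> f x y" "\<And>x. (f x has_sum g x) UNIV" "(g has_sum s) UNIV"
  shows "((\<lambda>y. infsum (\<lambda>x. f x y) UNIV) has_sum s) UNIV" "\<And>y. (\<lambda>x. f x y) summable_on UNIV"
proof -
  have g: "infsum (f x) UNIV = g x" "f x summable_on UNIV" for x using assms(2)[of x] by (simp_all add: has_sum_iff)
  then have g': "(\<lambda>x. infsum (f x) UNIV) summable_on UNIV" using assms(3) by (simp add: has_sum_iff)
  have S: "(\<lambda>(x, y). f x y) summable_on UNIV \<times> UNIV"
    by (rule summable_on_prod_nonneg) (use assms(1) g g' in auto)
  then have S': "(\<lambda>(y, x). f x y) summable_on UNIV \<times> UNIV"
    using summable_on_swap[of "\<lambda>(x,y). f x y" UNIV UNIV] by (simp add: case_prod_beta' del: UNIV_Times_UNIV)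
  have I: "(\<lambda>y. infsum (\<lambda>x. f x y) UNIV) summable_on UNIV"
    using summable_on_Sigma_banach[OF S'] by simp
  show "\<And>y. (\<lambda>x. f x y) summable_on UNIV"
    using summable_on_SigmaD1[OF S', of ] by auto
  show "((\<lambda>y. infsum (\<lambda>x. f x y) UNIV) has_sum s) UNIV"
    using I infsum_swap_nonneg[of f] assms(1,3) g g' by (auto simp: has_sum_iff)
qed

section \<open>Powers of a stochastic matrix and their ratios\<close>

lemma P_nonneg: "stochastic P \<Longrightarrow> 0 \<le> P i j" by (simp add: stochastic_def)

lemma mpow_nonneg: "stochastic P \<Longrightarrow> 0 \<le> mpow P n i j"
  by (induction n arbitrary: i j) (auto intro!: infsum_nonneg mult_nonneg_nonneg simp: P_nonneg)

lemma has_sum_single: "((\<lambda>j. if i = j then f j else (0::'b::{comm_monoid_add,topological_space})) has_sum f i) UNIV"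
  by (rule has_sum_finite_neutralI[of "{i}"]) auto

lemma mpow_has_sum: assumes "stochastic P" shows "((\<lambda>j. mpow P n i j) has_sum 1) UNIV"
proof (induction n arbitrary: i)
  case 0 show ?case using has_sum_single[of i "\<lambda>_. 1::real"] by simp
next
  case (Suc n)
  have "((\<lambda>j. mpow P n i k * P k j) has_sum mpow P n i k * 1) UNIV" for k
    by (rule has_sum_cmult_right) (use assms in \<open>auto simp: stochastic_def\<close>)
  then show ?case
    using swap_nonneg_has_sum(1)[of "\<lambda>k j. mpow P n i k * P k j" "\<lambda>k. mpow P n i k" 1] Suc
    by (simp add: mpow_nonneg P_nonneg assms)
qed

lemma mpow_le1: assumes "stochastic P" shows "mpow P n i j \<le> 1"
  using finite_sum_le_has_sum[OF mpow_has_sum[OF assms, of n i], of "{j}"] mpow_nonneg[OF assms] by simp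

lemma mpow_summable: "stochastic P \<Longrightarrow> mpow P n i summable_on UNIV"
  using mpow_has_sum[of P n i] by (auto simp: has_sum_iff)

lemma mpow_mult_summable: assumes "stochastic P"
  shows "(\<lambda>j. mpow P n i j * mpow P m j k) summable_on UNIV"
  by (rule summable_on_comparison_test[OF mpow_summable[OF assms, of n i]])
     (auto simp: mpow_nonneg assms mpow_le1 mult_left_le)

lemma mpow_1: "mpow P (Suc 0) = P"
proof (intro ext)
  fix i j
  have "((\<lambda>k. (if i = k then 1 else 0) * P k j) has_sum P i j) UNIV"
    using has_sum_single[of i "\<lambda>k. P k j"] by (simp add: if_distrib[of "\<lambda>x. x * _"] cong: if_cong)
  then show "mpow P (Suc 0) i j = P i j" by (simp add: infsumI)
qed

text \<open>Chapman-Kolmogorov. The induction is on the second exponent because \<open>mpow\<close>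
  appends its last step on the right; Tonelli exchanges the two intermediate vertices.\<close>

lemma mpow_add: assumes P: "stochastic P"
  shows "((\<lambda>j. mpow P n i j * mpow P m j k) has_sum mpow P (n + m) i k) UNIV"
proof (induction m arbitrary: k)
  case 0
  show ?case using has_sum_single[of k "\<lambda>j. mpow P n i j"] by (simp add: if_distrib[of "\<lambda>x. _ * x"] eq_commute cong: if_cong)
next
  case (Suc m)
  let ?f = "\<lambda>h j. mpow P n i j * mpow P m j h * P h k"
  have 1: "(?f h has_sum mpow P (n + m) i h * P h k) UNIV" for h
    by (rule has_sum_cmult_left[OF Suc])
  have 2: "((\<lambda>h. mpow P (n + m) i h * P h k) has_sum mpow P (n + Suc m) i k) UNIV"
    using mpow_mult_summable[OF P, of "n+m" i "Suc 0" k] by (simp add: mpow_1)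
  have "infsum (\<lambda>h. ?f h j) UNIV = mpow P n i j * mpow P (Suc m) j k" for j
    by (simp add: infsum_cmult_right' mult.assoc)
  then show ?case using swap_nonneg_has_sum(1)[OF _ 1 2] by (simp add: mpow_nonneg P_nonneg P)
qed

lemma mpow_le_add: assumes P: "stochastic P" shows "mpow P n i j * mpow P m j k \<le> mpow P (n + m) i k"
  using finite_sum_le_has_sum[OF mpow_add[OF P, of n i m k], of "{j}"] by (simp add: mpow_nonneg P)

lemma mpow_pos_add: assumes P: "stochastic P" "mpow P n i j > 0" "mpow P m j k > 0" shows "mpow P (n + m) i k > 0"
  using mpow_le_add[OF P(1), of n i j m k] P by (meson less_le_trans mult_pos_pos)

lemma mpow_pos_split: assumes P: "stochastic P" "mpow P (n + m) i k > 0"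
  obtains j where "mpow P n i j > 0" "mpow P m j k > 0"
proof -
  have "\<exists>j. mpow P n i j * mpow P m j k \<noteq> 0"
  proof (rule ccontr)
    assume "\<not> ?thesis"
    then show False using P mpow_add[OF P(1), of n i m k] infsum_0[of UNIV "\<lambda>j. mpow P n i j * mpow P m j k"]
      by (simp add: has_sum_iff del: mult_eq_0_iff)
  qed
  then show ?thesis using that mpow_nonneg[OF P(1)] by (metis less_eq_real_def mult_eq_0_iff)
qed

lemma mpow_neq0: "stochastic P \<Longrightarrow> mpow P n i j \<noteq> 0 \<longleftrightarrow> 0 < mpow P n i j"
  using mpow_nonneg[of P n i j] by linarith

text \<open>The probability of visiting \<open>j\<close> at time \<open>n\<close> on the way from \<open>i\<close> to \<open>k\<close> in \<open>n + m\<close> steps (\<open>0\<close> if there is no such way).\<close>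
definition ratio :: "('a \<Rightarrow> 'a \<Rightarrow> real) \<Rightarrow> nat \<Rightarrow> nat \<Rightarrow> 'a \<Rightarrow> 'a \<Rightarrow> 'a \<Rightarrow> real" where
  "ratio P n m i j k = mpow P n i j * mpow P m j k / mpow P (n + m) i k"

lemma ratio_nonneg: "stochastic P \<Longrightarrow> 0 \<le> ratio P n m i j k" by (simp add: ratio_def mpow_nonneg)

lemma ratio_has_sum: assumes "stochastic P" "mpow P (n+m) i k \<noteq> 0"
  shows "((\<lambda>j. ratio P n m i j k) has_sum 1) UNIV"
  using has_sum_divide_const[OF mpow_add[OF assms(1), of n i m k], of "mpow P (n+m) i k"] assms(2) by (simp add: ratio_def)

lemma ratio_pos: assumes P: "stochastic P" shows "ratio P n m i j k > 0 \<longleftrightarrow> mpow P n i j > 0 \<and> mpow P m j k > 0"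
proof
  assume "0 < ratio P n m i j k"
  then have "mpow P n i j \<noteq> 0" "mpow P m j k \<noteq> 0" by (auto simp: ratio_def)
  then show "mpow P n i j > 0 \<and> mpow P m j k > 0" using mpow_neq0[OF P] by blast
next
  assume "mpow P n i j > 0 \<and> mpow P m j k > 0"
  then show "0 < ratio P n m i j k" using mpow_pos_add[OF P] by (auto simp: ratio_def)
qed

lemma ratio_mult: assumes P: "stochastic P" shows "ratio P n m i j k * mpow P (n+m) i k = mpow P n i j * mpow P m j k"
proof (cases "mpow P (n+m) i k = 0")
  case True
  \<comment> \<open>The value 0 of the division by zero is the right one: a positive numerator would
    give a path from i to k of length n + m.\<close>
  then have "mpow P n i j * mpow P m j k = 0"
    using mpow_le_add[OF P, of n i j m k] mult_nonneg_nonneg[OF mpow_nonneg[OF P] mpow_nonneg[OF P]] by (metis order_antisym)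
  then show ?thesis using True by simp
qed (simp add: ratio_def)

lemma ratio_0_left: assumes "stochastic P" shows "ratio P 0 m i j k = (if i = j \<and> mpow P m j k \<noteq> 0 then 1 else 0)"
  by (simp add: ratio_def)
lemma ratio_0_right: assumes "stochastic P" shows "ratio P n 0 i j k = (if j = k \<and> mpow P n i j \<noteq> 0 then 1 else 0)"
  by (simp add: ratio_def)

text \<open>Square roots of a probability distribution form a unit vector; without any path the
  vector is zero. Every Cauchy-Schwarz estimate for \<open>U\<close> uses this vector as one
  factor.\<close>

lemma ratio_l2b: assumes "stochastic P" shows "l2b (\<lambda>j. complex_of_real (sqrt (ratio P n m i j k))) 1"
proof (cases "mpow P (n+m) i k = 0")
  case True then show ?thesis by (simp add: ratio_def l2b_def L2_set_def)
next
  case False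
  then show ?thesis using ratio_has_sum[OF assms False] ratio_nonneg[OF assms]
    by (intro l2b_infsumI) (auto simp: has_sum_iff)
qed

section \<open>The Fock module and the shifts\<close>

lemma l2b_self: assumes "l2b f b" shows "l2b f (sqrt (infsum (\<lambda>x. (cmod (f x))\<^sup>2) UNIV))"
  by (rule l2b_infsumI) (use l2b_summable[OF assms] in \<open>auto simp: infsum_nonneg\<close>)

text \<open>A norm over pairs may be estimated in two stages. A finite set of pairs lies in the
  product of its two projections, so finite sums are enough.\<close>

lemma l2b_pairI:
  fixes g :: "'b \<Rightarrow> 'c \<Rightarrow> complex"
  assumes g: "\<And>x. l2b (g x) (c x)" and c: "l2b (\<lambda>x. complex_of_real (c x)) b"
  shows "l2b (\<lambda>p. g (fst p) (snd p)) b"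
proof (rule l2bI)
  show "0 \<le> b" using c by (rule l2b_nonneg)
  fix F :: "('b \<times> 'c) set" assume F: "finite F"
  then have FF: "finite (fst ` F)" "finite (snd ` F)" by auto
  have "(\<Sum>p\<in>F. (cmod (g (fst p) (snd p)))\<^sup>2) \<le> (\<Sum>p\<in>fst ` F \<times> snd ` F. (cmod (g (fst p) (snd p)))\<^sup>2)"
    using FF by (intro sum_mono2 subset_fst_snd) auto
  also have "\<dots> = (\<Sum>x\<in>fst ` F. \<Sum>y\<in>snd ` F. (cmod (g x y))\<^sup>2)"
    by (simp add: sum.cartesian_product case_prod_beta)
  also have "\<dots> \<le> (\<Sum>x\<in>fst ` F. (cmod (complex_of_real (c x)))\<^sup>2)"
    by (intro sum_mono) (use l2b_sum[OF g FF(2)] in auto)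
  also have "\<dots> \<le> b\<^sup>2" by (rule l2b_sum[OF c FF(1)])
  finally show "(\<Sum>p\<in>F. (cmod (g (fst p) (snd p)))\<^sup>2) \<le> b\<^sup>2" .
qed

lemma l2b_inj: assumes "l2b f b" "inj h" shows "l2b (\<lambda>x. f (h x)) b"
proof (rule l2bI)
  show "0 \<le> b" using assms l2b_nonneg by auto
  fix F :: "'b set" assume F: "finite F"
  have "(\<Sum>x\<in>F. (cmod (f (h x)))\<^sup>2) = (\<Sum>x\<in>h ` F. (cmod (f x))\<^sup>2)"
    by (subst sum.reindex) (use assms in \<open>auto intro: inj_on_subset\<close>)
  also have "\<dots> \<le> b\<^sup>2" using l2b_sum[OF assms(1)] F by blast
  finally show "(\<Sum>x\<in>F. (cmod (f (h x)))\<^sup>2) \<le> b\<^sup>2" .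
qed

lemma l2b_slice: "l2b (\<lambda>p. g (fst p) (snd p)) b \<Longrightarrow> l2b (g x) b"
  using l2b_inj[of "\<lambda>p. g (fst p) (snd p)" b "\<lambda>y. (x, y)"] by (simp add: inj_def)

text \<open>The converse of the two-stage estimate, with the exact norms of the slices.\<close>

lemma l2b_pairD:
  fixes g :: "'b \<Rightarrow> 'c \<Rightarrow> complex"
  assumes g: "l2b (\<lambda>p. g (fst p) (snd p)) b"
  shows "l2b (\<lambda>x. complex_of_real (sqrt (infsum (\<lambda>y. (cmod (g x y))\<^sup>2) UNIV))) b"
proof (rule l2bI)
  show "0 \<le> b" using g by (rule l2b_nonneg)
  fix F :: "'b set" assume F: "finite F"
  let ?h = "\<lambda>p. (cmod (g (fst p) (snd p)))\<^sup>2"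
  have S: "?h summable_on UNIV" using l2b_summable[OF g] .
  have "(\<Sum>x\<in>F. (cmod (complex_of_real (sqrt (infsum (\<lambda>y. (cmod (g x y))\<^sup>2) UNIV))))\<^sup>2)
     = (\<Sum>x\<in>F. infsum (\<lambda>y. (cmod (g x y))\<^sup>2) UNIV)"
    by (intro sum.cong) (auto simp: infsum_nonneg)
  also have "\<dots> = infsum (\<lambda>x. infsum (\<lambda>y. ?h (x, y)) UNIV) F" using F by simp
  also have "\<dots> = infsum ?h (F \<times> UNIV)"
    by (rule infsum_Sigma_banach) (rule summable_on_subset_banach[OF S], simp)
  also have "\<dots> \<le> infsum ?h UNIV"
    by (rule infsum_mono2) (auto intro: summable_on_subset_banach[OF S] S)
  also have "\<dots> \<le> b\<^sup>2" by (rule l2b_infsum[OF g])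
  finally show "(\<Sum>x\<in>F. (cmod (complex_of_real (sqrt (infsum (\<lambda>y. (cmod (g x y))\<^sup>2) UNIV))))\<^sup>2) \<le> b\<^sup>2" .
qed

section \<open>Uniform column bounds for matrices and Fock vectors\<close>

definition ab :: "'a mat \<Rightarrow> real \<Rightarrow> bool" where "ab A b \<longleftrightarrow> (\<forall>j. l2b (\<lambda>i. A i j) b)"

text \<open>The columns are vectors of Hilbert spaces and the module norm is the supremum of their
  norms. \<open>ab\<close> and \<open>mb\<close> say that a number dominates this norm without
  mentioning a supremum that might be a junk value.\<close>

definition mb :: "'a fvec \<Rightarrow> real \<Rightarrow> bool" where
  "mb \<xi> b \<longleftrightarrow> (\<forall>j. l2b (\<lambda>p. \<xi> (fst p) (snd p) j) b)"

lemma abD: "ab A b \<Longrightarrow> l2b (\<lambda>i. A i j) b" by (simp add: ab_def)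
lemma ab_nonneg: "ab A b \<Longrightarrow> 0 \<le> b" by (rule l2b_nonneg[OF abD])
lemma mbD: "mb \<xi> b \<Longrightarrow> l2b (\<lambda>p. \<xi> (fst p) (snd p) j) b" by (simp add: mb_def)

lemma fcolsq_alt: "fcolsq \<xi> j = infsum (\<lambda>p. (cmod (\<xi> (fst p) (snd p) j))\<^sup>2) UNIV"
  by (simp add: fcolsq_def case_prod_beta')

lemma fock_iff: "\<xi> \<in> fock P \<longleftrightarrow> (\<forall>n i j. mpow P n i j = 0 \<longrightarrow> \<xi> n i j = 0) \<and> (\<exists>b. mb \<xi> b)"
proof (cases "\<forall>n i j. mpow P n i j = 0 \<longrightarrow> \<xi> n i j = 0")
  case True
  have "(\<exists>b. mb \<xi> b) \<longleftrightarrow> (\<forall>j. (\<lambda>p. (cmod (\<xi> (fst p) (snd p) j))\<^sup>2) summable_on UNIV) \<and> bdd_above (range (fcolsq \<xi>))"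
  proof safe
    fix b assume b: "mb \<xi> b"
    then show "(\<lambda>p. (cmod (\<xi> (fst p) (snd p) j))\<^sup>2) summable_on UNIV" for j
      unfolding mb_def by (auto intro: l2b_summable)
    from b show "bdd_above (range (fcolsq \<xi>))"
      unfolding mb_def fcolsq_alt by (auto intro!: bdd_aboveI[of _ "b\<^sup>2"] l2b_infsum)
  next
    assume S: "\<forall>j. (\<lambda>p. (cmod (\<xi> (fst p) (snd p) j))\<^sup>2) summable_on UNIV" and "bdd_above (range (fcolsq \<xi>))"
    then obtain c where c: "\<And>j. fcolsq \<xi> j \<le> c" by (auto simp: bdd_above_def)
    have "mb \<xi> (sqrt \<bar>c\<bar>)"
      unfolding mb_def by (intro allI l2b_infsumI) (use S c in \<open>auto simp: fcolsq_alt abs_le_iff intro: order_trans[OF _ abs_ge_self]\<close>)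
    then show "\<exists>b. mb \<xi> b" ..
  qed
  then show ?thesis using True by (simp add: fock_def case_prod_beta')
qed (auto simp: fock_def)

lemma fcolsq_nonneg: "0 \<le> fcolsq \<xi> j" by (simp add: fcolsq_alt infsum_nonneg)

lemma fnorm_le: assumes "mb \<xi> b" shows "fnorm \<xi> \<le> b"
proof -
  have "fcolsq \<xi> j \<le> b\<^sup>2" for j using assms unfolding mb_def fcolsq_alt by (auto intro: l2b_infsum)
  then have "Sup (range (fcolsq \<xi>)) \<le> b\<^sup>2" by (intro cSup_least) auto
  moreover have "0 \<le> b" using assms l2b_nonneg unfolding mb_def by blast
  ultimately show ?thesis unfolding fnorm_def by (simp add: real_le_lsqrt)
qed

lemma mb_fnorm: assumes "mb \<xi> b" shows "mb \<xi> (fnorm \<xi>)" and "0 \<le> fnorm \<xi>" and "fcolsq \<xi> j \<le> (fnorm \<xi>)\<^sup>2"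
proof -
  have "bdd_above (range (fcolsq \<xi>))"
    using assms unfolding mb_def fcolsq_alt by (auto intro!: bdd_aboveI[of _ "b\<^sup>2"] l2b_infsum)
  then have 1: "fcolsq \<xi> j \<le> Sup (range (fcolsq \<xi>))" for j by (intro cSup_upper) auto
  have 0: "0 \<le> Sup (range (fcolsq \<xi>))" by (rule order_trans[OF fcolsq_nonneg 1])
  then show 2: "0 \<le> fnorm \<xi>" by (simp add: fnorm_def)
  have 3: "fcolsq \<xi> j \<le> (fnorm \<xi>)\<^sup>2" for j using 0 1 by (simp add: fnorm_def)
  then show "fcolsq \<xi> j \<le> (fnorm \<xi>)\<^sup>2" .
  show "mb \<xi> (fnorm \<xi>)" unfolding mb_def
    by (intro allI l2b_infsumI l2b_summable[OF mbD[OF assms]] 2) (use 3 in \<open>simp add: fcolsq_alt\<close>)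
qed

lemma fock_mb: "\<xi> \<in> fock P \<Longrightarrow> mb \<xi> (fnorm \<xi>)" using mb_fnorm(1) by (auto simp: fock_iff)
lemma fock_supp: "\<xi> \<in> fock P \<Longrightarrow> mpow P n i j = 0 \<Longrightarrow> \<xi> n i j = 0" by (auto simp: fock_iff)
lemma fnorm_nonneg: "\<xi> \<in> fock P \<Longrightarrow> 0 \<le> fnorm \<xi>" using mb_fnorm(2) by (auto simp: fock_iff)

lemma fock_component: "\<xi> \<in> fock P \<Longrightarrow> cmod (\<xi> n i j) \<le> fnorm \<xi>"
  using fock_mb[of \<xi> P] l2b_component[of "\<lambda>p. \<xi> (fst p) (snd p) j" "fnorm \<xi>" "(n, i)"] by (simp add: mb_def)

definition fadd :: "'a fvec \<Rightarrow> 'a fvec \<Rightarrow> 'a fvec" where "fadd \<xi> \<eta> = (\<lambda>n i j. \<xi> n i j + \<eta> n i j)"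
definition fsc :: "complex \<Rightarrow> 'a fvec \<Rightarrow> 'a fvec" where "fsc c \<xi> = (\<lambda>n i j. c * \<xi> n i j)"

lemma mb_add: "mb \<xi> a \<Longrightarrow> mb \<eta> b \<Longrightarrow> mb (fadd \<xi> \<eta>) (a + b)"
  by (simp add: mb_def fadd_def l2b_add)
lemma mb_fsc: "mb \<xi> a \<Longrightarrow> mb (fsc c \<xi>) (cmod c * a)"
  by (simp add: mb_def fsc_def l2b_scale)
lemma fock_add: "\<xi> \<in> fock P \<Longrightarrow> \<eta> \<in> fock P \<Longrightarrow> fadd \<xi> \<eta> \<in> fock P"
  unfolding fock_iff by (metis (no_types, lifting) mb_add fadd_def add_0)
lemma fock_fsc: "\<xi> \<in> fock P \<Longrightarrow> fsc c \<xi> \<in> fock P"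
  unfolding fock_iff by (metis (no_types, lifting) mb_fsc fsc_def mult_zero_right)
lemma mb_fzero: "mb fzero 0" by (simp add: mb_def fzero_def l2b_zero)
lemma fock_fzero: "fzero \<in> fock P" unfolding fock_iff using mb_fzero by (auto simp: fzero_def)
lemma fnorm_fzero: "fnorm fzero = 0"
  by (rule antisym[OF fnorm_le[OF mb_fzero] mb_fnorm(2)[OF mb_fzero]])
lemma fnorm_add: "\<xi> \<in> fock P \<Longrightarrow> \<eta> \<in> fock P \<Longrightarrow> fnorm (fadd \<xi> \<eta>) \<le> fnorm \<xi> + fnorm \<eta>"
  by (intro fnorm_le mb_add fock_mb)
lemma fnorm_fsc_le: "\<xi> \<in> fock P \<Longrightarrow> fnorm (fsc c \<xi>) \<le> cmod c * fnorm \<xi>"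
  by (intro fnorm_le mb_fsc fock_mb)
lemma fsc_fsc: "fsc a (fsc b \<xi>) = fsc (a * b) \<xi>" by (simp add: fsc_def mult.assoc)
lemma fsc_1: "fsc 1 \<xi> = \<xi>" by (simp add: fsc_def)
lemma fnorm_fsc: assumes "\<xi> \<in> fock P" shows "fnorm (fsc c \<xi>) = cmod c * fnorm \<xi>"
proof (cases "c = 0")
  case True then show ?thesis using fnorm_fzero by (simp add: fsc_def fzero_def)
next
  case False
  have "fnorm (fsc (1 / c) (fsc c \<xi>)) \<le> cmod (1 / c) * fnorm (fsc c \<xi>)"
    by (rule fnorm_fsc_le[OF fock_fsc[OF assms]])
  then have "cmod c * fnorm \<xi> \<le> fnorm (fsc c \<xi>)" using False by (simp add: fsc_fsc fsc_1 norm_divide field_simps)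
  then show ?thesis using fnorm_fsc_le[OF assms, of c] by simp
qed

lemma arv_iff: "A \<in> arv P n \<longleftrightarrow> (\<forall>i j. mpow P n i j = 0 \<longrightarrow> A i j = 0) \<and> (\<exists>b. ab A b)"
proof -
  have "(\<exists>b. ab A b) \<longleftrightarrow> (\<forall>j. (\<lambda>i. (cmod (A i j))\<^sup>2) summable_on UNIV) \<and> bdd_above (range (colsq A))"
  proof safe
    fix b assume b: "ab A b"
    then show "(\<lambda>i. (cmod (A i j))\<^sup>2) summable_on UNIV" for j
      unfolding ab_def by (auto intro: l2b_summable)
    from b show "bdd_above (range (colsq A))"
      unfolding ab_def colsq_def by (auto intro!: bdd_aboveI[of _ "b\<^sup>2"] l2b_infsum)
  next
    assume S: "\<forall>j. (\<lambda>i. (cmod (A i j))\<^sup>2) summable_on UNIV" and "bdd_above (range (colsq A))"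
    then obtain c where c: "\<And>j. colsq A j \<le> c" by (auto simp: bdd_above_def)
    have "ab A (sqrt \<bar>c\<bar>)"
      unfolding ab_def by (intro allI l2b_infsumI) (use S c in \<open>auto simp: colsq_def abs_le_iff intro: order_trans[OF _ abs_ge_self]\<close>)
    then show "\<exists>b. ab A b" ..
  qed
  then show ?thesis by (auto simp: arv_def)
qed

lemma arv_supp: "A \<in> arv P n \<Longrightarrow> mpow P n i j = 0 \<Longrightarrow> A i j = 0" by (simp add: arv_iff)

lemma fock_slice: assumes "\<xi> \<in> fock P" shows "\<xi> n \<in> arv P n" and "ab (\<xi> n) (fnorm \<xi>)"
proof -
  show "ab (\<xi> n) (fnorm \<xi>)" unfolding ab_def
  proof
    fix j have "l2b (\<lambda>p. \<xi> (fst p) (snd p) j) (fnorm \<xi>)" using fock_mb[OF assms] by (simp add: mb_def)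
    then show "l2b (\<lambda>i. \<xi> n i j) (fnorm \<xi>)" using l2b_slice[of "\<lambda>n i. \<xi> n i j"] by blast
  qed
  then show "\<xi> n \<in> arv P n" using assms by (auto simp: arv_iff fock_iff)
qed

lemma arv_add: "A \<in> arv P n \<Longrightarrow> B \<in> arv P n \<Longrightarrow> (\<lambda>i j. A i j + B i j) \<in> arv P n"
  unfolding arv_iff ab_def using l2b_add by (safe, simp, blast)
lemma arv_scale: "A \<in> arv P n \<Longrightarrow> (\<lambda>i j. c * A i j) \<in> arv P n"
  unfolding arv_iff ab_def using l2b_scale by (safe, simp, blast)
lemma arv_zero: "(\<lambda>i j. 0) \<in> arv P n"
  unfolding arv_iff ab_def using l2b_zero by auto
lemma arv_sum: "finite I \<Longrightarrow> (\<And>x. x \<in> I \<Longrightarrow> B x \<in> arv P n) \<Longrightarrow> (\<lambda>i j. \<Sum>x\<in>I. B x i j) \<in> arv P n"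
  by (induction I rule: finite_induct) (auto simp: arv_zero intro: arv_add)

section \<open>The product maps and their associativity\<close>

abbreviation rt :: "('a \<Rightarrow> 'a \<Rightarrow> real) \<Rightarrow> nat \<Rightarrow> nat \<Rightarrow> 'a \<Rightarrow> 'a \<Rightarrow> 'a \<Rightarrow> complex" where
  "rt P n m i j k \<equiv> complex_of_real (sqrt (ratio P n m i j k))"

lemma infsum_single: "(\<And>j. j \<noteq> i \<Longrightarrow> f j = 0) \<Longrightarrow> infsum f UNIV = (f i :: complex)"
  using has_sum_finite_neutralI[of "{i}" UNIV f "f i"] by (auto intro!: infsumI)

text \<open>One formula for all cases of \<open>U\<close>. For exponent 0 the ratio is an indicator
  and the sum collapses to a single term; where the power of exponent n + m vanishes, both sides are
  0 by division by zero. Thus \<open>U\<close> depends on P only through its ratios.\<close>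

lemma U_entry: assumes P: "stochastic P" and A: "A \<in> arv P n" and B: "B \<in> arv P m"
  shows "U P n m A B i k = infsum (\<lambda>j. rt P n m i j k * (A i j * B j k)) UNIV"
proof -
  consider "n = 0" | "n > 0" "m = 0" | "n > 0" "m > 0" "mpow P (n + m) i k > 0" | "n > 0" "m > 0" "mpow P (n + m) i k = 0"
    using mpow_neq0[OF P, of "n+m" i k] by blast
  then show ?thesis
  proof cases
    case 1
    have "infsum (\<lambda>j. rt P n m i j k * (A i j * B j k)) UNIV = rt P n m i i k * (A i i * B i k)"
      by (rule infsum_single) (use arv_supp[OF A] 1 in auto)
    then show ?thesis using 1 arv_supp[OF B, of i k] by (auto simp: U_def lmul_def ratio_0_left[OF P])
  next
    case 2
    have "infsum (\<lambda>j. rt P n m i j k * (A i j * B j k)) UNIV = rt P n m i k k * (A i k * B k k)"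
      by (rule infsum_single) (use arv_supp[OF B] 2 in auto)
    then show ?thesis using 2 arv_supp[OF A, of i k] by (auto simp: U_def rmul_def ratio_0_right[OF P])
  next
    case 3
    have "U P n m A B i k = infsum (\<lambda>j. complex_of_real (sqrt (mpow P n i j)) * A i j * (complex_of_real (sqrt (mpow P m j k)) * B j k)) UNIV / complex_of_real (sqrt (mpow P (n + m) i k))"
      using 3 by (simp add: U_def mmul_def)
    also have "\<dots> = infsum (\<lambda>j. (complex_of_real (sqrt (mpow P n i j)) * A i j * (complex_of_real (sqrt (mpow P m j k)) * B j k)) * (1/ complex_of_real (sqrt (mpow P (n + m) i k)))) UNIV"
      by (subst infsum_cmult_left') simp
    also have "\<dots> = infsum (\<lambda>j. rt P n m i j k * (A i j * B j k)) UNIV"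
      by (rule infsum_cong) (simp add: ratio_def real_sqrt_mult real_sqrt_divide)
    finally show ?thesis .
  next
    case 4
    then show ?thesis by (simp add: U_def ratio_def)
  qed
qed

lemma l2b_mult_bounded: assumes "l2b g b" "\<And>x. cmod (f x) \<le> a" shows "l2b (\<lambda>x. f x * g x) (a * b)"
proof -
  have a: "0 \<le> a" using assms(2) norm_ge_zero order_trans by blast
  have "l2b (\<lambda>x. complex_of_real a * g x) (cmod (complex_of_real a) * b)" by (rule l2b_scale[OF assms(1)])
  then have "l2b (\<lambda>x. complex_of_real a * g x) (a * b)" using a by simp
  then show ?thesis by (rule l2b_dominated) (use a assms(2) in \<open>auto simp: norm_mult mult_right_mono\<close>)
qed

lemma ab_component: "ab A a \<Longrightarrow> cmod (A i j) \<le> a" by (auto simp: ab_def intro: l2b_component)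

lemma U_summable: assumes P: "stochastic P" and A: "ab A a" and B: "l2b (\<lambda>j. B j k) b"
  shows "(\<lambda>j. rt P n m i j k * (A i j * B j k)) summable_on UNIV"
  by (rule abs_summable_summable, rule l2b_CS_summable[OF ratio_l2b[OF P] l2b_mult_bounded[OF B]])
     (rule ab_component[OF A])

lemma summable_on_sum:
  fixes f :: "'b \<Rightarrow> 'c \<Rightarrow> real"
  assumes "\<And>i. i \<in> F \<Longrightarrow> f i summable_on A"
  shows "(\<lambda>x. \<Sum>i\<in>F. f i x) summable_on A"
  using assms by (induction F rule: infinite_finite_induct) (auto intro: summable_on_add)

text \<open>Cauchy-Schwarz in j against the unit vector of square roots of ratios bounds the squared
  entry by the sum over j of |A i j|^2 |B j k|^2. Summing over i first then uses the column bound of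
  A.\<close>

lemma U_bound: assumes P: "stochastic P" and A: "A \<in> arv P n" "ab A a" and B: "B \<in> arv P m" "l2b (\<lambda>j. B j k) b"
  shows "l2b (\<lambda>i. U P n m A B i k) (a * b)"
proof (rule l2bI)
  have a0: "0 \<le> a" using A(2) by (rule ab_nonneg)
  then show "0 \<le> a * b" using l2b_nonneg[OF B(2)] by simp
  fix F :: "'a set" assume F: "finite F"
  have L: "l2b (\<lambda>j. A i j * B j k) (a * b)" for i by (rule l2b_mult_bounded[OF B(2) ab_component[OF A(2)]])
  have S: "(\<lambda>j. (cmod (A i j * B j k))\<^sup>2) summable_on UNIV" for i by (rule l2b_summable[OF L])
  have "(cmod (U P n m A B i k))\<^sup>2 \<le> infsum (\<lambda>j. (cmod (A i j * B j k))\<^sup>2) UNIV" for i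
  proof -
    have "cmod (U P n m A B i k) \<le> 1 * sqrt (infsum (\<lambda>j. (cmod (A i j * B j k))\<^sup>2) UNIV)"
      unfolding U_entry[OF P A(1) B(1)] by (rule l2b_CS_norm[OF ratio_l2b[OF P] l2b_self[OF L]])
    then have "(cmod (U P n m A B i k))\<^sup>2 \<le> (sqrt (infsum (\<lambda>j. (cmod (A i j * B j k))\<^sup>2) UNIV))\<^sup>2"
      by (intro power_mono) auto
    then show ?thesis by (simp add: infsum_nonneg)
  qed
  then have "(\<Sum>i\<in>F. (cmod (U P n m A B i k))\<^sup>2) \<le> (\<Sum>i\<in>F. infsum (\<lambda>j. (cmod (A i j * B j k))\<^sup>2) UNIV)"
    by (rule sum_mono)
  also have "\<dots> = infsum (\<lambda>j. \<Sum>i\<in>F. (cmod (A i j * B j k))\<^sup>2) UNIV"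
    using F by (induction F rule: finite_induct) (simp_all add: infsum_add S summable_on_sum)
  also have "\<dots> \<le> infsum (\<lambda>j. a\<^sup>2 * (cmod (B j k))\<^sup>2) UNIV"
  proof (rule infsum_mono)
    show "(\<lambda>j. \<Sum>i\<in>F. (cmod (A i j * B j k))\<^sup>2) summable_on UNIV" using S by (rule summable_on_sum)
    show "(\<lambda>j. a\<^sup>2 * (cmod (B j k))\<^sup>2) summable_on UNIV" by (rule summable_on_cmult_right[OF l2b_summable[OF B(2)]])
    fix j
    have "(\<Sum>i\<in>F. (cmod (A i j * B j k))\<^sup>2) = (\<Sum>i\<in>F. (cmod (A i j))\<^sup>2) * (cmod (B j k))\<^sup>2"
      by (simp add: norm_mult power_mult_distrib sum_distrib_right)
    also have "\<dots> \<le> a\<^sup>2 * (cmod (B j k))\<^sup>2"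
      using A(2) F by (intro mult_right_mono l2b_sum) (auto simp: ab_def)
    finally show "(\<Sum>i\<in>F. (cmod (A i j * B j k))\<^sup>2) \<le> a\<^sup>2 * (cmod (B j k))\<^sup>2" .
  qed
  also have "\<dots> = a\<^sup>2 * infsum (\<lambda>j. (cmod (B j k))\<^sup>2) UNIV" by (rule infsum_cmult_right')
  also have "\<dots> \<le> (a * b)\<^sup>2" using l2b_infsum[OF B(2)] by (simp add: power_mult_distrib mult_left_mono)
  finally show "(\<Sum>i\<in>F. (cmod (U P n m A B i k))\<^sup>2) \<le> (a * b)\<^sup>2" .
qed

lemma U_arv: assumes P: "stochastic P" and A: "A \<in> arv P n" and B: "B \<in> arv P m"
  shows "U P n m A B \<in> arv P (n + m)"
proof -
  obtain a b where ab: "ab A a" "ab B b" using A B by (auto simp: arv_iff)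
  then have "ab (U P n m A B) (a * b)" using U_bound[OF P A ab(1) B] by (auto simp: ab_def)
  moreover have "U P n m A B i k = 0" if "mpow P (n+m) i k = 0" for i k
    using that by (simp add: U_entry[OF P A B] ratio_def)
  ultimately show ?thesis by (auto simp: arv_iff)
qed

lemma U_entry_bound: assumes P: "stochastic P" and A: "A \<in> arv P n" "ab A a" and B: "B \<in> arv P m" "ab B b"
  shows "cmod (U P n m A B i k) \<le> a * b"
  using l2b_component[OF U_bound[OF P A B(1)]] B(2) by (auto simp: ab_def)

lemma U_add_left: assumes P: "stochastic P" and "A \<in> arv P n" "A' \<in> arv P n" "B \<in> arv P m"
  shows "U P n m (\<lambda>i j. A i j + A' i j) B i k = U P n m A B i k + U P n m A' B i k"
proof -
  obtain a a' b where ab: "ab A a" "ab A' a'" "ab B b" using assms by (auto simp: arv_iff)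
  have S: "(\<lambda>j. rt P n m i j k * (A i j * B j k)) summable_on UNIV" "(\<lambda>j. rt P n m i j k * (A' i j * B j k)) summable_on UNIV"
    by (rule U_summable[OF P _ abD[OF ab(3)]], rule ab)+
  show ?thesis using infsum_add[OF S] by (simp add: U_entry[OF P] assms arv_add distrib_left distrib_right)
qed

lemma U_add_right: assumes P: "stochastic P" and "A \<in> arv P n" "B \<in> arv P m" "B' \<in> arv P m"
  shows "U P n m A (\<lambda>i j. B i j + B' i j) i k = U P n m A B i k + U P n m A B' i k"
proof -
  obtain a b b' where ab: "ab A a" "ab B b" "ab B' b'" using assms by (auto simp: arv_iff)
  have S: "(\<lambda>j. rt P n m i j k * (A i j * B j k)) summable_on UNIV" "(\<lambda>j. rt P n m i j k * (A i j * B' j k)) summable_on UNIV"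
    by (rule U_summable[OF P ab(1) abD], rule ab)+
  show ?thesis using infsum_add[OF S] by (simp add: U_entry[OF P] assms arv_add distrib_left distrib_right)
qed

lemma U_scale_left: assumes P: "stochastic P" and "A \<in> arv P n" "B \<in> arv P m"
  shows "U P n m (\<lambda>i j. c * A i j) B i k = c * U P n m A B i k"
  by (simp add: U_entry[OF P] assms arv_scale flip: infsum_cmult_right') (simp add: mult_ac)

lemma U_scale_right: assumes P: "stochastic P" and "A \<in> arv P n" "B \<in> arv P m"
  shows "U P n m A (\<lambda>i j. c * B i j) i k = c * U P n m A B i k"
  by (simp add: U_entry[OF P] assms arv_scale flip: infsum_cmult_right') (simp add: mult_ac)

lemma U_zero_left: "stochastic P \<Longrightarrow> B \<in> arv P m \<Longrightarrow> U P n m (\<lambda>i j. 0) B i k = 0"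
  using U_scale_left[OF _ arv_zero, of P B m n 0 i k] by simp
lemma U_zero_right: "stochastic P \<Longrightarrow> A \<in> arv P n \<Longrightarrow> U P n m A (\<lambda>i j. 0) i k = 0"
  using U_scale_right[OF _ _ arv_zero, of P A n m 0 i k] by simp

lemma U_sum_left: assumes P: "stochastic P" and "finite I" "\<And>x. x \<in> I \<Longrightarrow> A x \<in> arv P n" "B \<in> arv P m"
  shows "U P n m (\<lambda>i j. \<Sum>x\<in>I. A x i j) B i k = (\<Sum>x\<in>I. U P n m (A x) B i k)"
  using assms(2,3) by (induction I rule: finite_induct) (simp_all add: U_zero_left U_add_left P assms(4) arv_sum)
lemma U_sum_right: assumes P: "stochastic P" and "finite I" "\<And>x. x \<in> I \<Longrightarrow> B x \<in> arv P m" "A \<in> arv P n"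
  shows "U P n m A (\<lambda>i j. \<Sum>x\<in>I. B x i j) i k = (\<Sum>x\<in>I. U P n m A (B x) i k)"
  using assms(2,3) by (induction I rule: finite_induct) (simp_all add: U_zero_right U_add_right P assms(4) arv_sum)

text \<open>Both products are the probability of passing through j and then h on the way from i to
  k, computed in two orders of conditioning.\<close>

lemma ratio_assoc: assumes P: "stochastic P"
  shows "ratio P (n + m) l i h k * ratio P n m i j h = ratio P n (m + l) i j k * ratio P m l j h k"
proof -
  have "ratio P (n + m) l i h k * ratio P n m i j h = mpow P n i j * mpow P m j h * mpow P l h k / mpow P (n + m + l) i k"
    using ratio_mult[OF P, of n m i j h] by (simp add: ratio_def[of P "n+m" l]) (metis mult.assoc mult.commute)
  moreover have "ratio P n (m + l) i j k * ratio P m l j h k = mpow P n i j * mpow P m j h * mpow P l h k / mpow P (n + m + l) i k"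
    using ratio_mult[OF P, of m l j h k] by (simp add: ratio_def[of P n "m+l"] add.assoc) (metis mult.assoc mult.commute)
  ultimately show ?thesis by simp
qed

text \<open>By \<open>ratio_assoc\<close> both sides are the same double sum over j and h in
  opposite orders; only the exchange of the sums needs an argument.\<close>

lemma U_assoc: assumes P: "stochastic P" and A: "A \<in> arv P n" and B: "B \<in> arv P m" and C: "C \<in> arv P l"
  shows "U P (n + m) l (U P n m A B) C i k = U P n (m + l) A (U P m l B C) i k"
proof -
  obtain a b c where abc: "ab A a" "ab B b" "ab C c" using A B C by (auto simp: arv_iff)
  \<comment> \<open>\<open>W\<close> is the square root of a probability on pairs, hence of norm at
    most one; \<open>X\<close> collects the matrix entries and has norm at most abc. Cauchy-Schwarz
    for these two factors gives the absolute summability required for the exchange.\<close>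
  define W where "W h j = complex_of_real (sqrt (ratio P (n + m) l i h k * ratio P n m i j h))" for h j
  define X where "X h j = A i j * B j h * C h k" for h j
  have W1: "W h j = rt P (n + m) l i h k * rt P n m i j h" for h j by (simp add: W_def real_sqrt_mult)
  have W2: "W h j = rt P n (m + l) i j k * rt P m l j h k" for h j by (simp add: W_def ratio_assoc[OF P] real_sqrt_mult)
  have "l2b (W h) (sqrt (ratio P (n + m) l i h k))" for h
    using l2b_scale[OF ratio_l2b[OF P, of n m i h], of "rt P (n + m) l i h k"] by (simp add: W1[abs_def] ratio_nonneg[OF P])
  then have LW: "l2b (\<lambda>p. W (fst p) (snd p)) 1" by (rule l2b_pairI) (rule ratio_l2b[OF P])
  have XL: "l2b (X h) (a * b * cmod (C h k))" for h
  proof -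
    have "l2b (\<lambda>j. A i j * B j h) (a * b)" by (rule l2b_mult_bounded[OF abD[OF abc(2)] ab_component[OF abc(1)]])
    from l2b_scale[OF this, of "C h k"] show ?thesis by (simp add: X_def[abs_def] mult_ac)
  qed
  have CL: "l2b (\<lambda>h. complex_of_real (a * b * cmod (C h k))) (a * b * c)"
  proof (rule l2b_dominated)
    show "l2b (\<lambda>h. complex_of_real (a * b) * C h k) (a * b * c)"
      using l2b_scale[OF abD[OF abc(3)], of "complex_of_real (a * b)"] ab_nonneg[OF abc(1)] ab_nonneg[OF abc(2)] by (simp add: norm_mult)
  qed (simp add: norm_mult)
  have LX: "l2b (\<lambda>p. X (fst p) (snd p)) (a * b * c)" by (rule l2b_pairI[OF XL CL])
  have S: "(\<lambda>(h, j). W h j * X h j) summable_on UNIV \<times> UNIV"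
    using abs_summable_summable[OF l2b_CS_summable[OF LW LX]] by (simp add: case_prod_beta')
  have "U P (n + m) l (U P n m A B) C i k = infsum (\<lambda>h. infsum (\<lambda>j. W h j * X h j) UNIV) UNIV"
    unfolding U_entry[OF P U_arv[OF P A B] C] U_entry[OF P A B]
    by (intro infsum_cong) (simp add: W1 X_def mult_ac flip: infsum_cmult_right' infsum_cmult_left')
  also have "\<dots> = infsum (\<lambda>j. infsum (\<lambda>h. W h j * X h j) UNIV) UNIV"
    by (rule infsum_swap_banach[OF S])
  also have "\<dots> = U P n (m + l) A (U P m l B C) i k"
    unfolding U_entry[OF P A U_arv[OF P B C]] U_entry[OF P B C]
    by (intro infsum_cong) (simp add: W2 X_def mult_ac flip: infsum_cmult_right' infsum_cmult_left')
  finally show ?thesis .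
qed

text \<open>A shift moves every degree by n, so distinct degrees stay orthogonal and the bound
  \<open>U_bound\<close> in each degree adds up to the same factor a.\<close>

lemma shift_bound: assumes P: "stochastic P" and A: "A \<in> arv P n" "ab A a" and x: "\<xi> \<in> fock P" "mb \<xi> b"
  shows "mb (shift_op P n A \<xi>) (a * b)"
  unfolding mb_def
proof
  fix k
  define c where "c m = sqrt (infsum (\<lambda>i. (cmod (\<xi> m i k))\<^sup>2) UNIV)" for m
  have L: "l2b (\<lambda>p. \<xi> (fst p) (snd p) k) b" using x(2) by (simp add: mb_def)
  have c: "l2b (\<lambda>i. \<xi> m i k) (c m)" for m unfolding c_def by (rule l2b_self[OF l2b_slice[of "\<lambda>m i. \<xi> m i k", OF L]])
  have a0: "0 \<le> a" using A(2) by (rule ab_nonneg)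
  have cb: "l2b (\<lambda>m. complex_of_real (c m)) b" unfolding c_def by (rule l2b_pairD[of "\<lambda>m i. \<xi> m i k", OF L])
  let ?g = "\<lambda>l i. shift_op P n A \<xi> l i k"
  have "l2b (?g l) (if n \<le> l then a * c (l - n) else 0)" for l
    using U_bound[OF P A fock_slice(1)[OF x(1)] c] x(1) by (auto simp: shift_op_def l2b_zero)
  moreover have "l2b (\<lambda>l. complex_of_real (if n \<le> l then a * c (l - n) else 0)) (a * b)"
  proof (rule l2bI)
    show "0 \<le> a * b" using a0 l2b_nonneg[OF L] by simp
    fix F :: "nat set" assume F: "finite F"
    have "(\<Sum>l\<in>F. (cmod (complex_of_real (if n \<le> l then a * c (l - n) else 0)))\<^sup>2)
        = (\<Sum>l\<in>{l\<in>F. n \<le> l}. a\<^sup>2 * (cmod (complex_of_real (c (l - n))))\<^sup>2)"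
      using F by (intro sum.mono_neutral_cong_right) (auto simp: power_mult_distrib norm_mult split: if_splits)
    also have "\<dots> = a\<^sup>2 * (\<Sum>l\<in>(\<lambda>l. l - n) ` {l\<in>F. n \<le> l}. (cmod (complex_of_real (c l)))\<^sup>2)"
      by (subst sum.reindex) (auto simp: inj_on_def sum_distrib_left)
    also have "\<dots> \<le> a\<^sup>2 * b\<^sup>2" using F by (intro mult_left_mono l2b_sum[OF cb]) auto
    finally show "(\<Sum>l\<in>F. (cmod (complex_of_real (if n \<le> l then a * c (l - n) else 0)))\<^sup>2) \<le> (a * b)\<^sup>2"
      by (simp add: power_mult_distrib)
  qed
  ultimately show "l2b (\<lambda>p. shift_op P n A \<xi> (fst p) (snd p) k) (a * b)" by (rule l2b_pairI)
qed

lemma shift_fock: assumes P: "stochastic P" and A: "A \<in> arv P n" and x: "\<xi> \<in> fock P"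
  shows "shift_op P n A \<xi> \<in> fock P"
proof -
  obtain a where "ab A a" using A by (auto simp: arv_iff)
  then have "mb (shift_op P n A \<xi>) (a * fnorm \<xi>)" using shift_bound[OF P A _ x fock_mb[OF x]] by blast
  moreover have "shift_op P n A \<xi> m i k = 0" if "mpow P m i k = 0" for m i k
    using that arv_supp[OF U_arv[OF P A fock_slice(1)[OF x]], of "m - n" i k] x by (auto simp: shift_op_def)
  ultimately show ?thesis by (auto simp: fock_iff)
qed

section \<open>Adjointable operators are bounded\<close>

text \<open>What remains of adjointability when the adjoint is dropped. Unlike adjoints, these
  properties pass to sums, multiples and products by plain norm estimates.\<close>

definition bounded_op :: "('a \<Rightarrow> 'a \<Rightarrow> real) \<Rightarrow> 'a fop \<Rightarrow> bool" where
  "bounded_op P T \<longleftrightarrow> (\<forall>\<xi>. \<xi> \<notin> fock P \<longrightarrow> T \<xi> = fzero) \<and> (\<forall>\<xi>\<in>fock P. T \<xi> \<in> fock P)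
    \<and> (\<forall>\<xi>\<in>fock P. \<forall>\<eta>\<in>fock P. T (fadd \<xi> \<eta>) = fadd (T \<xi>) (T \<eta>))
    \<and> (\<forall>\<xi>\<in>fock P. \<forall>c. T (fsc c \<xi>) = fsc c (T \<xi>))
    \<and> (\<exists>K\<ge>0. \<forall>\<xi>\<in>fock P. fnorm (T \<xi>) \<le> K * fnorm \<xi>)"

definition basv :: "nat \<Rightarrow> 'a \<Rightarrow> 'a \<Rightarrow> 'a fvec" where
  "basv n i j = (\<lambda>m x y. if m = n \<and> x = i \<and> y = j then 1 else 0)"

lemma l2b_indicator: "l2b (\<lambda>x. if x = a then 1 else 0) 1"
proof (rule l2bI)
  fix F :: "'a set" assume F: "finite F"
  have "(\<Sum>x\<in>F. (cmod (if x = a then 1 else 0))\<^sup>2) = (\<Sum>x\<in>F. if x = a then 1 else 0)"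
    by (rule sum.cong) auto
  then show "(\<Sum>x\<in>F. (cmod (if x = a then 1 else 0))\<^sup>2) \<le> 1\<^sup>2" using F by simp
qed simp

lemma basv_fock: assumes "mpow P n i j \<noteq> 0" shows "basv n i j \<in> fock P" and "mb (basv n i j) 1"
proof -
  show "mb (basv n i j) 1" unfolding mb_def
  proof
    fix y show "l2b (\<lambda>p. basv n i j (fst p) (snd p) y) 1"
      by (rule l2b_dominated[OF l2b_indicator[of "(n, i)"]]) (auto simp: basv_def)
  qed
  then show "basv n i j \<in> fock P" using assms by (auto simp: fock_iff basv_def)
qed

lemma fip_alt: "fip \<xi> \<eta> j = infsum (\<lambda>p. cnj (\<xi> (fst p) (snd p) j) * \<eta> (fst p) (snd p) j) UNIV"
  by (simp add: fip_def case_prod_beta')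

lemma l2b_cnj: "l2b f a \<Longrightarrow> l2b (\<lambda>x. cnj (f x)) a" by (simp add: l2b_def)

lemma fip_bound: assumes "l2b (\<lambda>p. \<xi> (fst p) (snd p) j) a" "l2b (\<lambda>p. \<eta> (fst p) (snd p) j) b"
  shows "cmod (fip \<xi> \<eta> j) \<le> a * b"
  unfolding fip_alt by (rule l2b_CS_norm[OF l2b_cnj assms(2)]) (rule assms(1))

lemma fip_basv: "fip \<xi> (basv n i j) j = cnj (\<xi> n i j)"
proof -
  have "fip \<xi> (basv n i j) j = cnj (\<xi> (fst (n, i)) (snd (n, i)) j) * basv n i j (fst (n, i)) (snd (n, i)) j"
    unfolding fip_alt by (rule infsum_single) (auto simp: basv_def)
  then show ?thesis by (simp add: basv_def)
qed

lemma fip_summable: "\<xi> \<in> fock P \<Longrightarrow> \<eta> \<in> fock P \<Longrightarrow>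
   (\<lambda>p. cnj (\<xi> (fst p) (snd p) j) * \<eta> (fst p) (snd p) j) summable_on UNIV"
  by (rule abs_summable_summable[OF l2b_CS_summable[OF l2b_cnj[OF mbD] mbD]]) (erule fock_mb)+

lemma fip_add_left: assumes "\<xi> \<in> fock P" "\<eta> \<in> fock P" "\<zeta> \<in> fock P"
  shows "fip (fadd \<xi> \<eta>) \<zeta> j = fip \<xi> \<zeta> j + fip \<eta> \<zeta> j"
  using infsum_add[OF fip_summable[OF assms(1,3)] fip_summable[OF assms(2,3)]]
  by (simp add: fip_alt fadd_def distrib_right)

lemma fip_add_right: assumes "\<xi> \<in> fock P" "\<eta> \<in> fock P" "\<zeta> \<in> fock P"
  shows "fip \<xi> (fadd \<eta> \<zeta>) j = fip \<xi> \<eta> j + fip \<xi> \<zeta> j"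
  using infsum_add[OF fip_summable[OF assms(1,2)] fip_summable[OF assms(1,3)]]
  by (simp add: fip_alt fadd_def distrib_left)

lemma fip_fsc_left: "fip (fsc c \<xi>) \<zeta> j = cnj c * fip \<xi> \<zeta> j"
  by (simp add: fip_alt fsc_def mult.assoc flip: infsum_cmult_right')
lemma fip_fsc_right: "fip \<xi> (fsc c \<zeta>) j = c * fip \<xi> \<zeta> j"
  by (simp add: fip_alt fsc_def flip: infsum_cmult_right') (simp add: mult_ac)

lemma adjointableE:
  assumes "adjointable P T"
  obtains S where "\<And>\<xi>. \<xi> \<in> fock P \<Longrightarrow> S \<xi> \<in> fock P"
    and "\<And>\<xi> \<eta>. \<xi> \<in> fock P \<Longrightarrow> \<eta> \<in> fock P \<Longrightarrow> fip (T \<xi>) \<eta> = fip \<xi> (S \<eta>)"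
proof -
  obtain S where S: "S ` fock P \<subseteq> fock P" "\<forall>\<xi>\<in>fock P. \<forall>\<eta>\<in>fock P. fip (T \<xi>) \<eta> = fip \<xi> (S \<eta>)"
    using assms unfolding adjointable_def by (elim conjE exE)
  show ?thesis
  proof (rule that[of S])
    show "S \<xi> \<in> fock P" if "\<xi> \<in> fock P" for \<xi> using S(1) that by (simp add: image_subset_iff)
    show "fip (T \<xi>) \<eta> = fip \<xi> (S \<eta>)" if "\<xi> \<in> fock P" "\<eta> \<in> fock P" for \<xi> \<eta>
      by (rule S(2)[rule_format, OF that])
  qed
qed

text \<open>Linearity is forced by the adjoint: an entry of \<open>T \<xi>\<close> is the conjugate
  of the inner product of \<xi> with the adjoint applied to a basis vector.\<close>

lemma adjointable_linear:
  assumes T: "adjointable P T"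
  shows "\<xi> \<in> fock P \<Longrightarrow> \<eta> \<in> fock P \<Longrightarrow> T (fadd \<xi> \<eta>) = fadd (T \<xi>) (T \<eta>)"
    and "\<xi> \<in> fock P \<Longrightarrow> T (fsc c \<xi>) = fsc c (T \<xi>)"
proof -
  obtain S where S: "\<And>\<xi>. \<xi> \<in> fock P \<Longrightarrow> S \<xi> \<in> fock P"
    and adj: "\<And>\<xi> \<eta>. \<xi> \<in> fock P \<Longrightarrow> \<eta> \<in> fock P \<Longrightarrow> fip (T \<xi>) \<eta> = fip \<xi> (S \<eta>)"
    by (fact adjointableE[OF T])
  have TF: "\<And>\<xi>. \<xi> \<in> fock P \<Longrightarrow> T \<xi> \<in> fock P" using T by (auto simp: adjointable_def)
  have E: "T \<xi> n i j = cnj (fip \<xi> (S (basv n i j)) j)" if "\<xi> \<in> fock P" "mpow P n i j \<noteq> 0" for \<xi> n i j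
    using adj[OF that(1) basv_fock(1)[OF that(2)]] fip_basv[of "T \<xi>" n i j] by simp
  have Z: "T \<xi> n i j = 0" if "\<xi> \<in> fock P" "mpow P n i j = 0" for \<xi> n i j
    using fock_supp[OF TF] that by blast
  show "T (fadd \<xi> \<eta>) = fadd (T \<xi>) (T \<eta>)" if "\<xi> \<in> fock P" "\<eta> \<in> fock P"
  proof (intro ext)
    fix n i j show "T (fadd \<xi> \<eta>) n i j = fadd (T \<xi>) (T \<eta>) n i j"
      using that by (cases "mpow P n i j = 0")
        (simp_all add: fadd_def[of "T \<xi>"] E Z fock_add fip_add_left S basv_fock(1))
  qed
  show "T (fsc c \<xi>) = fsc c (T \<xi>)" if "\<xi> \<in> fock P"
  proof (intro ext)
    fix n i j show "T (fsc c \<xi>) n i j = fsc c (T \<xi>) n i j"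
      using that by (cases "mpow P n i j = 0") (simp_all add: fsc_def[of c "T \<xi>"] E Z fock_fsc fip_fsc_left)
  qed
qed

lemma fadd_swap: "fadd (fadd a b) c = fadd (fadd a c) b" by (simp add: fadd_def add_ac)

text \<open>The supremum in \<^const>\<open>opnorm\<close> is a junk value for unbounded operators, so the boundedness of the
  limits occurring in \<^const>\<open>tensor_alg\<close> has to come from adjointability. The proof is the gliding hump
  form of the uniform boundedness principle, applied to the functionals \<open>l n\<close>.\<close>
lemma adjointable_unit_ball_bounded:
  assumes T: "adjointable P T"
  shows "\<exists>K\<ge>0. \<forall>\<xi>\<in>fock P. fnorm \<xi> \<le> 1 \<longrightarrow> fnorm (T \<xi>) \<le> K"
proof (rule ccontr)
  assume unb: "\<not> ?thesis"
  obtain S where S: "\<And>\<xi>. \<xi> \<in> fock P \<Longrightarrow> S \<xi> \<in> fock P"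
    and adj: "\<And>\<xi> \<eta>. \<xi> \<in> fock P \<Longrightarrow> \<eta> \<in> fock P \<Longrightarrow> fip (T \<xi>) \<eta> = fip \<xi> (S \<eta>)"
    by (fact adjointableE[OF T])
  have TF: "\<And>\<xi>. \<xi> \<in> fock P \<Longrightarrow> T \<xi> \<in> fock P" using T by (auto simp: adjointable_def)
  have "\<exists>x. fst x \<in> fock P \<and> fnorm (fst x) \<le> 1 \<and> \<not> l2b (\<lambda>p. T (fst x) (fst p) (snd p) (snd x)) K" if "K \<ge> 0" for K
  proof -
    obtain \<xi> where "\<xi> \<in> fock P" "fnorm \<xi> \<le> 1" "\<not> fnorm (T \<xi>) \<le> K" using unb \<open>K \<ge> 0\<close> by auto
    moreover from this(3) obtain j where "\<not> l2b (\<lambda>p. T \<xi> (fst p) (snd p) j) K" using fnorm_le[of "T \<xi>" K] unfolding mb_def by blast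
    ultimately show ?thesis by (intro exI[of _ "(\<xi>, j)"]) simp
  qed
  \<comment> \<open>The n-th hump gets the coefficient 3^-n and the later ones sum to half of it, so
    the n-th functional, of norm N n, is at least N n / (2 * 3 ^ n) in modulus at the limit. The
    threshold makes this exceed n.\<close>
  then have "\<forall>n::nat. \<exists>x. fst x \<in> fock P \<and> fnorm (fst x) \<le> 1 \<and> \<not> l2b (\<lambda>p. T (fst x) (fst p) (snd p) (snd x)) (2 * 3 ^ n * real n)"
    by simp
  then obtain X where X: "\<And>n. fst (X n) \<in> fock P" "\<And>n. fnorm (fst (X n)) \<le> 1"
     "\<And>n. \<not> l2b (\<lambda>p. T (fst (X n)) (fst p) (snd p) (snd (X n))) (2 * 3 ^ n * real n)"
    using choice[of "\<lambda>n x. fst x \<in> fock P \<and> fnorm (fst x) \<le> 1 \<and> \<not> l2b (\<lambda>p. T (fst x) (fst p) (snd p) (snd x)) (2 * 3 ^ n * real n)"] by auto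
  define t where "t n = (\<lambda>p. T (fst (X n)) (fst p) (snd p) (snd (X n)))" for n
  define N where "N n = sqrt (infsum (\<lambda>p. (cmod (t n p))\<^sup>2) UNIV)" for n
  have tl: "l2b (t n) (N n)" for n
    unfolding N_def by (rule l2b_self[where b="fnorm (T (fst (X n)))"]) (use mbD[OF fock_mb[OF TF[OF X(1)]]] in \<open>auto simp: t_def\<close>)
  have Nbig: "N n > 2 * 3 ^ n * real n" for n
    using l2b_mono[OF tl[of n], of "2 * 3 ^ n * real n"] X(3)[of n] by (force simp: t_def)
  have Npos: "N n > 0" for n using Nbig[of n] by (meson le_less_trans mult_nonneg_nonneg of_nat_0_le_iff zero_le_numeral zero_le_power)
  define u where "u n = (\<lambda>m i j. if j = snd (X n) then t n (m, i) / N n else 0)" for n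
  have uf: "mb (u n) 1" for n unfolding mb_def
  proof
    fix j
    show "l2b (\<lambda>p. u n (fst p) (snd p) j) 1"
    proof (cases "j = snd (X n)")
      case True
      then show ?thesis using l2b_scale[OF tl, of "1 / complex_of_real (N n)" n] Npos[of n]
        by (simp add: u_def norm_divide)
    next
      case False
      then show ?thesis using l2b_mono[OF l2b_zero, of 1] by (simp add: u_def)
    qed
  qed
  have uF: "u n \<in> fock P" for n
    using uf[of n] fock_supp[OF TF[OF X(1)]] by (auto simp: fock_iff u_def t_def)
  define l where "l n \<eta> = fip (T (fst (X n))) \<eta> (snd (X n))" for n \<eta>
  have lb: "cmod (l n \<eta>) \<le> N n * b" if "mb \<eta> b" for n \<eta> b
    unfolding l_def by (rule fip_bound) (use tl[of n] mbD[OF that] in \<open>auto simp: t_def\<close>)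
  have la: "l n (fadd \<eta> \<zeta>) = l n \<eta> + l n \<zeta>" if "\<eta> \<in> fock P" "\<zeta> \<in> fock P" for n \<eta> \<zeta>
    unfolding l_def by (rule fip_add_right[OF TF[OF X(1)] that])
  have ls: "l n (fsc c \<eta>) = c * l n \<eta>" for n c \<eta> unfolding l_def by (rule fip_fsc_right)
  have lu: "l n (u n) = N n" for n
  proof -
    have "l n (u n) = infsum (\<lambda>p. complex_of_real ((cmod (t n p))\<^sup>2) * (1 / N n)) UNIV"
      unfolding l_def fip_alt by (intro infsum_cong) (simp add: u_def t_def complex_norm_square mult.commute del: of_real_power)
    also have "\<dots> = infsum (\<lambda>p. complex_of_real ((cmod (t n p))\<^sup>2)) UNIV * (1 / N n)" by (rule infsum_cmult_left')
    also have "infsum (\<lambda>p. complex_of_real ((cmod (t n p))\<^sup>2)) UNIV = complex_of_real ((N n)\<^sup>2)"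
      using has_sum_of_real[OF has_sum_infsum[OF l2b_summable[OF tl[of n]]]] by (auto simp: N_def infsum_nonneg intro: infsumI)
    finally show ?thesis using Npos[of n] by (simp add: power2_eq_square)
  qed
  \<comment> \<open>The two values obtained by adding and by subtracting 3^-n N n differ by twice
    that amount, so at least one of them has modulus 3^-n N n or more; the sign picks such a
    one.\<close>
  define step where "step n \<eta> = (if cmod (l n \<eta> + (1/3)^n * N n) \<ge> (1/3)^n * N n then (1/3)^n else - ((1/3)^n) :: complex)" for n \<eta>
  define e where "e = rec_nat fzero (\<lambda>n \<eta>. fadd \<eta> (fsc (step n \<eta>) (u n)))"
  have e0: "e 0 = fzero" and eS: "e (Suc n) = fadd (e n) (fsc (step n (e n)) (u n))" for n by (auto simp: e_def)
  have cs: "cmod (step n \<eta>) = (1/3)^n" for n \<eta> by (simp add: step_def norm_power norm_divide)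
  have eF: "e n \<in> fock P" for n by (induction n) (auto simp: e0 eS fock_fzero intro!: fock_add fock_fsc uF)
  have big: "cmod (l n (e (Suc n))) \<ge> (1/3)^n * N n" for n
  proof -
    have eq: "l n (e (Suc n)) = l n (e n) + step n (e n) * N n" by (simp add: eS la eF fock_fsc uF ls lu)
    show ?thesis
    proof (cases "cmod (l n (e n) + (1/3)^n * N n) \<ge> (1/3)^n * N n")
      case True then show ?thesis by (simp add: eq step_def)
    next
      case False
      have "2 * ((1/3)^n * N n) = cmod ((l n (e n) + (1/3)^n * N n) - (l n (e n) - (1/3)^n * N n))"
        using Npos[of n] by (simp add: norm_mult norm_power norm_divide)
      also have "\<dots> \<le> cmod (l n (e n) + (1/3)^n * N n) + cmod (l n (e n) - (1/3)^n * N n)" by (rule norm_triangle_ineq4)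
      finally show ?thesis using False by (simp add: eq step_def)
    qed
  qed
  have dl: "mb (fadd (e (Suc n + k)) (fsc (-1) (e (Suc n)))) ((1/3)^n / 2 - (1/3)^(n+k) / 2)" for n k
  proof (induction k)
    case 0
    have "fadd (e (Suc n)) (fsc (-1) (e (Suc n))) = fzero" by (simp add: fadd_def fsc_def fzero_def)
    then show ?case using mb_fzero by simp
  next
    case (Suc k)
    have "fadd (e (Suc n + Suc k)) (fsc (-1) (e (Suc n)))
      = fadd (fadd (e (Suc n + k)) (fsc (-1) (e (Suc n)))) (fsc (step (Suc n + k) (e (Suc n + k))) (u (Suc n + k)))"
      using eS[of "Suc n + k"] by (simp add: fadd_swap)
    moreover have "mb \<dots> (((1/3)^n / 2 - (1/3)^(n+k) / 2) + (1/3)^(Suc n + k))"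
      using mb_add[OF Suc mb_fsc[OF uf, of "step (Suc n + k) (e (Suc n + k))"]] by (simp add: cs)
    moreover have "((1/3)^n / 2 - (1/3)^(n+k) / 2) + (1/3)^(Suc n + k) = ((1/3)^n / 2 - (1/3)^(n+Suc k) / 2 :: real)"
      by (simp add: field_simps)
    ultimately show ?case by simp
  qed
  have "\<exists>L. (\<lambda>n. e n m i j) \<longlonglongrightarrow> L" for m i j
  proof -
    have "cmod (e (Suc n) m i j - e n m i j) \<le> (1/3)^n" for n
      using l2b_component[OF mbD[OF mb_fsc[OF uf, of "step n (e n)" n], of j], of "(m, i)"] by (simp add: eS fadd_def cs)
    then have "summable (\<lambda>n. e (Suc n) m i j - e n m i j)"
      by (intro summable_comparison_test'[OF summable_geometric[of "1/3::real"]]) auto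
    from summable_LIMSEQ[OF this] have "(\<lambda>n. e n m i j - e 0 m i j) \<longlonglongrightarrow> (\<Sum>n. e (Suc n) m i j - e n m i j)"
      by (simp add: sum_lessThan_telescope[of "\<lambda>n. e n m i j"])
    then show ?thesis by (auto simp: e0 fzero_def)
  qed
  then obtain \<eta> where lim: "\<And>m i j. (\<lambda>n. e n m i j) \<longlonglongrightarrow> \<eta> m i j" by metis
  \<comment> \<open>The increments after e (Suc n) have norms at most 3^-(n+1), 3^-(n+2) and so on,
    with sum 3^-n / 2.\<close>
  have tail: "mb (fadd \<eta> (fsc (-1) (e (Suc n)))) ((1/3)^n / 2)" for n
    unfolding mb_def
  proof
    fix j
    show "l2b (\<lambda>p. fadd \<eta> (fsc (-1) (e (Suc n))) (fst p) (snd p) j) ((1/3)^n / 2)"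
    proof (rule l2b_limit)
      show "l2b (\<lambda>p. fadd (e (Suc n + k)) (fsc (-1) (e (Suc n))) (fst p) (snd p) j) ((1/3)^n / 2)" for k
        using l2b_mono[OF mbD[OF dl[of n k]]] by simp
      show "(\<lambda>k. fadd (e (Suc n + k)) (fsc (-1) (e (Suc n))) (fst p) (snd p) j) \<longlonglongrightarrow> fadd \<eta> (fsc (-1) (e (Suc n))) (fst p) (snd p) j" for p
        unfolding fadd_def by (intro tendsto_intros) (use LIMSEQ_ignore_initial_segment[OF lim, where k = "Suc n"] in \<open>simp add: add.commute\<close>)
    qed
  qed
  have dF: "fadd \<eta> (fsc (-1) (e (Suc n))) \<in> fock P" for n
  proof -
    have "\<eta> m i j = 0" if "mpow P m i j = 0" for m i j
      using LIMSEQ_unique[OF lim[of m i j]] fock_supp[OF eF that] by simp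
    then show ?thesis using tail[of n] fock_supp[OF eF] by (auto simp: fock_iff fadd_def fsc_def)
  qed
  have dec: "\<eta> = fadd (fadd \<eta> (fsc (-1) (e (Suc n)))) (e (Suc n))" for n by (simp add: fadd_def fsc_def)
  have hF: "\<eta> \<in> fock P" using fock_add[OF dF eF] dec[of 0] by metis
  have "N n / (2 * 3 ^ n) \<le> fnorm (S \<eta>)" for n
  proof -
    have "cmod (l n (e (Suc n))) \<le> cmod (l n \<eta>) + N n * ((1/3)^n / 2)"
    proof -
      have "l n (e (Suc n)) = l n \<eta> - l n (fadd \<eta> (fsc (-1) (e (Suc n))))"
        using la[OF dF[of n] eF[of "Suc n"], of n] by (simp flip: dec)
      then show ?thesis using add_left_mono[OF lb[OF tail, of n n], of "cmod (l n \<eta>)"] norm_triangle_ineq4[of "l n \<eta>" "l n (fadd \<eta> (fsc (-1) (e (Suc n))))"] by simp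
    qed
    then have "(1/3)^n * N n / 2 \<le> cmod (l n \<eta>)" using big[of n] by (simp add: mult.commute[of "N n"])
    also have "l n \<eta> = fip (fst (X n)) (S \<eta>) (snd (X n))" unfolding l_def using adj[OF X(1) hF] by simp
    also have "cmod \<dots> \<le> fnorm (fst (X n)) * fnorm (S \<eta>)"
      by (rule fip_bound[OF mbD[OF fock_mb[OF X(1)]] mbD[OF fock_mb[OF S[OF hF]]]])
    also have "\<dots> \<le> 1 * fnorm (S \<eta>)" by (rule mult_right_mono[OF X(2) fnorm_nonneg[OF S[OF hF]]])
    finally show ?thesis by (simp add: field_simps power_divide)
  qed
  moreover have "real n < N n / (2 * 3 ^ n)" for n using Nbig[of n] by (simp add: field_simps)
  ultimately have *: "real n < fnorm (S \<eta>)" for n by (rule less_le_trans[rotated])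
  obtain n :: nat where "fnorm (S \<eta>) < real n" using reals_Archimedean2 by blast
  then show False using *[of n] by linarith
qed

lemma fnorm_zeroD: assumes "\<xi> \<in> fock P" "fnorm \<xi> = 0" shows "\<xi> = fzero"
  using fock_component[OF assms(1)] assms(2) by (intro ext) (simp add: fzero_def)

lemma adjointable_bounded_op: assumes T: "adjointable P T" shows "bounded_op P T"
proof -
  obtain K where K: "K \<ge> 0" "\<And>\<xi>. \<xi> \<in> fock P \<Longrightarrow> fnorm \<xi> \<le> 1 \<Longrightarrow> fnorm (T \<xi>) \<le> K"
    using adjointable_unit_ball_bounded[OF T] by auto
  have TF: "\<And>\<xi>. \<xi> \<in> fock P \<Longrightarrow> T \<xi> \<in> fock P" using T by (auto simp: adjointable_def)
  have "fnorm (T \<xi>) \<le> K * fnorm \<xi>" if x: "\<xi> \<in> fock P" for \<xi>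
  proof (cases "fnorm \<xi> = 0")
    case True
    then have "\<xi> = fsc 0 \<xi>" using fnorm_zeroD[OF x] by (simp add: fsc_def fzero_def)
    then have "T \<xi> = fsc 0 (T \<xi>)" using adjointable_linear(2)[OF T x] by metis
    then show ?thesis using True fnorm_fsc[OF TF[OF x], of 0] by simp
  next
    case False
    then have pos: "fnorm \<xi> > 0" using fnorm_nonneg[OF x] by simp
    let ?c = "complex_of_real (1 / fnorm \<xi>)"
    have "fnorm (T (fsc ?c \<xi>)) \<le> K" using pos x by (intro K fock_fsc) (simp_all add: fnorm_fsc[OF x] norm_divide)
    then have "fnorm (T \<xi>) / fnorm \<xi> \<le> K" using pos adjointable_linear(2)[OF T x] fnorm_fsc[OF TF[OF x]] by (simp add: norm_divide)
    then show ?thesis using pos by (simp add: field_simps)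
  qed
  then show ?thesis unfolding bounded_op_def using K(1) T adjointable_linear[OF T] TF by (auto simp: adjointable_def)
qed

section \<open>Fourier expansion of the elements of the tensor algebra\<close>

lemma bounded_opD:
  assumes "bounded_op P T"
  shows "\<xi> \<notin> fock P \<Longrightarrow> T \<xi> = fzero" "\<xi> \<in> fock P \<Longrightarrow> T \<xi> \<in> fock P"
    "\<xi> \<in> fock P \<Longrightarrow> \<eta> \<in> fock P \<Longrightarrow> T (fadd \<xi> \<eta>) = fadd (T \<xi>) (T \<eta>)"
    "\<xi> \<in> fock P \<Longrightarrow> T (fsc c \<xi>) = fsc c (T \<xi>)"
  using assms by (auto simp: bounded_op_def)

lemma bounded_op_bound: assumes "bounded_op P T" obtains K where "K \<ge> 0" "\<And>\<xi>. \<xi> \<in> fock P \<Longrightarrow> fnorm (T \<xi>) \<le> K * fnorm \<xi>"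
  using assms by (auto simp: bounded_op_def)

lemma op_add_alt: "op_add T S \<xi> = fadd (T \<xi>) (S \<xi>)" by (simp add: op_add_def fadd_def)
lemma op_smul_alt: "op_smul c T \<xi> = fsc c (T \<xi>)" by (simp add: op_smul_def fsc_def)
lemma op_diff_alt: "op_diff T S = op_add T (op_smul (-1) S)" by (simp add: op_diff_def op_add_def op_smul_def)

lemma fadd_fzero: "fadd fzero \<xi> = \<xi>" "fadd \<xi> fzero = \<xi>" by (simp_all add: fadd_def fzero_def)
lemma fsc_fzero: "fsc c fzero = fzero" by (simp add: fsc_def fzero_def)

lemma opnorm_le:
  assumes "K \<ge> 0" "\<And>\<xi>. \<xi> \<in> fock P \<Longrightarrow> fnorm (T \<xi>) \<le> K * fnorm \<xi>" shows "opnorm P T \<le> K"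
  unfolding opnorm_def
proof (rule cSup_least)
  show "{fnorm (T \<xi>) |\<xi>. \<xi> \<in> fock P \<and> fnorm \<xi> \<le> 1} \<noteq> {}" proof -
    have "fnorm (T fzero) \<in> {fnorm (T \<xi>) |\<xi>. \<xi> \<in> fock P \<and> fnorm \<xi> \<le> 1}"
      by (intro CollectI exI[of _ fzero]) (simp add: fnorm_fzero fock_fzero)
    then show ?thesis by blast
  qed
  fix x assume "x \<in> {fnorm (T \<xi>) |\<xi>. \<xi> \<in> fock P \<and> fnorm \<xi> \<le> 1}"
  then obtain \<xi> where x: "x = fnorm (T \<xi>)" "\<xi> \<in> fock P" "fnorm \<xi> \<le> 1" by auto
  then show "x \<le> K" using assms(2)[OF x(2)] mult_left_le[OF x(3) assms(1)] by linarith
qed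

lemma opnorm_upper: assumes "bounded_op P T" "\<xi> \<in> fock P" "fnorm \<xi> \<le> 1" shows "fnorm (T \<xi>) \<le> opnorm P T"
proof -
  obtain K where K: "K \<ge> 0" "\<And>\<xi>. \<xi> \<in> fock P \<Longrightarrow> fnorm (T \<xi>) \<le> K * fnorm \<xi>" using bounded_op_bound[OF assms(1)] by blast
  have "bdd_above {fnorm (T \<xi>) |\<xi>. \<xi> \<in> fock P \<and> fnorm \<xi> \<le> 1}"
  proof (rule bdd_aboveI[of _ K])
    fix x assume "x \<in> {fnorm (T \<xi>) |\<xi>. \<xi> \<in> fock P \<and> fnorm \<xi> \<le> 1}"
    then obtain \<xi> where x: "x = fnorm (T \<xi>)" "\<xi> \<in> fock P" "fnorm \<xi> \<le> 1" by auto
    then show "x \<le> K" using K(2)[OF x(2)] mult_left_le[OF x(3) K(1)] by linarith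
  qed
  then show ?thesis unfolding opnorm_def by (rule cSup_upper[rotated]) (use assms in auto)
qed

lemma opnorm_nonneg: assumes "bounded_op P T" shows "0 \<le> opnorm P T"
proof -
  have "T fzero \<in> fock P" using bounded_opD(2)[OF assms fock_fzero] .
  then have "0 \<le> fnorm (T fzero)" by (rule fnorm_nonneg)
  also have "\<dots> \<le> opnorm P T" by (rule opnorm_upper[OF assms fock_fzero]) (simp add: fnorm_fzero)
  finally show ?thesis .
qed

lemma opnorm_bound: assumes T: "bounded_op P T" and x: "\<xi> \<in> fock P" shows "fnorm (T \<xi>) \<le> opnorm P T * fnorm \<xi>"
proof (cases "fnorm \<xi> = 0")
  case True
  obtain K where "\<And>\<xi>. \<xi> \<in> fock P \<Longrightarrow> fnorm (T \<xi>) \<le> K * fnorm \<xi>" using bounded_op_bound[OF T] by blast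
  from this[OF x] show ?thesis using True by simp
next
  case False
  then have pos: "fnorm \<xi> > 0" using fnorm_nonneg[OF x] by simp
  let ?c = "complex_of_real (1 / fnorm \<xi>)"
  have "fnorm (T (fsc ?c \<xi>)) \<le> opnorm P T" using pos x by (intro opnorm_upper[OF T] fock_fsc) (simp_all add: fnorm_fsc[OF x] norm_divide)
  then have "fnorm (T \<xi>) / fnorm \<xi> \<le> opnorm P T" using pos by (simp add: bounded_opD(4)[OF T x] fnorm_fsc[OF bounded_opD(2)[OF T x]] norm_divide)
  then show ?thesis using pos by (simp add: field_simps)
qed

lemma fadd_distrib: "fadd (fadd a b) (fadd c d) = fadd (fadd a c) (fadd b d)" "fsc z (fadd a b) = fadd (fsc z a) (fsc z b)"
  by (simp_all add: fadd_def fsc_def algebra_simps)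

lemma bounded_op_add: assumes "bounded_op P T" "bounded_op P S" shows "bounded_op P (op_add T S)" and "opnorm P (op_add T S) \<le> opnorm P T + opnorm P S"
proof -
  have B: "fnorm (op_add T S \<xi>) \<le> (opnorm P T + opnorm P S) * fnorm \<xi>" if "\<xi> \<in> fock P" for \<xi>
    using fnorm_add[OF bounded_opD(2)[OF assms(1) that] bounded_opD(2)[OF assms(2) that]] opnorm_bound[OF assms(1) that] opnorm_bound[OF assms(2) that]
    by (simp add: op_add_alt distrib_right)
  have N: "0 \<le> opnorm P T + opnorm P S" using opnorm_nonneg assms by (auto intro: add_nonneg_nonneg)
  show "bounded_op P (op_add T S)" unfolding bounded_op_def
  proof (intro conjI ballI allI impI)
    show "\<exists>K\<ge>0. \<forall>\<xi>\<in>fock P. fnorm (op_add T S \<xi>) \<le> K * fnorm \<xi>" using B N by blast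
  qed (simp_all add: op_add_alt bounded_opD[OF assms(1)] bounded_opD[OF assms(2)] fadd_fzero fadd_distrib fock_add)
  show "opnorm P (op_add T S) \<le> opnorm P T + opnorm P S" by (rule opnorm_le[OF N B])
qed

lemma bounded_op_smul: assumes "bounded_op P T" shows "bounded_op P (op_smul c T)" and "opnorm P (op_smul c T) \<le> cmod c * opnorm P T"
proof -
  have B: "fnorm (op_smul c T \<xi>) \<le> (cmod c * opnorm P T) * fnorm \<xi>" if "\<xi> \<in> fock P" for \<xi>
    using opnorm_bound[OF assms that] by (simp add: op_smul_alt fnorm_fsc[OF bounded_opD(2)[OF assms that]] mult.assoc mult_left_mono)
  have N: "0 \<le> cmod c * opnorm P T" using opnorm_nonneg[OF assms] by simp
  show "bounded_op P (op_smul c T)" unfolding bounded_op_def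
  proof (intro conjI ballI allI impI)
    show "\<exists>K\<ge>0. \<forall>\<xi>\<in>fock P. fnorm (op_smul c T \<xi>) \<le> K * fnorm \<xi>" using B N by blast
  qed (simp_all add: op_smul_alt bounded_opD[OF assms(1)] fsc_fzero fadd_distrib fock_fsc fsc_fsc mult.commute)
  show "opnorm P (op_smul c T) \<le> cmod c * opnorm P T" by (rule opnorm_le[OF N B])
qed

lemma bounded_op_comp: assumes "bounded_op P T" "bounded_op P S" shows "bounded_op P (T \<circ> S)" and "opnorm P (T \<circ> S) \<le> opnorm P T * opnorm P S"
proof -
  have B: "fnorm ((T \<circ> S) \<xi>) \<le> (opnorm P T * opnorm P S) * fnorm \<xi>" if "\<xi> \<in> fock P" for \<xi>
    using opnorm_bound[OF assms(1) bounded_opD(2)[OF assms(2) that]] mult_left_mono[OF opnorm_bound[OF assms(2) that] opnorm_nonneg[OF assms(1)]]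
    by (simp add: mult.assoc)
  have N: "0 \<le> opnorm P T * opnorm P S" using opnorm_nonneg assms by (auto intro: mult_nonneg_nonneg)
  have "T fzero = fzero" using bounded_opD(4)[OF assms(1) fock_fzero, of 0] by (simp add: fsc_def fzero_def)
  then show "bounded_op P (T \<circ> S)" unfolding bounded_op_def
  proof (intro conjI ballI allI impI)
    show "\<exists>K\<ge>0. \<forall>\<xi>\<in>fock P. fnorm ((T \<circ> S) \<xi>) \<le> K * fnorm \<xi>" using B N by blast
  qed (simp_all add: bounded_opD[OF assms(1)] bounded_opD[OF assms(2)])
  show "opnorm P (T \<circ> S) \<le> opnorm P T * opnorm P S" by (rule opnorm_le[OF N B])
qed

lemma bounded_op_diff: assumes "bounded_op P T" "bounded_op P S" shows "bounded_op P (op_diff T S)" and "opnorm P (op_diff T S) \<le> opnorm P T + opnorm P S"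
  using bounded_op_add[OF assms(1) bounded_op_smul(1)[OF assms(2), of "-1"]] bounded_op_smul(2)[OF assms(2), of "-1"] by (auto simp: op_diff_alt)

lemma shift_bounded_op: assumes P: "stochastic P" and A: "A \<in> arv P n" shows "bounded_op P (shift_op P n A)"
  and "ab A a \<Longrightarrow> opnorm P (shift_op P n A) \<le> a"
proof -
  have B: "fnorm (shift_op P n A \<xi>) \<le> a * fnorm \<xi>" if "ab A a" "\<xi> \<in> fock P" for \<xi> a
    by (rule fnorm_le, rule shift_bound[OF P A that fock_mb[OF that(2)]])
  obtain a0 where a: "ab A a0" using A by (auto simp: arv_iff)
  have S: "\<xi> k \<in> arv P k" if "\<xi> \<in> fock P" for \<xi> k using fock_slice(1)[OF that] .
  show "bounded_op P (shift_op P n A)" unfolding bounded_op_def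
  proof (intro conjI ballI allI impI)
    show "shift_op P n A \<xi> \<in> fock P" if "\<xi> \<in> fock P" for \<xi> by (rule shift_fock[OF P A that])
    show "\<exists>K\<ge>0. \<forall>\<xi>\<in>fock P. fnorm (shift_op P n A \<xi>) \<le> K * fnorm \<xi>" using B[OF a] ab_nonneg[OF a] by blast
    show "shift_op P n A \<xi> = fzero" if "\<xi> \<notin> fock P" for \<xi> using that by (simp add: shift_op_def)
    fix \<xi> assume x: "\<xi> \<in> fock P"
    show "shift_op P n A (fsc c \<xi>) = fsc c (shift_op P n A \<xi>)" for c
      by (intro ext) (simp add: shift_op_def x fock_fsc, simp add: fsc_def U_scale_right[OF P A S[OF x]])
    fix \<eta> assume y: "\<eta> \<in> fock P"
    show "shift_op P n A (fadd \<xi> \<eta>) = fadd (shift_op P n A \<xi>) (shift_op P n A \<eta>)"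
      by (intro ext) (simp add: shift_op_def x y fock_add, simp add: fadd_def U_add_right[OF P A S[OF x] S[OF y]])
  qed
  show "opnorm P (shift_op P n A) \<le> a" if "ab A a" by (rule opnorm_le[OF ab_nonneg[OF that] B[OF that]])
qed

text \<open>The identity matrix in degree 0, that is, the vacuum vectors of all columns at once.
  Accordingly \<open>T vac n\<close> is the n-th Fourier coefficient of T.\<close>

definition vac :: "'a fvec" where "vac = (\<lambda>n i j. if n = 0 \<and> i = j then 1 else 0)"

lemma vac_mb: "mb vac 1" unfolding mb_def
proof
  fix j show "l2b (\<lambda>p. vac (fst p) (snd p) j) 1"
    by (rule l2b_dominated[OF l2b_indicator[of "(0, j)"]]) (auto simp: vac_def)
qed

lemma vac_fock: "vac \<in> fock P" and vac_norm: "fnorm vac \<le> 1"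
proof -
  have "mpow P n i j = 0 \<Longrightarrow> \<not> (n = 0 \<and> i = j)" for n i j by auto
  then show "vac \<in> fock P" using vac_mb unfolding fock_iff by (auto simp: vac_def)
  show "fnorm vac \<le> 1" by (rule fnorm_le[OF vac_mb])
qed

text \<open>T acts as the formal sum of the shifts by its coefficients \<open>T vac n\<close>. In a
  fixed degree m only finitely many of them contribute, so no convergence is involved.\<close>

definition fourier :: "('a \<Rightarrow> 'a \<Rightarrow> real) \<Rightarrow> 'a fop \<Rightarrow> bool" where
  "fourier P T \<longleftrightarrow> (\<forall>\<xi>\<in>fock P. \<forall>m i k. T \<xi> m i k = (\<Sum>a\<le>m. U P (m - a) a (T vac (m - a)) (\<xi> a) i k))"

definition analytic_op :: "('a \<Rightarrow> 'a \<Rightarrow> real) \<Rightarrow> 'a fop \<Rightarrow> bool" where "analytic_op P T \<longleftrightarrow> bounded_op P T \<and> fourier P T"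

lemma ab_mono: "ab A a \<Longrightarrow> a \<le> b \<Longrightarrow> ab A b" using l2b_mono unfolding ab_def by blast

lemma analytic_op_bounded_op: "analytic_op P T \<Longrightarrow> bounded_op P T" by (simp add: analytic_op_def)
lemma analytic_op_fourier: "analytic_op P T \<Longrightarrow> \<xi> \<in> fock P \<Longrightarrow> T \<xi> m i k = (\<Sum>a\<le>m. U P (m - a) a (T vac (m - a)) (\<xi> a) i k)"
  by (simp add: analytic_op_def fourier_def)
lemma analytic_op_arv: "analytic_op P T \<Longrightarrow> T vac n \<in> arv P n" using fock_slice(1)[OF bounded_opD(2)[OF analytic_op_bounded_op vac_fock]] .
lemma analytic_op_ab: assumes "analytic_op P T" shows "ab (T vac n) (opnorm P T)"
proof -
  have "fnorm (T vac) \<le> opnorm P T" by (rule opnorm_upper[OF analytic_op_bounded_op[OF assms] vac_fock vac_norm])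
  then show ?thesis by (rule ab_mono[OF fock_slice(2)[OF bounded_opD(2)[OF analytic_op_bounded_op[OF assms] vac_fock]]])
qed
lemma cf_bound: "analytic_op P T \<Longrightarrow> cmod (T vac n i j) \<le> opnorm P T" by (rule ab_component[OF analytic_op_ab])

lemma U_vac: assumes P: "stochastic P" and A: "A \<in> arv P n" shows "U P n 0 A (vac 0) = A"
proof (intro ext)
  fix i k
  show "U P n 0 A (vac 0) i k = A i k" using arv_supp[OF A, of i k]
    by (cases "n = 0") (auto simp: U_def lmul_def rmul_def vac_def)
qed

lemma shift_vac: assumes P: "stochastic P" and A: "A \<in> arv P n"
  shows "shift_op P n A vac m = (if m = n then A else (\<lambda>i j. 0))"
proof -
  have "U P n (m - n) A (vac (m - n)) = (\<lambda>i j. 0)" if "n < m"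
    using that by (intro ext) (simp add: vac_def U_zero_right[OF P A])
  then show ?thesis using U_vac[OF P A] by (auto simp: shift_op_def vac_fock)
qed

lemma analytic_op_shift: assumes P: "stochastic P" and A: "A \<in> arv P n" shows "analytic_op P (shift_op P n A)"
  unfolding analytic_op_def fourier_def
proof (intro conjI ballI allI shift_bounded_op(1)[OF P A])
  fix \<xi> m i k assume x: "\<xi> \<in> fock P"
  have "(\<Sum>a\<le>m. U P (m - a) a (shift_op P n A vac (m - a)) (\<xi> a) i k)
      = (\<Sum>a\<le>m. if n \<le> m \<and> a = m - n then U P n a A (\<xi> a) i k else 0)"
    by (intro sum.cong) (auto simp: shift_vac[OF P A] U_zero_left[OF P fock_slice(1)[OF x]])
  also have "\<dots> = shift_op P n A \<xi> m i k" using x by (auto simp: shift_op_def sum.delta)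
  finally show "shift_op P n A \<xi> m i k = (\<Sum>a\<le>m. U P (m - a) a (shift_op P n A vac (m - a)) (\<xi> a) i k)" ..
qed

lemma diag_arv: assumes "a \<in> linf" shows "diag_of a \<in> arv P 0"
proof -
  obtain K where K: "\<And>i. cmod (a i) \<le> K" using assms by (auto simp: linf_def bounded_iff)
  have "l2b (\<lambda>i. diag_of a i j) K" for j
  proof -
    have "l2b (\<lambda>i. a j * (if i = j then 1 else 0)) (cmod (a j) * 1)" by (rule l2b_scale[OF l2b_indicator])
    then have "l2b (\<lambda>i. a j * (if i = j then 1 else 0)) K" by (rule l2b_mono) (simp add: K)
    then show ?thesis by (rule l2b_dominated) (auto simp: diag_of_def)
  qed
  then show ?thesis by (auto simp: arv_iff ab_def diag_of_def)
qed

lemma lmult_shift: "lmult_op P a = shift_op P 0 (diag_of a)"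
  by (intro ext) (simp add: lmult_op_def shift_op_def U_def lmul_def diag_of_def)

lemma analytic_op_add: assumes P: "stochastic P" and "analytic_op P T" "analytic_op P S" shows "analytic_op P (op_add T S)"
  unfolding analytic_op_def fourier_def
proof (intro conjI ballI allI bounded_op_add(1) analytic_op_bounded_op assms)
  fix \<xi> m i k assume x: "\<xi> \<in> fock P"
  have "U P (m - a) a (op_add T S vac (m - a)) (\<xi> a) i k = U P (m - a) a (T vac (m - a)) (\<xi> a) i k + U P (m - a) a (S vac (m - a)) (\<xi> a) i k" for a
    using U_add_left[OF P analytic_op_arv[OF assms(2)] analytic_op_arv[OF assms(3)] fock_slice(1)[OF x]] by (simp add: op_add_def)
  then show "op_add T S \<xi> m i k = (\<Sum>a\<le>m. U P (m - a) a (op_add T S vac (m - a)) (\<xi> a) i k)"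
    using analytic_op_fourier[OF assms(2) x] analytic_op_fourier[OF assms(3) x] by (simp add: op_add_def[of T S] sum.distrib)
qed

lemma analytic_op_smul: assumes P: "stochastic P" and "analytic_op P T" shows "analytic_op P (op_smul c T)"
  unfolding analytic_op_def fourier_def
proof (intro conjI ballI allI bounded_op_smul(1) analytic_op_bounded_op assms)
  fix \<xi> m i k assume x: "\<xi> \<in> fock P"
  have "U P (m - a) a (op_smul c T vac (m - a)) (\<xi> a) i k = c * U P (m - a) a (T vac (m - a)) (\<xi> a) i k" for a
    using U_scale_left[OF P analytic_op_arv[OF assms(2)] fock_slice(1)[OF x]] by (simp add: op_smul_def)
  then show "op_smul c T \<xi> m i k = (\<Sum>a\<le>m. U P (m - a) a (op_smul c T vac (m - a)) (\<xi> a) i k)"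
    using analytic_op_fourier[OF assms(2) x] by (simp add: op_smul_def[of c T] sum_distrib_left)
qed

text \<open>The coefficients of a product are Cauchy products of the coefficients; the identity is
  associativity of \<open>U\<close> followed by reindexing the triangle b \<le> a \<le> m.\<close>

lemma analytic_op_comp: assumes P: "stochastic P" and T: "analytic_op P T" and S: "analytic_op P S" shows "analytic_op P (T \<circ> S)"
  unfolding analytic_op_def fourier_def
proof (intro conjI ballI allI bounded_op_comp(1) analytic_op_bounded_op T S)
  fix \<xi> m i k assume x: "\<xi> \<in> fock P"
  have SF: "\<And>\<xi>. \<xi> \<in> fock P \<Longrightarrow> S \<xi> \<in> fock P" using bounded_opD(2)[OF analytic_op_bounded_op[OF S]] .
  note TA = analytic_op_arv[OF T] and SA = analytic_op_arv[OF S]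
  have Sa: "S \<xi> a = (\<lambda>i j. \<Sum>b\<le>a. U P (a - b) b (S vac (a - b)) (\<xi> b) i j)" if "\<xi> \<in> fock P" for \<xi> a
    by (intro ext) (rule analytic_op_fourier[OF S that])
  have Ua: "U P (a - b) b (S vac (a - b)) (\<xi> b) \<in> arv P a" if "b \<le> a" for a b
    using U_arv[OF P SA fock_slice(1)[OF x], of "a - b" b] that by simp
  have L: "(T \<circ> S) \<xi> m i k = (\<Sum>a\<le>m. \<Sum>b\<le>a. U P (m - a) a (T vac (m - a)) (U P (a - b) b (S vac (a - b)) (\<xi> b)) i k)"
  proof -
    have "(T \<circ> S) \<xi> m i k = (\<Sum>a\<le>m. U P (m - a) a (T vac (m - a)) (S \<xi> a) i k)"
      using analytic_op_fourier[OF T SF[OF x], of m i k] by simp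
    also have "\<dots> = (\<Sum>a\<le>m. \<Sum>b\<le>a. U P (m - a) a (T vac (m - a)) (U P (a - b) b (S vac (a - b)) (\<xi> b)) i k)"
      unfolding Sa[OF x] by (intro sum.cong refl U_sum_right[OF P _ _ TA]) (auto intro: Ua)
    finally show ?thesis .
  qed
  have V: "(T \<circ> S) vac n = (\<lambda>i j. \<Sum>c\<le>n. U P (n - c) c (T vac (n - c)) (S vac c) i j)" for n
    using analytic_op_fourier[OF T SF[OF vac_fock], of n] by (intro ext) simp
  have Va: "U P (n - c) c (T vac (n - c)) (S vac c) \<in> arv P n" if "c \<le> n" for n c
    using U_arv[OF P TA SA, of "n - c" c] that by simp
  have "(\<Sum>b\<le>m. U P (m - b) b ((T \<circ> S) vac (m - b)) (\<xi> b) i k)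
     = (\<Sum>b\<le>m. \<Sum>c\<le>m - b. U P (m - b) b (U P (m - b - c) c (T vac (m - b - c)) (S vac c)) (\<xi> b) i k)"
    unfolding V by (intro sum.cong refl U_sum_left[OF P _ _ fock_slice(1)[OF x]]) (simp_all only: atMost_iff Va finite_atMost)
  also have "\<dots> = (\<Sum>b\<le>m. \<Sum>c\<le>m - b. U P (m - b - c) (c + b) (T vac (m - b - c)) (U P c b (S vac c) (\<xi> b)) i k)"
    using U_assoc[OF P TA SA fock_slice(1)[OF x]] by (intro sum.cong refl) (metis atMost_iff le_add_diff_inverse2)
  also have "\<dots> = (\<Sum>b\<le>m. \<Sum>a\<in>{b..m}. U P (m - a) a (T vac (m - a)) (U P (a - b) b (S vac (a - b)) (\<xi> b)) i k)"
  proof (rule sum.cong[OF refl])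
    fix b assume "b \<in> {..m}"
    then show "(\<Sum>c\<le>m - b. U P (m - b - c) (c + b) (T vac (m - b - c)) (U P c b (S vac c) (\<xi> b)) i k)
       = (\<Sum>a\<in>{b..m}. U P (m - a) a (T vac (m - a)) (U P (a - b) b (S vac (a - b)) (\<xi> b)) i k)"
      by (intro sum.reindex_bij_witness[of _ "\<lambda>a. a - b" "\<lambda>c. c + b"]) (auto simp: add.commute)
  qed
  also have "\<dots> = (\<Sum>a\<le>m. \<Sum>b\<le>a. U P (m - a) a (T vac (m - a)) (U P (a - b) b (S vac (a - b)) (\<xi> b)) i k)"
    by (simp add: sum.Sigma) (rule sum.reindex_bij_witness[of _ prod.swap prod.swap], auto)
  finally show "(T \<circ> S) \<xi> m i k = (\<Sum>a\<le>m. U P (m - a) a ((T \<circ> S) vac (m - a)) (\<xi> a) i k)" using L by simp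
qed

lemma LIMSEQ_null_comparison:
  fixes f :: "nat \<Rightarrow> complex"
  assumes "\<And>n. norm (f n) \<le> g n" "g \<longlonglongrightarrow> 0" shows "f \<longlonglongrightarrow> 0"
  by (rule Lim_null_comparison[OF _ assms(2)]) (simp add: assms(1))

text \<open>Norm convergence implies convergence of every single entry, and the Fourier identity for
  a given entry is a finite sum.\<close>

lemma analytic_op_lim:
  assumes P: "stochastic P" and Ts: "\<And>k. analytic_op P (Ts k)" and T: "bounded_op P T"
    and lim: "(\<lambda>k. opnorm P (op_diff (Ts k) T)) \<longlonglongrightarrow> 0"
  shows "analytic_op P T"
  unfolding analytic_op_def fourier_def
proof (intro conjI ballI allI T)
  fix \<xi> m i k assume x: "\<xi> \<in> fock P"
  have B: "bounded_op P (op_diff (Ts n) T)" for n by (rule bounded_op_diff(1)[OF analytic_op_bounded_op[OF Ts] T])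
  let ?e = "\<lambda>n. opnorm P (op_diff (Ts n) T)"
  have C: "(\<lambda>n. Ts n \<xi> m i k) \<longlonglongrightarrow> T \<xi> m i k" if "\<xi> \<in> fock P" for \<xi> m i k
  proof -
    have "cmod (Ts n \<xi> m i k - T \<xi> m i k) \<le> ?e n * fnorm \<xi>" for n
      using order_trans[OF fock_component[OF bounded_opD(2)[OF B that]] opnorm_bound[OF B that]] by (simp add: op_diff_def)
    moreover have "(\<lambda>n. ?e n * fnorm \<xi>) \<longlonglongrightarrow> 0" using tendsto_mult_left_zero[OF lim] .
    ultimately have "(\<lambda>n. Ts n \<xi> m i k - T \<xi> m i k) \<longlonglongrightarrow> 0"
      by (rule LIMSEQ_null_comparison)
    then show ?thesis by (rule LIM_zero_cancel)
  qed
  have TA: "T vac n \<in> arv P n" for n using fock_slice(1)[OF bounded_opD(2)[OF T vac_fock]] .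
  have UC: "(\<lambda>n. U P b a (Ts n vac b) (\<xi> a) i k) \<longlonglongrightarrow> U P b a (T vac b) (\<xi> a) i k" for a b
  proof -
    let ?D = "\<lambda>n. op_diff (Ts n) T vac"
    have DA: "?D n b \<in> arv P b" for n using fock_slice(1)[OF bounded_opD(2)[OF B vac_fock]] .
    have "ab (?D n b) (?e n)" for n
      by (rule ab_mono[OF fock_slice(2)[OF bounded_opD(2)[OF B vac_fock]] opnorm_upper[OF B vac_fock vac_norm]])
    then have "cmod (U P b a (?D n b) (\<xi> a) i k) \<le> ?e n * fnorm \<xi>" for n
      by (intro U_entry_bound[OF P DA _ fock_slice(1)[OF x] fock_slice(2)[OF x]])
    then have "cmod (U P b a (Ts n vac b) (\<xi> a) i k - U P b a (T vac b) (\<xi> a) i k) \<le> ?e n * fnorm \<xi>" for n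
      using U_add_left[OF P DA[of n] TA fock_slice(1)[OF x, of a], of i k] by (simp add: op_diff_def)
    moreover have "(\<lambda>n. ?e n * fnorm \<xi>) \<longlonglongrightarrow> 0" using tendsto_mult_left_zero[OF lim] .
    ultimately have "(\<lambda>n. U P b a (Ts n vac b) (\<xi> a) i k - U P b a (T vac b) (\<xi> a) i k) \<longlonglongrightarrow> 0"
      by (rule LIMSEQ_null_comparison)
    then show ?thesis by (rule LIM_zero_cancel)
  qed
  have "(\<lambda>n. Ts n \<xi> m i k) \<longlonglongrightarrow> (\<Sum>a\<le>m. U P (m - a) a (T vac (m - a)) (\<xi> a) i k)"
    unfolding analytic_op_fourier[OF Ts x] by (intro tendsto_sum UC)
  then show "T \<xi> m i k = (\<Sum>a\<le>m. U P (m - a) a (T vac (m - a)) (\<xi> a) i k)" by (rule LIMSEQ_unique[OF C[OF x]])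
qed

lemma tensor_alg_analytic_op: assumes P: "stochastic P" and "T \<in> tensor_alg P" shows "analytic_op P T"
  using assms(2)
proof induction
  case (gen_linf a) then show ?case by (simp add: lmult_shift analytic_op_shift[OF P] diag_arv)
next
  case (gen_shift A n) then show ?case by (simp add: analytic_op_shift[OF P])
next
  case (add T S) then show ?case by (simp add: analytic_op_add[OF P])
next
  case (smul T c) then show ?case by (simp add: analytic_op_smul[OF P])
next
  case (comp T S) then show ?case by (intro analytic_op_comp[OF P])
next
  case (lim Ts T) then show ?case by (blast intro: analytic_op_lim[OF P _ adjointable_bounded_op])
qed

text \<open>The Fourier identity reconstructs an operator from its vacuum vector, so equations in
  the tensor algebra need only be checked there.\<close>

lemma analytic_op_eqI: assumes "analytic_op P T" "analytic_op P S" "\<And>n. T vac n = S vac n" shows "T = S"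
proof
  fix \<xi> show "T \<xi> = S \<xi>"
  proof (cases "\<xi> \<in> fock P")
    case True then show ?thesis by (intro ext) (simp add: analytic_op_fourier[OF assms(1)] analytic_op_fourier[OF assms(2)] assms(3))
  next
    case False then show ?thesis using bounded_opD(1)[OF analytic_op_bounded_op[OF assms(1)] False] bounded_opD(1)[OF analytic_op_bounded_op[OF assms(2)] False] by simp
  qed
qed

section \<open>Corners of the tensor algebra\<close>

lemma comp_vac: assumes "analytic_op P T" "analytic_op P S"
  shows "(T \<circ> S) vac n i k = (\<Sum>c\<le>n. U P (n - c) c (T vac (n - c)) (S vac c) i k)"
  using analytic_op_fourier[OF assms(1) bounded_opD(2)[OF analytic_op_bounded_op[OF assms(2)] vac_fock]] by simp

lemma vac_apply: "vac n i j = (if n = 0 \<and> i = j then 1 else 0)" by (simp add: vac_def)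

definition pr :: "('a \<Rightarrow> 'a \<Rightarrow> real) \<Rightarrow> 'a \<Rightarrow> 'a fop" where
  "pr P i = lmult_op P (\<lambda>x. if x = i then 1 else 0)"

definition Zm :: "('a \<Rightarrow> 'a \<Rightarrow> real) \<Rightarrow> nat \<Rightarrow> 'a \<Rightarrow> 'a \<Rightarrow> 'a mat" where
  "Zm P n i j = (\<lambda>x y. if x = i \<and> y = j then complex_of_real (1 / sqrt (mpow P n i j)) else 0)"

text \<open>The normalization in \<^const>\<open>Zm\<close> makes these shifts multiplicative: \<open>zz P n i j \<circ> zz P m j k = zz P (n + m) i k\<close>.\<close>
definition zz :: "('a \<Rightarrow> 'a \<Rightarrow> real) \<Rightarrow> nat \<Rightarrow> 'a \<Rightarrow> 'a \<Rightarrow> 'a fop" where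
  "zz P n i j = shift_op P n (Zm P n i j)"

definition corner :: "('a \<Rightarrow> 'a \<Rightarrow> real) \<Rightarrow> 'a \<Rightarrow> 'a \<Rightarrow> 'a fop \<Rightarrow> 'a fop" where
  "corner P i j T = pr P i \<circ> T \<circ> pr P j"

lemma ind_linf: "(\<lambda>x. if x \<in> D then 1 else 0) \<in> linf"
  by (auto simp: linf_def bounded_iff intro!: exI[of _ 1])

lemma pr_in: "pr P i \<in> tensor_alg P"
  unfolding pr_def using ind_linf[of "{i}"] by (intro tensor_alg.gen_linf) simp

lemma assumes "stochastic P" shows Zm_arv: "Zm P n i j \<in> arv P n" and Zm_ab: "ab (Zm P n i j) (1 / sqrt (mpow P n i j))"
proof -
  show "ab (Zm P n i j) (1 / sqrt (mpow P n i j))" unfolding ab_def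
  proof
    fix y
    have "l2b (\<lambda>x. complex_of_real (1 / sqrt (mpow P n i j)) * (if x = i then 1 else 0)) (cmod (complex_of_real (1 / sqrt (mpow P n i j))) * 1)"
      by (rule l2b_scale[OF l2b_indicator])
    then have "l2b (\<lambda>x. complex_of_real (1 / sqrt (mpow P n i j)) * (if x = i then 1 else 0)) (1 / sqrt (mpow P n i j))"
      using mpow_nonneg[OF assms, of n i j] by (simp add: norm_divide)
    then show "l2b (\<lambda>x. Zm P n i j x y) (1 / sqrt (mpow P n i j))"
      by (rule l2b_dominated) (auto simp: Zm_def)
  qed
  then show "Zm P n i j \<in> arv P n" by (auto simp: arv_iff Zm_def)
qed

lemma zz_in: "stochastic P \<Longrightarrow> zz P n i j \<in> tensor_alg P"
  unfolding zz_def by (rule tensor_alg.gen_shift[OF Zm_arv])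

lemma zz_vac: "stochastic P \<Longrightarrow> zz P n i j vac m x y = (if m = n then Zm P n i j x y else 0)"
  unfolding zz_def by (simp add: shift_vac[OF _ Zm_arv])

lemma zz_opnorm: "stochastic P \<Longrightarrow> opnorm P (zz P n i j) \<le> 1 / sqrt (mpow P n i j)"
  unfolding zz_def by (rule shift_bounded_op(2)[OF _ Zm_arv Zm_ab])

lemma op_diff_in: "T \<in> tensor_alg P \<Longrightarrow> S \<in> tensor_alg P \<Longrightarrow> op_diff T S \<in> tensor_alg P"
  unfolding op_diff_alt by (intro tensor_alg.add tensor_alg.smul)

lemma corner_in: "T \<in> tensor_alg P \<Longrightarrow> corner P i j T \<in> tensor_alg P"
  unfolding corner_def by (intro tensor_alg.comp pr_in)

lemma pr_apply: "\<xi> \<in> fock P \<Longrightarrow> pr P i \<xi> n x y = (if x = i then \<xi> n x y else 0)"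
  by (simp add: pr_def lmult_op_def)

lemma tensor_alg_eqI: assumes "stochastic P" "T \<in> tensor_alg P" "S \<in> tensor_alg P"
   "\<And>n x y. T vac n x y = S vac n x y" shows "T = S"
  by (rule analytic_op_eqI[OF tensor_alg_analytic_op tensor_alg_analytic_op, OF assms(1,2,1,3)]) (intro ext assms(4))

lemma op_add_vac: "op_add T S \<xi> n x y = T \<xi> n x y + S \<xi> n x y" by (simp add: op_add_def)
lemma op_smul_vac: "op_smul c T \<xi> n x y = c * T \<xi> n x y" by (simp add: op_smul_def)
lemma op_diff_vac: "op_diff T S \<xi> n x y = T \<xi> n x y - S \<xi> n x y" by (simp add: op_diff_def)

lemma zz_0: assumes "stochastic P" shows "zz P 0 i i = pr P i"
  by (rule tensor_alg_eqI[OF assms zz_in[OF assms] pr_in])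
     (simp add: zz_vac[OF assms] Zm_def pr_apply[OF vac_fock] vac_apply)

lemma pr_opnorm: "stochastic P \<Longrightarrow> opnorm P (pr P i) \<le> 1"
  using zz_opnorm[of P 0 i i] by (simp add: zz_0)

lemma pr_left_vac: assumes "analytic_op P T" shows "(pr P i \<circ> T) vac n x y = (if x = i then T vac n x y else 0)"
  using pr_apply[OF bounded_opD(2)[OF analytic_op_bounded_op[OF assms] vac_fock]] by simp

lemma pr_right_vac: assumes P: "stochastic P" and T: "analytic_op P T"
  shows "(T \<circ> pr P j) vac n x y = (if y = j then T vac n x y else 0)"
proof -
  note pg = tensor_alg_analytic_op[OF P pr_in]
  have pv: "pr P j vac c = (if c = 0 then (\<lambda>x y. if x = j \<and> y = j then 1 else 0) else (\<lambda>x y. 0))" for c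
    by (intro ext) (simp add: pr_apply[OF vac_fock] vac_apply)
  have "(T \<circ> pr P j) vac n x y = (\<Sum>c\<le>n. if c = 0 then U P n 0 (T vac n) (\<lambda>x y. if x = j \<and> y = j then 1 else 0) x y else 0)"
    unfolding comp_vac[OF T pg] by (intro sum.cong) (auto simp: pv U_zero_right[OF P analytic_op_arv[OF T]])
  also have "\<dots> = U P n 0 (T vac n) (\<lambda>x y. if x = j \<and> y = j then 1 else 0) x y" by (simp add: sum.delta)
  also have "\<dots> = (if y = j then T vac n x y else 0)"
    using arv_supp[OF analytic_op_arv[OF T], of n x y] by (cases "n = 0") (auto simp: U_def lmul_def rmul_def)
  finally show ?thesis .
qed

lemma corner_vac: assumes P: "stochastic P" and T: "analytic_op P T"
  shows "corner P i j T vac n x y = (if x = i \<and> y = j then T vac n i j else 0)"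
proof -
  have "analytic_op P (T \<circ> pr P j)" by (rule analytic_op_comp[OF P T tensor_alg_analytic_op[OF P pr_in]])
  from pr_left_vac[OF this, of i n x y] pr_right_vac[OF P T, of j n x y]
  show ?thesis by (auto simp: corner_def)
qed

lemma zz_comp: assumes P: "stochastic P" and "mpow P n i j > 0" "mpow P m j k > 0"
  shows "zz P n i j \<circ> zz P m j k = zz P (n + m) i k"
proof (rule tensor_alg_eqI[OF P tensor_alg.comp[OF zz_in[OF P] zz_in[OF P]] zz_in[OF P]])
  fix l x y
  note g = tensor_alg_analytic_op[OF P zz_in[OF P]]
  have zv: "zz P n i j vac c = (if c = n then Zm P n i j else (\<lambda>x y. 0))" for n i j c
    by (intro ext) (simp add: zz_vac[OF P])
  have "(zz P n i j \<circ> zz P m j k) vac l x y = (\<Sum>c\<le>l. if c = m \<and> l = n + m then U P n m (Zm P n i j) (Zm P m j k) x y else 0)"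
    unfolding comp_vac[OF g g] by (intro sum.cong) (auto simp: zv U_zero_right[OF P Zm_arv[OF P]] U_zero_left[OF P Zm_arv[OF P]] U_zero_left[OF P arv_zero])
  also have "\<dots> = (if l = n + m then U P n m (Zm P n i j) (Zm P m j k) x y else 0)" by (auto simp: sum.delta)
  also have "U P n m (Zm P n i j) (Zm P m j k) x y = Zm P (n + m) i k x y"
  proof -
    have "U P n m (Zm P n i j) (Zm P m j k) x y = rt P n m x j y * (Zm P n i j x j * Zm P m j k j y)"
      unfolding U_entry[OF P Zm_arv[OF P] Zm_arv[OF P]] by (rule infsum_single) (simp add: Zm_def)
    also have "\<dots> = Zm P (n + m) i k x y"
      using assms(2,3) mpow_pos_add[OF P assms(2,3)]
      by (auto simp: Zm_def ratio_def real_sqrt_mult real_sqrt_divide simp flip: of_real_mult)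
    finally show ?thesis .
  qed
  finally show "(zz P n i j \<circ> zz P m j k) vac l x y = zz P (n + m) i k vac l x y" by (simp add: zz_vac[OF P])
qed

text \<open>The weights \<open>sqrt (mpow P n i j)\<close> turn composition of corners into multiplication of power series.\<close>
definition hat :: "('a \<Rightarrow> 'a \<Rightarrow> real) \<Rightarrow> 'a fop \<Rightarrow> 'a \<Rightarrow> 'a \<Rightarrow> complex fps" where
  "hat P T i j = Abs_fps (\<lambda>n. T vac n i j * complex_of_real (sqrt (mpow P n i j)))"

text \<open>The hypothesis \<open>single\<close> leaves j as the only intermediate vertex. The
  square root of the ratio in \<open>U\<close> times the weight of degree n is, by
  \<open>ratio_mult\<close>, the product of the weights of the two factors.\<close>

lemma hat_mult: assumes P: "stochastic P" and S: "analytic_op P S" and T: "analytic_op P T"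
  and single: "\<And>b h. h \<noteq> j \<Longrightarrow> T vac b h k = 0"
  shows "hat P (S \<circ> T) i k = hat P S i j * hat P T j k"
proof (rule fps_ext)
  fix n
  have "(S \<circ> T) vac n i k * complex_of_real (sqrt (mpow P n i k))
     = (\<Sum>c\<le>n. (S vac (n - c) i j * complex_of_real (sqrt (mpow P (n - c) i j))) * (T vac c j k * complex_of_real (sqrt (mpow P c j k))))"
    unfolding comp_vac[OF S T] sum_distrib_right
  proof (rule sum.cong[OF refl])
    fix c assume "c \<in> {..n}"
    then have n: "n - c + c = n" by simp
    have u: "U P (n - c) c (S vac (n - c)) (T vac c) i k = rt P (n - c) c i j k * (S vac (n - c) i j * T vac c j k)"
      unfolding U_entry[OF P analytic_op_arv[OF S] analytic_op_arv[OF T]] by (rule infsum_single) (simp add: single)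
    have r: "rt P (n - c) c i j k * complex_of_real (sqrt (mpow P n i k))
        = complex_of_real (sqrt (mpow P (n - c) i j)) * complex_of_real (sqrt (mpow P c j k))"
      using ratio_mult[OF P, of "n - c" c i j k] by (simp add: n flip: of_real_mult real_sqrt_mult)
    show "U P (n - c) c (S vac (n - c)) (T vac c) i k * complex_of_real (sqrt (mpow P n i k))
      = (S vac (n - c) i j * complex_of_real (sqrt (mpow P (n - c) i j))) * (T vac c j k * complex_of_real (sqrt (mpow P c j k)))"
      unfolding u using arg_cong[OF r, of "\<lambda>x. x * (S vac (n - c) i j * T vac c j k)"] by (simp only: mult_ac)
  qed
  also have "\<dots> = (\<Sum>a=0..n. (S vac a i j * complex_of_real (sqrt (mpow P a i j))) * (T vac (n - a) j k * complex_of_real (sqrt (mpow P (n - a) j k))))"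
    by (rule sum.reindex_bij_witness[of _ "\<lambda>a. n - a" "\<lambda>a. n - a"]) auto
  finally show "fps_nth (hat P (S \<circ> T) i k) n = fps_nth (hat P S i j * hat P T j k) n"
    by (simp add: hat_def fps_mult_nth)
qed

section \<open>Density of the elements of finite degree\<close>

lemma opnorm_diff_self: assumes "bounded_op P T" shows "opnorm P (op_diff T T) = 0"
proof -
  have "op_diff T T = (\<lambda>\<xi>. fzero)" by (simp add: op_diff_def fzero_def)
  then have "opnorm P (op_diff T T) \<le> 0" by (intro opnorm_le) (auto simp: fnorm_fzero)
  then show ?thesis using opnorm_nonneg[OF bounded_op_diff(1)[OF assms assms]] by simp
qed

text \<open>Generators have finite degree, finite degree survives sums and products, and a limit is
  approximated through one of its approximants.\<close>

lemma tensor_alg_approx: assumes P: "stochastic P" and "T \<in> tensor_alg P" and "\<epsilon> > 0"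
  shows "\<exists>S\<in>tensor_alg P. (\<exists>N. \<forall>n\<ge>N. \<forall>i j. S vac n i j = 0) \<and> opnorm P (op_diff T S) < \<epsilon>"
  using assms(2,3)
proof (induction arbitrary: \<epsilon>)
  case (gen_linf a)
  have "lmult_op P a \<in> tensor_alg P" using tensor_alg.gen_linf[OF gen_linf(1)] .
  moreover have "\<forall>n\<ge>1. \<forall>i j. lmult_op P a vac n i j = 0" by (simp add: lmult_op_def vac_fock) (simp add: vac_def)
  ultimately show ?case using opnorm_diff_self[OF analytic_op_bounded_op[OF tensor_alg_analytic_op[OF P]]] gen_linf(2) by metis
next
  case (gen_shift A n)
  have "shift_op P n A \<in> tensor_alg P" using tensor_alg.gen_shift[OF gen_shift(1)] .
  moreover have "\<forall>m\<ge>Suc n. \<forall>i j. shift_op P n A vac m i j = 0" by (simp add: shift_vac[OF P gen_shift(1)])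
  ultimately show ?case using opnorm_diff_self[OF analytic_op_bounded_op[OF tensor_alg_analytic_op[OF P]]] gen_shift(2) by metis
next
  case (add T S)
  obtain T' N where T': "T' \<in> tensor_alg P" "\<forall>n\<ge>N. \<forall>i j. T' vac n i j = 0" "opnorm P (op_diff T T') < \<epsilon>/2"
    using add.IH(1)[of "\<epsilon>/2"] add.prems by auto
  obtain S' M where S': "S' \<in> tensor_alg P" "\<forall>n\<ge>M. \<forall>i j. S' vac n i j = 0" "opnorm P (op_diff S S') < \<epsilon>/2"
    using add.IH(2)[of "\<epsilon>/2"] add.prems by auto
  have "op_diff (op_add T S) (op_add T' S') = op_add (op_diff T T') (op_diff S S')"
    by (simp add: op_diff_def op_add_def algebra_simps)
  moreover have "opnorm P \<dots> \<le> opnorm P (op_diff T T') + opnorm P (op_diff S S')"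
    by (intro bounded_op_add(2) analytic_op_bounded_op tensor_alg_analytic_op[OF P] op_diff_in add.hyps T' S')
  ultimately have "opnorm P (op_diff (op_add T S) (op_add T' S')) < \<epsilon>" using T' S' by simp
  moreover have "\<forall>n\<ge>max N M. \<forall>i j. op_add T' S' vac n i j = 0" using T'(2) S'(2) by (simp add: op_add_vac)
  ultimately show ?case using tensor_alg.add[OF T'(1) S'(1)] by blast
next
  case (smul T c)
  have "\<epsilon> / (cmod c + 1) > 0" using smul.prems by (simp add: add_nonneg_pos)
  then obtain T' N where T': "T' \<in> tensor_alg P" "\<forall>n\<ge>N. \<forall>i j. T' vac n i j = 0" "opnorm P (op_diff T T') < \<epsilon> / (cmod c + 1)"
    using smul.IH by blast
  have b: "bounded_op P (op_diff T T')" by (intro analytic_op_bounded_op tensor_alg_analytic_op[OF P] op_diff_in smul.hyps T')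
  have "op_diff (op_smul c T) (op_smul c T') = op_smul c (op_diff T T')"
    by (simp add: op_diff_def op_smul_def algebra_simps)
  then have "opnorm P (op_diff (op_smul c T) (op_smul c T')) \<le> cmod c * opnorm P (op_diff T T')"
    using bounded_op_smul(2)[OF b] by simp
  also have "\<dots> \<le> (cmod c + 1) * opnorm P (op_diff T T')" using opnorm_nonneg[OF b] by (simp add: mult_right_mono)
  also have "\<dots> < \<epsilon>" using T'(3) by (simp add: pos_less_divide_eq add_nonneg_pos mult.commute)
  finally have "opnorm P (op_diff (op_smul c T) (op_smul c T')) < \<epsilon>" .
  moreover have "\<forall>n\<ge>N. \<forall>i j. op_smul c T' vac n i j = 0" using T'(2) by (simp add: op_smul_vac)
  ultimately show ?case using tensor_alg.smul[OF T'(1)] by blast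
next
  case (comp T S)
  have bT: "bounded_op P T" and bS: "bounded_op P S" using comp.hyps by (auto intro: analytic_op_bounded_op tensor_alg_analytic_op[OF P])
  note nT = opnorm_nonneg[OF bT]
  \<comment> \<open>The right factor is approximated first, because the tolerance for the left
    factor depends on the norm of the approximant \<open>S'\<close>. The added 1 keeps the
    denominators positive.\<close>
  have "\<epsilon> / (2 * (opnorm P T + 1)) > 0" using comp.prems nT by (simp add: add_nonneg_pos)
  then obtain S' M where S': "S' \<in> tensor_alg P" "\<forall>n\<ge>M. \<forall>i j. S' vac n i j = 0" "opnorm P (op_diff S S') < \<epsilon> / (2 * (opnorm P T + 1))"
    using comp.IH(2) by blast
  have gS': "analytic_op P S'" by (rule tensor_alg_analytic_op[OF P S'(1)])
  note bS' = analytic_op_bounded_op[OF gS'] and nS' = opnorm_nonneg[OF analytic_op_bounded_op[OF gS']]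
  have "\<epsilon> / (2 * (opnorm P S' + 1)) > 0" using comp.prems nS' by (simp add: add_nonneg_pos)
  then obtain T' N where T': "T' \<in> tensor_alg P" "\<forall>n\<ge>N. \<forall>i j. T' vac n i j = 0" "opnorm P (op_diff T T') < \<epsilon> / (2 * (opnorm P S' + 1))"
    using comp.IH(1) by blast
  have gT': "analytic_op P T'" by (rule tensor_alg_analytic_op[OF P T'(1)])
  have bd: "bounded_op P (op_diff S S')" "bounded_op P (op_diff T T')" by (intro analytic_op_bounded_op tensor_alg_analytic_op[OF P] op_diff_in comp.hyps T' S')+
  have "op_diff (T \<circ> S) (T' \<circ> S') = op_add (T \<circ> op_diff S S') (op_diff T T' \<circ> S')"
  proof
    fix \<xi>
    have Tf: "T fzero = fzero" using bounded_opD(4)[OF bT fock_fzero, of 0] by (simp add: fsc_def fzero_def)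
    show "op_diff (T \<circ> S) (T' \<circ> S') \<xi> = op_add (T \<circ> op_diff S S') (op_diff T T' \<circ> S') \<xi>"
    proof (cases "\<xi> \<in> fock P")
      case True
      have "T (op_diff S S' \<xi>) = fadd (T (S \<xi>)) (fsc (-1) (T (S' \<xi>)))"
        using bounded_opD(2)[OF bS True] bounded_opD(2)[OF bS' True] by (simp add: op_diff_alt op_add_alt op_smul_alt bounded_opD(3)[OF bT] bounded_opD(4)[OF bT] fock_fsc)
      then show ?thesis by (simp add: op_add_alt op_diff_def) (simp add: fadd_def fsc_def)
    next
      case False
      then have "S \<xi> = fzero" "S' \<xi> = fzero" using bounded_opD(1)[OF bS] bounded_opD(1)[OF bS'] by auto
      then show ?thesis using Tf by (simp add: op_add_def op_diff_def) (simp add: fzero_def)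
    qed
  qed
  moreover have "opnorm P \<dots> \<le> opnorm P T * opnorm P (op_diff S S') + opnorm P (op_diff T T') * opnorm P S'"
    using bounded_op_add(2)[OF bounded_op_comp(1)[OF bT bd(1)] bounded_op_comp(1)[OF bd(2) bS']] bounded_op_comp(2)[OF bT bd(1)] bounded_op_comp(2)[OF bd(2) bS'] by linarith
  moreover have "opnorm P T * opnorm P (op_diff S S') < \<epsilon> / 2"
  proof -
    have "opnorm P T * opnorm P (op_diff S S') \<le> (opnorm P T + 1) * opnorm P (op_diff S S')"
      using opnorm_nonneg[OF bd(1)] by (simp add: mult_right_mono)
    also have "\<dots> < (opnorm P T + 1) * (\<epsilon> / (2 * (opnorm P T + 1)))" using S'(3) nT by (intro mult_strict_left_mono) auto
    also have "\<dots> = \<epsilon> / 2" using nT by (simp add: field_simps)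
    finally show ?thesis .
  qed
  moreover have "opnorm P (op_diff T T') * opnorm P S' < \<epsilon> / 2"
  proof -
    have "opnorm P (op_diff T T') * opnorm P S' \<le> opnorm P (op_diff T T') * (opnorm P S' + 1)"
      using opnorm_nonneg[OF bd(2)] by (simp add: mult_left_mono)
    also have "\<dots> < (\<epsilon> / (2 * (opnorm P S' + 1))) * (opnorm P S' + 1)" using T'(3) nS' by (intro mult_strict_right_mono) auto
    also have "\<dots> = \<epsilon> / 2" using nS' by (simp add: field_simps)
    finally show ?thesis .
  qed
  ultimately have "opnorm P (op_diff (T \<circ> S) (T' \<circ> S')) < \<epsilon>" by simp
  moreover have "\<forall>n\<ge>N + M. \<forall>i j. (T' \<circ> S') vac n i j = 0"
  proof (intro allI impI)
    fix n i j assume n: "N + M \<le> n"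
    have "U P (n - c) c (T' vac (n - c)) (S' vac c) i j = 0" for c
    proof (cases "M \<le> c")
      case True
      then have "S' vac c = (\<lambda>i j. 0)" using S'(2) by (intro ext) simp
      then show ?thesis by (simp add: U_zero_right[OF P analytic_op_arv[OF gT']])
    next
      case False
      then have "T' vac (n - c) = (\<lambda>i j. 0)" using T'(2) n by (intro ext) simp
      then show ?thesis by (simp add: U_zero_left[OF P analytic_op_arv[OF gS']])
    qed
    then show "(T' \<circ> S') vac n i j = 0" by (simp add: comp_vac[OF gT' gS'] del: comp_apply)
  qed
  ultimately show ?case using tensor_alg.comp[OF T'(1) S'(1)] by blast
next
  case (lim Ts T)
  have bT: "bounded_op P T" by (rule adjointable_bounded_op[OF lim.hyps(2)])
  obtain k where k: "opnorm P (op_diff (Ts k) T) < \<epsilon>/2"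

    using LIMSEQ_D[OF lim.hyps(3), of "\<epsilon>/2"] lim.prems by (metis abs_less_iff diff_zero half_gt_zero order_refl real_norm_def)
  obtain S N where S: "S \<in> tensor_alg P" "\<forall>n\<ge>N. \<forall>i j. S vac n i j = 0" "opnorm P (op_diff (Ts k) S) < \<epsilon>/2"
    using lim.IH[of "\<epsilon>/2" k] lim.prems by auto
  have bS: "bounded_op P S" and bk: "bounded_op P (Ts k)" by (intro analytic_op_bounded_op tensor_alg_analytic_op[OF P] S lim.hyps)+
  have "op_diff T S = op_add (op_smul (-1) (op_diff (Ts k) T)) (op_diff (Ts k) S)"
    by (simp add: op_diff_def op_add_def op_smul_def)
  then have "opnorm P (op_diff T S) \<le> opnorm P (op_diff (Ts k) T) + opnorm P (op_diff (Ts k) S)"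
    using bounded_op_add(2)[OF bounded_op_smul(1)[OF bounded_op_diff(1)[OF bk bT], of "-1"] bounded_op_diff(1)[OF bk bS]] bounded_op_smul(2)[OF bounded_op_diff(1)[OF bk bT], of "-1"] by simp
  then have "opnorm P (op_diff T S) < \<epsilon>" using k S by linarith
  then show ?case using S by blast
qed

text \<open>A corner of an element of finite degree is a finite combination of the monomials
  \<open>zz P n i j\<close>, and compression to a corner does not increase norms, so density extends
  the vanishing to all T. Identities between linear expressions in an isomorphism are proved by
  applying this to the difference of the two sides.\<close>

lemma corner_functional_zero:
  fixes f :: "'a fop \<Rightarrow> complex"
  assumes P: "stochastic P"
    and add: "\<And>T S. T \<in> tensor_alg P \<Longrightarrow> S \<in> tensor_alg P \<Longrightarrow> f (op_add T S) = f T + f S"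
    and smul: "\<And>T c. T \<in> tensor_alg P \<Longrightarrow> f (op_smul c T) = c * f T"
    and bnd: "\<And>T. T \<in> tensor_alg P \<Longrightarrow> cmod (f T) \<le> K * opnorm P T"
    and zero: "\<And>n. mpow P n i j > 0 \<Longrightarrow> f (zz P n i j) = 0"
    and T: "T \<in> tensor_alg P"
  shows "f (corner P i j T) = 0"
proof -
  have fin: "f (corner P i j S) = 0" if S: "S \<in> tensor_alg P" and N: "\<forall>n\<ge>N. \<forall>i j. S vac n i j = 0" for S and N :: nat
  proof -
    \<comment> \<open>The partial sums of the corner of S: the square root undoes the normalization
      of \<open>Zm\<close>, and the start is the zero operator written as an element of the
      algebra.\<close>
    define X where "X = rec_nat (op_smul 0 (pr P i)) (\<lambda>n Y. op_add Y (op_smul (S vac n i j * complex_of_real (sqrt (mpow P n i j))) (zz P n i j)))"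
    have X0: "X 0 = op_smul 0 (pr P i)" and XS: "X (Suc n) = op_add (X n) (op_smul (S vac n i j * complex_of_real (sqrt (mpow P n i j))) (zz P n i j))" for n
      by (simp_all add: X_def)
    have Xin: "X n \<in> tensor_alg P" for n
      by (induction n) (auto simp: X0 XS intro!: tensor_alg.smul tensor_alg.add pr_in zz_in[OF P])
    have Xf: "f (X n) = 0" for n
    proof (induction n)
      case (Suc n)
      show ?case
      proof (cases "mpow P n i j = 0")
        case True then show ?thesis by (simp add: XS add Xin smul tensor_alg.smul zz_in[OF P] Suc)
      next
        case False then show ?thesis using zero[of n] mpow_neq0[OF P] by (simp add: XS add Xin smul tensor_alg.smul zz_in[OF P] Suc)
      qed
    qed (simp add: X0 smul pr_in)
    have Sg: "analytic_op P S" by (rule tensor_alg_analytic_op[OF P S])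
    have Xv: "X n vac m x y = (if m < n \<and> x = i \<and> y = j then S vac m i j else 0)" for n m x y
    proof (induction n)
      case (Suc n)
      have "S vac n i j = 0" if "mpow P n i j = 0" using arv_supp[OF analytic_op_arv[OF Sg] that] .
      then show ?case using Suc mpow_nonneg[OF P, of n i j]
        by (auto simp: XS op_add_vac op_smul_vac zz_vac[OF P] Zm_def less_Suc_eq)
    qed (simp add: X0 op_smul_vac)
    have "corner P i j S = X N"
      by (rule tensor_alg_eqI[OF P corner_in[OF S] Xin]) (use N in \<open>auto simp: corner_vac[OF P Sg] Xv not_less\<close>)
    then show ?thesis using Xf by simp
  qed
  have B: "cmod (f (corner P i j T)) \<le> \<bar>K\<bar> * \<epsilon>" if "\<epsilon> > 0" for \<epsilon>
  proof -
    obtain S N where S: "S \<in> tensor_alg P" "\<forall>n\<ge>N. \<forall>i j. S vac n i j = 0" "opnorm P (op_diff T S) < \<epsilon>"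
      using tensor_alg_approx[OF P T \<open>\<epsilon> > 0\<close>] by blast
    let ?D = "op_diff T S"
    have D: "?D \<in> tensor_alg P" by (rule op_diff_in[OF T S(1)])
    have g: "analytic_op P T" "analytic_op P S" "analytic_op P ?D" using T S D by (auto intro: tensor_alg_analytic_op[OF P])
    have eq: "corner P i j T = op_add (corner P i j S) (corner P i j ?D)"
      by (rule tensor_alg_eqI[OF P]) (auto intro!: corner_in tensor_alg.add T S D simp: corner_vac[OF P] g op_add_vac op_diff_vac)
    have b: "bounded_op P ?D" "bounded_op P (pr P i)" "bounded_op P (pr P j)" by (intro analytic_op_bounded_op tensor_alg_analytic_op[OF P] D pr_in)+
    have "opnorm P (corner P i j ?D) \<le> opnorm P (pr P i) * opnorm P ?D * opnorm P (pr P j)"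
      unfolding corner_def using bounded_op_comp(2)[OF bounded_op_comp(1)[OF b(2,1)] b(3)] bounded_op_comp(2)[OF b(2,1)] opnorm_nonneg[OF b(3)]
      by (meson mult_right_mono order_trans)
    also have "\<dots> \<le> 1 * opnorm P ?D * 1"
      using pr_opnorm[OF P] opnorm_nonneg b by (intro mult_mono) auto
    finally have n: "opnorm P (corner P i j ?D) \<le> opnorm P ?D" by simp
    have "f (corner P i j T) = f (corner P i j ?D)" unfolding eq using fin[OF S(1,2)] by (simp add: add corner_in S D)
    then have "cmod (f (corner P i j T)) \<le> K * opnorm P (corner P i j ?D)" using bnd[OF corner_in[OF D]] by simp
    also have "\<dots> \<le> \<bar>K\<bar> * opnorm P (corner P i j ?D)"
      using opnorm_nonneg[OF analytic_op_bounded_op[OF tensor_alg_analytic_op[OF P corner_in[OF D]]]] by (intro mult_right_mono) auto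
    also have "\<dots> \<le> \<bar>K\<bar> * \<epsilon>" using n S(3) by (intro mult_left_mono) auto
    finally show ?thesis .
  qed
  have C: "cmod (f (corner P i j T)) \<le> \<bar>K\<bar> * (\<epsilon> / (\<bar>K\<bar> + 1))" if "\<epsilon> > 0" for \<epsilon>
    by (rule B, rule divide_pos_pos[OF that]) simp
  have D: "\<bar>K\<bar> * (\<epsilon> / (\<bar>K\<bar> + 1)) \<le> \<epsilon>" if "\<epsilon> > 0" for \<epsilon> using that by (simp add: field_simps)
  have "cmod (f (corner P i j T)) \<le> 0"
  proof (rule field_le_epsilon)
    fix e :: real assume "e > 0"
    from order_trans[OF C[OF this] D[OF this]] show "cmod (f (corner P i j T)) \<le> 0 + e" by simp
  qed
  then show ?thesis by simp
qed

section \<open>Permutations and gauge automorphisms\<close>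

text \<open>Supports determine the modules and ratios determine the products, which is why this is
  the common form of the three conditions. It does not determine the entries: replacing P_ij by P_ij
  h_j / h_i for a positive harmonic h leaves all ratios unchanged. This freedom disappears only for
  recurrent matrices.\<close>

definition same_ratios :: "('a \<Rightarrow> 'a \<Rightarrow> real) \<Rightarrow> ('a \<Rightarrow> 'a \<Rightarrow> real) \<Rightarrow> ('a \<Rightarrow> 'a) \<Rightarrow> bool" where
  "same_ratios P Q \<sigma> \<longleftrightarrow> bij \<sigma> \<and> (\<forall>n i j. mpow P n i j = 0 \<longleftrightarrow> mpow Q n (\<sigma> i) (\<sigma> j) = 0)
    \<and> (\<forall>n m i j k. ratio P n m i j k = ratio Q n m (\<sigma> i) (\<sigma> j) (\<sigma> k))"

text \<open>For \<open>z = 1\<close> this permutes the vertices, for \<open>\<tau> = id\<close> it is the gauge unitary.\<close>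
definition W :: "complex \<Rightarrow> ('a \<Rightarrow> 'a) \<Rightarrow> 'a fvec \<Rightarrow> 'a fvec" where
  "W z \<tau> \<xi> = (\<lambda>n i j. z ^ n * \<xi> n (\<tau> i) (\<tau> j))"

text \<open>Conjugation by the unitary \<open>W z (inv \<sigma>)\<close>; for |z| = 1 its inverse is
  \<open>W (cnj z) \<sigma>\<close>.\<close>

definition conjop :: "complex \<Rightarrow> ('a \<Rightarrow> 'a) \<Rightarrow> 'a fop \<Rightarrow> 'a fop" where
  "conjop z \<sigma> T = W z (inv \<sigma>) \<circ> T \<circ> W (cnj z) \<sigma>"

lemma W_W: "W z \<tau> (W w \<sigma> \<xi>) = W (z * w) (\<sigma> \<circ> \<tau>) \<xi>" by (simp add: W_def power_mult_distrib mult.assoc)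
lemma W_1: "W 1 id \<xi> = \<xi>" by (simp add: W_def)
lemma W_fadd: "W z \<tau> (fadd \<xi> \<eta>) = fadd (W z \<tau> \<xi>) (W z \<tau> \<eta>)" by (simp add: W_def fadd_def distrib_left)

lemma fcolsq_W: assumes "bij \<tau>" "cmod z = 1" shows "fcolsq (W z \<tau> \<xi>) j = fcolsq \<xi> (\<tau> j)"
proof -
  have b: "bij (map_prod id \<tau> :: nat \<times> 'a \<Rightarrow> nat \<times> 'a)" using assms(1) by (intro bij_betw_map_prod[of id UNIV UNIV \<tau> UNIV UNIV, simplified]) auto
  have "fcolsq (W z \<tau> \<xi>) j = infsum (\<lambda>p. (\<lambda>p. (cmod (\<xi> (fst p) (snd p) (\<tau> j)))\<^sup>2) (map_prod id \<tau> p)) UNIV"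
    unfolding fcolsq_alt by (intro infsum_cong) (simp add: W_def norm_mult norm_power assms(2))
  also have "\<dots> = fcolsq \<xi> (\<tau> j)" unfolding fcolsq_alt by (rule infsum_reindex_bij_betw[OF b])
  finally show ?thesis .
qed

lemma fip_W: assumes "bij \<tau>" "cmod z = 1" shows "fip (W z \<tau> \<xi>) (W z \<tau> \<eta>) j = fip \<xi> \<eta> (\<tau> j)"
proof -
  have b: "bij (map_prod id \<tau> :: nat \<times> 'a \<Rightarrow> nat \<times> 'a)" using assms(1) by (intro bij_betw_map_prod[of id UNIV UNIV \<tau> UNIV UNIV, simplified]) auto
  have zc: "cnj (z ^ n) * z ^ n = 1" for n
    using assms(2) complex_norm_square[of "z ^ n"] by (simp add: norm_power mult.commute)
  have e: "cnj (z ^ n * x) * (z ^ n * y) = cnj x * y" for n x y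
    using arg_cong[OF zc[of n], of "\<lambda>w. w * (cnj x * y)"] by (simp add: mult_ac)
  have "fip (W z \<tau> \<xi>) (W z \<tau> \<eta>) j = infsum (\<lambda>p. (\<lambda>p. cnj (\<xi> (fst p) (snd p) (\<tau> j)) * \<eta> (fst p) (snd p) (\<tau> j)) (map_prod id \<tau> p)) UNIV"
    unfolding fip_alt by (intro infsum_cong) (simp only: W_def e fst_map_prod snd_map_prod id_apply)
  also have "\<dots> = fip \<xi> \<eta> (\<tau> j)" unfolding fip_alt by (rule infsum_reindex_bij_betw[OF b])
  finally show ?thesis .
qed

lemma fnorm_W: assumes "bij \<tau>" "cmod z = 1" shows "fnorm (W z \<tau> \<xi>) = fnorm \<xi>"
proof -
  have "range (fcolsq (W z \<tau> \<xi>)) = range (fcolsq \<xi>)"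
    unfolding fcolsq_W[OF assms, abs_def] using bij_is_surj[OF assms(1)] by (metis image_image)
  then show ?thesis by (simp add: fnorm_def)
qed

lemma mb_W: assumes "bij \<tau>" "cmod z = 1" "mb \<xi> b" shows "mb (W z \<tau> \<xi>) b"
  unfolding mb_def
proof
  fix j
  have "inj (map_prod id \<tau> :: nat \<times> 'a \<Rightarrow> nat \<times> 'a)" using assms(1) by (intro prod.inj_map) (auto simp: bij_def)
  from l2b_inj[OF mbD[OF assms(3), of "\<tau> j"] this]
  have "l2b (\<lambda>p. \<xi> (fst p) (\<tau> (snd p)) (\<tau> j)) b" by simp
  then show "l2b (\<lambda>p. W z \<tau> \<xi> (fst p) (snd p) j) b"
    by (rule l2b_dominated) (simp add: W_def norm_mult norm_power assms(2))
qed

lemma same_ratios_inv: assumes "same_ratios P Q \<sigma>" shows "same_ratios Q P (inv \<sigma>)"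
  using assms unfolding same_ratios_def by (metis bij_imp_bij_inv bij_inv_eq_iff)

lemma vac_W: assumes "bij \<tau>" shows "W z \<tau> vac = vac"
  using assms by (auto simp: W_def vac_def fun_eq_iff bij_def inj_def)

locale transport =
  fixes P Q :: "'a \<Rightarrow> 'a \<Rightarrow> real" and \<sigma> :: "'a \<Rightarrow> 'a" and z :: complex
  assumes P: "stochastic P" and Q: "stochastic Q" and c: "same_ratios P Q \<sigma>" and z: "cmod z = 1"
begin

abbreviation "\<tau> \<equiv> inv \<sigma>"

lemma bs: "bij \<sigma>" and bt: "bij \<tau>" using c by (auto simp: same_ratios_def bij_imp_bij_inv)
lemma st [simp]: "\<sigma> (\<tau> x) = x" "\<tau> (\<sigma> x) = x" using bs by (simp_all add: bij_is_surj surj_f_inv_f bij_is_inj)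
lemma comps [simp]: "\<sigma> \<circ> \<tau> = id" "\<tau> \<circ> \<sigma> = id" by auto
lemma zz1 [simp]: "z * cnj z = 1" "cnj z * z = 1" using z complex_norm_square[of z] by (simp_all add: mult.commute)
lemma zc: "cmod (cnj z) = 1" using z by simp
lemma supp: "mpow P n (\<tau> i) (\<tau> j) = 0 \<longleftrightarrow> mpow Q n i j = 0" using c by (simp add: same_ratios_def)
lemma supp': "mpow Q n (\<sigma> i) (\<sigma> j) = 0 \<longleftrightarrow> mpow P n i j = 0" using c by (simp add: same_ratios_def)
lemma ratio_eq: "ratio Q n m i j k = ratio P n m (\<tau> i) (\<tau> j) (\<tau> k)" using c by (simp add: same_ratios_def)

lemma Winv: "W (cnj z) \<sigma> (W z \<tau> \<xi>) = \<xi>" "W z \<tau> (W (cnj z) \<sigma> \<xi>) = \<xi>" by (simp_all add: W_W W_1)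

lemma arv_perm: assumes "A \<in> arv P n" shows "(\<lambda>i j. A (\<tau> i) (\<tau> j)) \<in> arv Q n"
proof -
  obtain a where a: "ab A a" using assms by (auto simp: arv_iff)
  have "l2b (\<lambda>i. A (\<tau> i) (\<tau> j)) a" for j using l2b_inj[OF abD[OF a] bij_is_inj[OF bt]] .
  then have "ab (\<lambda>i j. A (\<tau> i) (\<tau> j)) a" by (simp add: ab_def)
  then show ?thesis using arv_supp[OF assms] by (auto simp: arv_iff supp)
qed

text \<open>By \<open>U_entry\<close> the product sees P and Q only through their ratios, so
  relabelling the summation index suffices.\<close>

lemma U_perm: assumes A: "A \<in> arv P n" and B: "B \<in> arv P m"
  shows "U Q n m (\<lambda>i j. A (\<tau> i) (\<tau> j)) (\<lambda>i j. B (\<tau> i) (\<tau> j)) i k = U P n m A B (\<tau> i) (\<tau> k)"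
  unfolding U_entry[OF Q arv_perm[OF A] arv_perm[OF B]] U_entry[OF P A B] ratio_eq
  by (rule infsum_reindex_bij_betw[OF bt])

lemma W_fock: assumes "\<xi> \<in> fock P" shows "W z \<tau> \<xi> \<in> fock Q"
  using mb_W[OF bt z fock_mb[OF assms]] fock_supp[OF assms] by (auto simp: fock_iff W_def supp)

lemma W_fock': assumes "\<xi> \<in> fock Q" shows "W (cnj z) \<sigma> \<xi> \<in> fock P"
  using mb_W[OF bs zc fock_mb[OF assms]] fock_supp[OF assms] by (auto simp: fock_iff W_def supp')

lemma W_fock_iff: "W (cnj z) \<sigma> \<xi> \<in> fock P \<longleftrightarrow> \<xi> \<in> fock Q"
  using W_fock[of "W (cnj z) \<sigma> \<xi>"] W_fock'[of \<xi>] by (auto simp: Winv)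

lemma conjop_apply: "conjop z \<sigma> T \<xi> = W z \<tau> (T (W (cnj z) \<sigma> \<xi>))" by (simp add: conjop_def)

text \<open>Generators go to generators: in degree k the two gauge factors z^k and cnj z^(k-n) leave
  z^n, which is absorbed into the symbol.\<close>

lemma conj_shift: assumes A: "A \<in> arv P n"
  shows "conjop z \<sigma> (shift_op P n A) = shift_op Q n (\<lambda>i j. z ^ n * A (\<tau> i) (\<tau> j))"
proof (intro ext)
  fix \<xi> k i j
  show "conjop z \<sigma> (shift_op P n A) \<xi> k i j = shift_op Q n (\<lambda>i j. z ^ n * A (\<tau> i) (\<tau> j)) \<xi> k i j"
  proof (cases "\<xi> \<in> fock Q \<and> n \<le> k")
    case True
    then have x: "\<xi> \<in> fock Q" and nk: "n \<le> k" by auto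
    let ?m = "k - n"
    let ?B = "\<lambda>i j. W (cnj z) \<sigma> \<xi> ?m i j"
    have B: "W (cnj z) \<sigma> \<xi> ?m \<in> arv P ?m" by (rule fock_slice(1)[OF W_fock'[OF x]])
    have "conjop z \<sigma> (shift_op P n A) \<xi> k i j = z ^ k * U P n ?m A (W (cnj z) \<sigma> \<xi> ?m) (\<tau> i) (\<tau> j)"
      using nk by (simp add: conjop_apply shift_op_def W_fock'[OF x]) (simp add: W_def)
    also have "\<dots> = z ^ k * U Q n ?m (\<lambda>i j. A (\<tau> i) (\<tau> j)) (\<lambda>i j. W (cnj z) \<sigma> \<xi> ?m (\<tau> i) (\<tau> j)) i j"
      by (simp add: U_perm[OF A B])
    also have "(\<lambda>i j. W (cnj z) \<sigma> \<xi> ?m (\<tau> i) (\<tau> j)) = (\<lambda>i j. cnj z ^ ?m * \<xi> ?m i j)" by (simp add: W_def)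
    also have "z ^ k * U Q n ?m (\<lambda>i j. A (\<tau> i) (\<tau> j)) (\<lambda>i j. cnj z ^ ?m * \<xi> ?m i j) i j
       = z ^ k * cnj z ^ ?m * U Q n ?m (\<lambda>i j. A (\<tau> i) (\<tau> j)) (\<xi> ?m) i j"
      by (simp add: U_scale_right[OF Q arv_perm[OF A] fock_slice(1)[OF x]])
    also have "z ^ k * cnj z ^ ?m = z ^ n"
    proof -
      have "z ^ k = z ^ n * z ^ ?m" using nk by (simp flip: power_add)
      then show ?thesis by (simp add: mult.assoc flip: power_mult_distrib)
    qed
    also have "z ^ n * U Q n ?m (\<lambda>i j. A (\<tau> i) (\<tau> j)) (\<xi> ?m) i j = U Q n ?m (\<lambda>i j. z ^ n * A (\<tau> i) (\<tau> j)) (\<xi> ?m) i j"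
      by (simp add: U_scale_left[OF Q arv_perm[OF A] fock_slice(1)[OF x]])
    finally show ?thesis using x nk by (simp add: shift_op_def)
  next
    case False
    then show ?thesis by (simp add: conjop_apply shift_op_def W_fock_iff) (auto simp: fzero_def W_def)
  qed
qed

lemma conj_add: "conjop z \<sigma> (op_add T S) = op_add (conjop z \<sigma> T) (conjop z \<sigma> S)"
  by (intro ext) (simp add: conjop_apply op_add_alt W_fadd)
lemma conj_smul: "conjop z \<sigma> (op_smul c T) = op_smul c (conjop z \<sigma> T)"
  by (intro ext) (simp add: conjop_apply op_smul_def W_def mult.left_commute)
lemma conj_comp: "conjop z \<sigma> (T \<circ> S) = conjop z \<sigma> T \<circ> conjop z \<sigma> S"
  by (intro ext) (simp add: conjop_apply Winv)
lemma conj_diff: "conjop z \<sigma> (op_diff T S) = op_diff (conjop z \<sigma> T) (conjop z \<sigma> S)"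
  by (simp add: op_diff_alt conj_add conj_smul)

lemma conj_opnorm: "opnorm Q (conjop z \<sigma> T) = opnorm P T"
proof -
  have "{fnorm (conjop z \<sigma> T \<xi>) |\<xi>. \<xi> \<in> fock Q \<and> fnorm \<xi> \<le> 1} = {fnorm (T \<xi>) |\<xi>. \<xi> \<in> fock P \<and> fnorm \<xi> \<le> 1}"
  proof safe
    fix \<xi> assume "\<xi> \<in> fock Q" "fnorm \<xi> \<le> 1"
    then show "\<exists>\<xi>'. fnorm (conjop z \<sigma> T \<xi>) = fnorm (T \<xi>') \<and> \<xi>' \<in> fock P \<and> fnorm \<xi>' \<le> 1"
      by (intro exI[of _ "W (cnj z) \<sigma> \<xi>"]) (simp add: conjop_apply fnorm_W[OF bt z] fnorm_W[OF bs zc] W_fock')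
  next
    fix \<xi> assume "\<xi> \<in> fock P" "fnorm \<xi> \<le> 1"
    then show "\<exists>\<xi>'. fnorm (T \<xi>) = fnorm (conjop z \<sigma> T \<xi>') \<and> \<xi>' \<in> fock Q \<and> fnorm \<xi>' \<le> 1"
      by (intro exI[of _ "W z \<tau> \<xi>"]) (simp add: conjop_apply fnorm_W[OF bt z] W_fock Winv)
  qed
  then show ?thesis by (simp add: opnorm_def)
qed

lemma conj_adjointable: assumes "adjointable P T" shows "adjointable Q (conjop z \<sigma> T)"
proof -
  obtain S where S: "\<And>\<xi>. \<xi> \<in> fock P \<Longrightarrow> S \<xi> \<in> fock P"
    and adj: "\<And>\<xi> \<eta>. \<xi> \<in> fock P \<Longrightarrow> \<eta> \<in> fock P \<Longrightarrow> fip (T \<xi>) \<eta> = fip \<xi> (S \<eta>)"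
    by (fact adjointableE[OF assms])
  have T: "\<And>\<xi>. \<xi> \<in> fock P \<Longrightarrow> T \<xi> \<in> fock P" "\<And>\<xi>. \<xi> \<notin> fock P \<Longrightarrow> T \<xi> = fzero" using assms by (auto simp: adjointable_def)
  have A: "fip (conjop z \<sigma> T \<xi>) \<eta> = fip \<xi> (conjop z \<sigma> S \<eta>)" if "\<xi> \<in> fock Q" "\<eta> \<in> fock Q" for \<xi> \<eta>
  proof
    fix j
    have "fip (W z \<tau> (T (W (cnj z) \<sigma> \<xi>))) (W z \<tau> (W (cnj z) \<sigma> \<eta>)) j = fip (W z \<tau> (W (cnj z) \<sigma> \<xi>)) (W z \<tau> (S (W (cnj z) \<sigma> \<eta>))) j"
      unfolding fip_W[OF bt z] using adj[OF W_fock'[OF that(1)] W_fock'[OF that(2)]] by simp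
    then show "fip (conjop z \<sigma> T \<xi>) \<eta> j = fip \<xi> (conjop z \<sigma> S \<eta>) j" by (simp add: conjop_apply Winv)
  qed
  show ?thesis unfolding adjointable_def
  proof (intro conjI exI[of _ "conjop z \<sigma> S"] allI impI ballI)
    fix \<xi> assume "\<xi> \<notin> fock Q"
    then show "conjop z \<sigma> T \<xi> = fzero" using T(2) by (simp add: conjop_apply W_fock_iff) (simp add: W_def fzero_def)
  next
    show "conjop z \<sigma> T ` fock Q \<subseteq> fock Q" "conjop z \<sigma> S ` fock Q \<subseteq> fock Q"
      by (auto simp: conjop_apply intro!: W_fock T(1) S W_fock')
  qed (rule A)
qed

text \<open>The closure rules transfer one by one; the limit rule does because the conjugation
  preserves operator norms and adjointability.\<close>

lemma conj_tensor_alg: assumes "T \<in> tensor_alg P" shows "conjop z \<sigma> T \<in> tensor_alg Q"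
proof -
  have sh: "conjop z \<sigma> (shift_op P n A) \<in> tensor_alg Q" if "A \<in> arv P n" for A n
    unfolding conj_shift[OF that] by (intro tensor_alg.gen_shift arv_scale arv_perm that)
  from assms show ?thesis
  proof induction
    case (gen_linf a) then show ?case by (simp add: lmult_shift sh diag_arv)
  next
    case (gen_shift A n) then show ?case by (rule sh)
  next
    case (add T S) then show ?case by (simp add: conj_add tensor_alg.add)
  next
    case (smul T c) then show ?case by (simp add: conj_smul tensor_alg.smul)
  next
    case (comp T S) then show ?case unfolding conj_comp by (intro tensor_alg.comp)
  next
    case (lim Ts T)
    show ?case
    proof (rule tensor_alg.lim[of "\<lambda>k. conjop z \<sigma> (Ts k)"])
      show "(\<lambda>k. opnorm Q (op_diff (conjop z \<sigma> (Ts k)) (conjop z \<sigma> T))) \<longlonglongrightarrow> 0"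
        using lim.hyps(3) by (simp add: conj_opnorm flip: conj_diff)
    qed (use lim in \<open>auto intro: conj_adjointable\<close>)
  qed
qed

lemma conj_vac: "conjop z \<sigma> T vac n i j = z ^ n * T vac n (\<tau> i) (\<tau> j)"
  by (simp add: conjop_apply vac_W[OF bs]) (simp add: W_def)

lemma conj_matnorm: "matnorm Q k (\<lambda>r s. conjop z \<sigma> (M r s)) = matnorm P k M"
proof -
  have fk: "fknorm k (\<lambda>s. W w \<tau>' (\<xi> s)) = fknorm k \<xi>" if "bij \<tau>'" "cmod w = 1" for w \<tau>' and \<xi> :: "nat \<Rightarrow> 'a fvec"
  proof -
    have "range (\<lambda>j. \<Sum>s<k. fcolsq (W w \<tau>' (\<xi> s)) j) = (\<lambda>j. \<Sum>s<k. fcolsq (\<xi> s) j) ` range \<tau>'"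
      by (simp add: fcolsq_W[OF that] image_image)
    then show ?thesis using bij_is_surj[OF that(1)] by (simp add: fknorm_def)
  qed
  have fm: "fknorm k (\<lambda>r n i j. \<Sum>s<k. conjop z \<sigma> (M r s) (\<xi> s) n i j)
     = fknorm k (\<lambda>r n i j. \<Sum>s<k. M r s (W (cnj z) \<sigma> (\<xi> s)) n i j)" for \<xi>
  proof -
    have "(\<lambda>r n i j. \<Sum>s<k. conjop z \<sigma> (M r s) (\<xi> s) n i j)
      = (\<lambda>r. W z \<tau> (\<lambda>n i j. \<Sum>s<k. M r s (W (cnj z) \<sigma> (\<xi> s)) n i j))"
      by (intro ext) (simp only: conjop_apply, simp only: W_def[of z \<tau>] sum_distrib_left)
    then show ?thesis using fk[OF bt z, of "\<lambda>r n i j. \<Sum>s<k. M r s (W (cnj z) \<sigma> (\<xi> s)) n i j"] by simp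
  qed
  have "{fknorm k (\<lambda>r n i j. \<Sum>s<k. conjop z \<sigma> (M r s) (\<xi> s) n i j) |\<xi>. (\<forall>s<k. \<xi> s \<in> fock Q) \<and> fknorm k \<xi> \<le> 1}
      = {fknorm k (\<lambda>r n i j. \<Sum>s<k. M r s (\<xi> s) n i j) |\<xi>. (\<forall>s<k. \<xi> s \<in> fock P) \<and> fknorm k \<xi> \<le> 1}" (is "?L = ?R")
  proof (intro equalityI subsetI)
    fix x assume "x \<in> ?L"
    then obtain \<xi> where x: "x = fknorm k (\<lambda>r n i j. \<Sum>s<k. conjop z \<sigma> (M r s) (\<xi> s) n i j)" "\<forall>s<k. \<xi> s \<in> fock Q" "fknorm k \<xi> \<le> 1" by blast
    then show "x \<in> ?R" using fk[OF bs zc, of \<xi>]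
      by (intro CollectI exI[of _ "\<lambda>s. W (cnj z) \<sigma> (\<xi> s)"]) (simp add: fm W_fock')
  next
    fix x assume "x \<in> ?R"
    then obtain \<xi> where x: "x = fknorm k (\<lambda>r n i j. \<Sum>s<k. M r s (\<xi> s) n i j)" "\<forall>s<k. \<xi> s \<in> fock P" "fknorm k \<xi> \<le> 1" by blast
    then show "x \<in> ?L" using fk[OF bt z, of \<xi>]
      by (intro CollectI exI[of _ "\<lambda>s. W z \<tau> (\<xi> s)"]) (simp add: fm W_fock Winv)
  qed
  then show ?thesis by (simp add: matnorm_def)
qed

lemma transport_inv: "transport Q P (inv \<sigma>) (cnj z)"
  by unfold_locales (use P Q same_ratios_inv[OF c] zc in auto)

lemma conj_conj_inv: "conjop (cnj z) \<tau> (conjop z \<sigma> T) = T"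
  by (intro ext) (simp add: conjop_def Winv inv_inv_eq[OF bs])
lemma conj_inv_conj: "conjop z \<sigma> (conjop (cnj z) \<tau> T) = T"
  by (intro ext) (simp add: conjop_def Winv inv_inv_eq[OF bs])

lemma conj_alg_iso: "alg_iso P Q (conjop z \<sigma>)"
  unfolding alg_iso_def
proof (intro conjI ballI allI conj_add conj_smul conj_comp)
  interpret i: transport Q P "inv \<sigma>" "cnj z" by (rule transport_inv)
  show "bij_betw (conjop z \<sigma>) (tensor_alg P) (tensor_alg Q)"
    by (rule bij_betwI[where g = "conjop (cnj z) \<tau>"])
       (auto simp: conj_conj_inv conj_inv_conj intro: conj_tensor_alg i.conj_tensor_alg)
qed

lemma conj_isometric: "isometric P Q (conjop z \<sigma>)" by (simp add: isometric_def conj_opnorm)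

lemma conj_completely_isometric: "completely_isometric P Q (conjop z \<sigma>)"
  by (simp add: completely_isometric_def conj_matnorm)

lemma conj_pr: "conjop z \<sigma> (pr P i) = pr Q (\<sigma> i)"
proof (rule tensor_alg_eqI[OF Q conj_tensor_alg[OF pr_in] pr_in])
  fix n x y
  have "\<tau> x = i \<longleftrightarrow> x = \<sigma> i" for x by (metis st)
  moreover have "\<tau> x = \<tau> y \<longleftrightarrow> x = y" by (metis st(1))
  ultimately show "conjop z \<sigma> (pr P i) vac n x y = pr Q (\<sigma> i) vac n x y"
    by (auto simp: conj_vac pr_apply[OF vac_fock] vac_apply)
qed

end

lemma transport_gauge: "stochastic P \<Longrightarrow> cmod z = 1 \<Longrightarrow> transport P P id z"
  by unfold_locales (auto simp: same_ratios_def)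

section \<open>Isometric isomorphisms\<close>

definition alg_isometry :: "('a \<Rightarrow> 'a \<Rightarrow> real) \<Rightarrow> ('a \<Rightarrow> 'a \<Rightarrow> real) \<Rightarrow> ('a fop \<Rightarrow> 'a fop) \<Rightarrow> bool" where
  "alg_isometry P Q \<phi> \<longleftrightarrow> alg_iso P Q \<phi> \<and> isometric P Q \<phi>"

definition alg_inverse :: "('a \<Rightarrow> 'a \<Rightarrow> real) \<Rightarrow> ('a fop \<Rightarrow> 'a fop) \<Rightarrow> 'a fop \<Rightarrow> 'a fop" where
  "alg_inverse P \<phi> = inv_into (tensor_alg P) \<phi>"

lemma alg_isometryD:
  assumes "alg_isometry P Q \<phi>"
  shows alg_isometry_in: "T \<in> tensor_alg P \<Longrightarrow> \<phi> T \<in> tensor_alg Q"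
    and alg_isometry_add: "T \<in> tensor_alg P \<Longrightarrow> S \<in> tensor_alg P \<Longrightarrow> \<phi> (op_add T S) = op_add (\<phi> T) (\<phi> S)"
    and alg_isometry_smul: "T \<in> tensor_alg P \<Longrightarrow> \<phi> (op_smul c T) = op_smul c (\<phi> T)"
    and alg_isometry_comp: "T \<in> tensor_alg P \<Longrightarrow> S \<in> tensor_alg P \<Longrightarrow> \<phi> (T \<circ> S) = \<phi> T \<circ> \<phi> S"
    and alg_isometry_norm: "T \<in> tensor_alg P \<Longrightarrow> opnorm Q (\<phi> T) = opnorm P T"
    and alg_isometry_eq: "T \<in> tensor_alg P \<Longrightarrow> S \<in> tensor_alg P \<Longrightarrow> \<phi> T = \<phi> S \<Longrightarrow> T = S"
    and alg_inverse_in: "T' \<in> tensor_alg Q \<Longrightarrow> alg_inverse P \<phi> T' \<in> tensor_alg P"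
    and alg_inverse_left: "T \<in> tensor_alg P \<Longrightarrow> alg_inverse P \<phi> (\<phi> T) = T"
    and alg_inverse_right: "T' \<in> tensor_alg Q \<Longrightarrow> \<phi> (alg_inverse P \<phi> T') = T'"
proof -
  have b: "bij_betw \<phi> (tensor_alg P) (tensor_alg Q)" using assms by (simp add: alg_isometry_def alg_iso_def)
  show "T \<in> tensor_alg P \<Longrightarrow> \<phi> T \<in> tensor_alg Q" by (rule bij_betwE[OF b, rule_format])
  show "T \<in> tensor_alg P \<Longrightarrow> S \<in> tensor_alg P \<Longrightarrow> \<phi> (op_add T S) = op_add (\<phi> T) (\<phi> S)"
    "T \<in> tensor_alg P \<Longrightarrow> \<phi> (op_smul c T) = op_smul c (\<phi> T)"
    "T \<in> tensor_alg P \<Longrightarrow> S \<in> tensor_alg P \<Longrightarrow> \<phi> (T \<circ> S) = \<phi> T \<circ> \<phi> S"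
    "T \<in> tensor_alg P \<Longrightarrow> opnorm Q (\<phi> T) = opnorm P T"
    using assms by (simp_all only: alg_isometry_def alg_iso_def isometric_def)
  show "T \<in> tensor_alg P \<Longrightarrow> S \<in> tensor_alg P \<Longrightarrow> \<phi> T = \<phi> S \<Longrightarrow> T = S"
    using b by (auto simp: bij_betw_def inj_on_def)
  show "T' \<in> tensor_alg Q \<Longrightarrow> alg_inverse P \<phi> T' \<in> tensor_alg P" unfolding alg_inverse_def
    using bij_betw_inv_into[OF b] bij_betwE by blast
  show "T \<in> tensor_alg P \<Longrightarrow> alg_inverse P \<phi> (\<phi> T) = T" unfolding alg_inverse_def by (rule bij_betw_inv_into_left[OF b])
  show "T' \<in> tensor_alg Q \<Longrightarrow> \<phi> (alg_inverse P \<phi> T') = T'" unfolding alg_inverse_def by (rule bij_betw_inv_into_right[OF b])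
qed

lemma alg_isometry_alg_inverse: assumes g: "alg_isometry P Q \<phi>" shows "alg_isometry Q P (alg_inverse P \<phi>)"
proof -
  note i = alg_inverse_in[OF g] and r = alg_inverse_right[OF g]
  have "bij_betw (alg_inverse P \<phi>) (tensor_alg Q) (tensor_alg P)" unfolding alg_inverse_def
    using g by (intro bij_betw_inv_into) (simp add: alg_isometry_def alg_iso_def)
  moreover have "alg_inverse P \<phi> (op_add T S) = op_add (alg_inverse P \<phi> T) (alg_inverse P \<phi> S)" if "T \<in> tensor_alg Q" "S \<in> tensor_alg Q" for T S
    by (rule alg_isometry_eq[OF g]) (simp_all add: that r i alg_isometry_add[OF g] tensor_alg.add)
  moreover have "alg_inverse P \<phi> (op_smul c T) = op_smul c (alg_inverse P \<phi> T)" if "T \<in> tensor_alg Q" for T c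
    by (rule alg_isometry_eq[OF g]) (simp_all add: that r i alg_isometry_smul[OF g] tensor_alg.smul)
  moreover have "alg_inverse P \<phi> (T \<circ> S) = alg_inverse P \<phi> T \<circ> alg_inverse P \<phi> S" if "T \<in> tensor_alg Q" "S \<in> tensor_alg Q" for T S
  proof (rule alg_isometry_eq[OF g])
    show "alg_inverse P \<phi> (T \<circ> S) \<in> tensor_alg P" by (rule i[OF tensor_alg.comp[OF that]])
    show "alg_inverse P \<phi> T \<circ> alg_inverse P \<phi> S \<in> tensor_alg P" by (rule tensor_alg.comp[OF i[OF that(1)] i[OF that(2)]])
    show "\<phi> (alg_inverse P \<phi> (T \<circ> S)) = \<phi> (alg_inverse P \<phi> T \<circ> alg_inverse P \<phi> S)"
      unfolding alg_isometry_comp[OF g i[OF that(1)] i[OF that(2)]] r[OF that(1)] r[OF that(2)]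
      by (rule r[OF tensor_alg.comp[OF that]])
  qed
  moreover have "opnorm P (alg_inverse P \<phi> T) = opnorm Q T" if "T \<in> tensor_alg Q" for T
    using alg_isometry_norm[OF g i[OF that]] r[OF that] by simp
  ultimately show ?thesis unfolding alg_isometry_def alg_iso_def isometric_def by blast
qed

lemma alg_isometry_compose: assumes f: "alg_isometry P Q \<phi>" and g: "alg_isometry Q R \<psi>" shows "alg_isometry P R (\<psi> \<circ> \<phi>)"
proof -
  have "bij_betw (\<psi> \<circ> \<phi>) (tensor_alg P) (tensor_alg R)"
    using f g by (intro bij_betw_trans) (auto simp: alg_isometry_def alg_iso_def)
  moreover have "(\<psi> \<circ> \<phi>) (T \<circ> S) = (\<psi> \<circ> \<phi>) T \<circ> (\<psi> \<circ> \<phi>) S" if "T \<in> tensor_alg P" "S \<in> tensor_alg P" for T S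
    using alg_isometry_comp[OF g alg_isometry_in[OF f that(1)] alg_isometry_in[OF f that(2)]] alg_isometry_comp[OF f that] by simp
  ultimately show ?thesis unfolding alg_isometry_def alg_iso_def isometric_def
    using alg_isometryD[OF f] alg_isometryD[OF g] by (simp del: o_assoc)
qed

section \<open>Contractive idempotents and the permutation of the vertices\<close>

lemma sum_ge_two: fixes f :: "'b \<Rightarrow> real"
  assumes "f summable_on UNIV" "\<And>x. 0 \<le> f x" "a \<noteq> b" shows "f a + f b \<le> infsum f UNIV"
  using finite_sum_le_infsum[OF assms(1), of "{a, b}"] assms by simp

definition set_proj :: "('a \<Rightarrow> 'a \<Rightarrow> real) \<Rightarrow> 'a set \<Rightarrow> 'a fop" where
  "set_proj P D = lmult_op P (\<lambda>x. if x \<in> D then 1 else 0)"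

lemma set_proj_in: "set_proj P D \<in> tensor_alg P" unfolding set_proj_def by (intro tensor_alg.gen_linf ind_linf)
lemma pr_set_proj: "pr P i = set_proj P {i}" by (simp add: pr_def set_proj_def)
lemma set_proj_vac: "set_proj P D vac n x y = (if n = 0 \<and> x = y \<and> x \<in> D then 1 else 0)"
  by (simp add: set_proj_def lmult_op_def vac_fock) (simp add: vac_apply)
lemma set_proj_inj: "set_proj P D = set_proj P D' \<Longrightarrow> D = D'"
proof (rule set_eqI)
  fix x assume "set_proj P D = set_proj P D'"
  then have "set_proj P D vac 0 x x = set_proj P D' vac 0 x x" by simp
  then show "x \<in> D \<longleftrightarrow> x \<in> D'" by (auto simp: set_proj_vac split: if_splits)
qed
lemma set_proj_comp: assumes "stochastic P" shows "set_proj P D \<circ> set_proj P D' = set_proj P (D \<inter> D')"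
proof (rule tensor_alg_eqI[OF assms tensor_alg.comp[OF set_proj_in set_proj_in] set_proj_in])
  fix n x y
  have "set_proj P D' vac \<in> fock P" by (rule bounded_opD(2)[OF analytic_op_bounded_op[OF tensor_alg_analytic_op[OF assms set_proj_in]] vac_fock])
  then have "(set_proj P D \<circ> set_proj P D') vac n x y = (if x \<in> D then 1 else 0) * set_proj P D' vac n x y"
    by (simp add: set_proj_def[of P D] lmult_op_def)
  then show "(set_proj P D \<circ> set_proj P D') vac n x y = set_proj P (D \<inter> D') vac n x y" by (simp add: set_proj_vac)
qed

text \<open>On the vacuum \<open>e\<close> of the column \<open>j\<close>, \<open>E e\<close> has the coefficient \<open>d j \<in> {0, 1}\<close> in degree \<open>0\<close>. If it is \<open>1\<close>,
  contractivity leaves no room for other coefficients; if it is \<open>0\<close>, then \<open>e\<close> and \<open>E e\<close> are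
  orthogonal and \<open>E (e + s E e) = (1 + s) E e\<close> is too long for large \<open>s\<close>.\<close>
lemma contractive_idempotent:
  assumes Q: "stochastic Q" and E: "E \<in> tensor_alg Q" and idem: "E \<circ> E = E" and n1: "opnorm Q E \<le> 1"
  shows "\<exists>D. E = set_proj Q D"
proof -
  have g: "analytic_op Q E" and gp: "\<And>j. analytic_op Q (pr Q j)" by (auto intro: tensor_alg_analytic_op[OF Q] E pr_in)
  note b = analytic_op_bounded_op[OF g]
  define d where "d j = E vac 0 j j" for j
  have dd: "d j * d j = d j" for j
  proof -
    have "(E \<circ> E) vac 0 j j = d j * d j" unfolding comp_vac[OF g g] by (simp add: U_def lmul_def d_def)
    then show ?thesis by (simp add: idem d_def)
  qed
  have key: "(d j = 0 \<longrightarrow> E vac n i j = 0) \<and> (d j = 1 \<longrightarrow> (n, i) \<noteq> (0, j) \<longrightarrow> E vac n i j = 0)" for n i j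
  proof -
    define e where "e = pr Q j vac"
    define x where "x = E e"
    have ef: "e \<in> fock Q" unfolding e_def by (rule bounded_opD(2)[OF analytic_op_bounded_op[OF gp] vac_fock])
    have ev: "e m y k = (if m = 0 \<and> y = j \<and> k = j then 1 else 0)" for m y k
      by (auto simp: e_def pr_apply[OF vac_fock] vac_apply)
    have xf: "x \<in> fock Q" unfolding x_def by (rule bounded_opD(2)[OF b ef])
    have xv: "x m y k = (if k = j then E vac m y j else 0)" for m y k
      using pr_right_vac[OF Q g, of j m y k] by (auto simp: x_def e_def)
    have Ex: "E x = x" unfolding x_def using fun_cong[OF idem, of e] by simp
    let ?f = "\<lambda>p. (cmod (E vac (fst p) (snd p) j))\<^sup>2"
    define q where "q = infsum ?f UNIV"
    have S: "?f summable_on UNIV" using l2b_summable[OF mbD[OF fock_mb[OF xf], of j]] by (simp add: xv)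
    have q0: "0 \<le> q" unfolding q_def by (rule infsum_nonneg) simp
    have qx: "q = fcolsq x j" by (simp add: q_def fcolsq_alt xv)
    have qn: "q \<le> (fnorm x)\<^sup>2" unfolding qx by (rule mb_fnorm(3)[OF fock_mb[OF xf]])
    have contr: "fnorm (E \<xi>) \<le> fnorm \<xi>" if "\<xi> \<in> fock Q" for \<xi>
      using opnorm_bound[OF b that] mult_right_mono[OF n1 fnorm_nonneg[OF that]] by simp
    show ?thesis
    proof (intro conjI impI)
      assume d0: "d j = 0"
      have "q = 0"
      proof (rule ccontr)
        assume "q \<noteq> 0"
        then have qp: "q > 0" using q0 by simp
        \<comment> \<open>The choice s = 1/q: column j of y has squared norm 1 + 1/q, while E y = (1
          + 1/q) x has squared norm at least (1 + 1/q)^2 q = (1 + 1/q)(q + 1).\<close>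
        define y where "y = fadd e (fsc (complex_of_real (1/q)) x)"
        have yf: "y \<in> fock Q" unfolding y_def by (intro fock_add fock_fsc ef xf)
        have Ey: "E y = fsc (complex_of_real (1 + 1/q)) x"
          unfolding y_def by (simp add: bounded_opD(3)[OF b] bounded_opD(4)[OF b] ef xf fock_fsc Ex flip: x_def)
             (simp add: fadd_def fsc_def distrib_right)
        have yn: "mb y (sqrt (1 + 1/q))" unfolding mb_def
        proof
          fix k
          show "l2b (\<lambda>p. y (fst p) (snd p) k) (sqrt (1 + 1/q))"
          proof (cases "k = j")
            case False
            then have "(\<lambda>p. y (fst p) (snd p) k) = (\<lambda>p. 0)" by (auto simp: y_def fadd_def fsc_def ev xv)
            then show ?thesis using l2b_mono[OF l2b_zero, of "sqrt (1 + 1/q)"] qp by simp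
          next
            case True
            let ?d = "\<lambda>p. if p = (0::nat, j) then 1 else (0::real)"
            have eq: "(cmod (y (fst p) (snd p) k))\<^sup>2 = ?d p + (1/q)\<^sup>2 * ?f p" for p
              using d0 by (cases p) (auto simp: y_def fadd_def fsc_def ev xv True d_def norm_mult norm_divide power_mult_distrib power_divide)
            have hd: "(?d has_sum 1) UNIV" by (rule has_sum_finite_neutralI[of "{(0, j)}"]) auto
            have "((\<lambda>p. ?d p + (1/q)\<^sup>2 * ?f p) has_sum (1 + (1/q)\<^sup>2 * q)) UNIV"
              by (intro has_sum_add hd has_sum_cmult_right) (use S in \<open>simp add: q_def\<close>)
            then have hs: "((\<lambda>p. (cmod (y (fst p) (snd p) k))\<^sup>2) has_sum (1 + (1/q)\<^sup>2 * q)) UNIV" by (simp only: eq)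
            have v: "1 + (1/q)\<^sup>2 * q = 1 + 1/q" using qp by (simp add: power2_eq_square)
            show ?thesis
              by (rule l2b_infsumI) (use has_sum_imp_summable[OF hs] infsumI[OF hs] v qp in auto)
          qed
        qed
        have "(1 + 1/q)\<^sup>2 * q \<le> (fnorm (E y))\<^sup>2"
        proof -
          have "fnorm (E y) = (1 + 1/q) * fnorm x" unfolding Ey fnorm_fsc[OF xf] using qp by (simp only: norm_of_real) simp
          then show ?thesis using qn by (simp add: power_mult_distrib mult_left_mono)
        qed
        also have "\<dots> \<le> (fnorm y)\<^sup>2" by (rule power_mono[OF contr[OF yf] fnorm_nonneg[OF bounded_opD(2)[OF b yf]]])
        also have "\<dots> \<le> (sqrt (1 + 1/q))\<^sup>2" by (rule power_mono[OF fnorm_le[OF yn] fnorm_nonneg[OF yf]])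
        also have "\<dots> = 1 + 1/q" using qp by simp
        finally have "(1 + 1/q) * ((1 + 1/q) * q) \<le> (1 + 1/q) * 1" by (simp add: power2_eq_square mult.assoc)
        then have "(1 + 1/q) * q \<le> 1" using qp by (simp only: mult_le_cancel_left_pos add_pos_pos divide_pos_pos zero_less_one)
        then show False using qp by (simp add: distrib_right)
      qed
      then have "?f (n, i) \<le> 0" using finite_sum_le_infsum[OF S, of "{(n, i)}"] by (simp add: q_def)
      then show "E vac n i j = 0" by simp
    next
      assume d1: "d j = 1" and ne: "(n, i) \<noteq> (0, j)"
      have "mb e 1" unfolding mb_def
      proof
        fix k show "l2b (\<lambda>p. e (fst p) (snd p) k) 1"
          by (rule l2b_dominated[OF l2b_indicator[of "(0, j)"]]) (auto simp: ev)
      qed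
      then have "fnorm x \<le> 1" using contr[OF ef] fnorm_le[of e 1] by (simp add: x_def)
      then have "q \<le> 1" using qn power_mono[of "fnorm x" 1 2] fnorm_nonneg[OF xf] by simp
      moreover have "?f (0, j) + ?f (n, i) \<le> q" unfolding q_def by (rule sum_ge_two[OF S]) (use ne in auto)
      moreover have "?f (0, j) = 1" using d1 by (simp add: d_def)
      ultimately have "?f (n, i) \<le> 0" by linarith
      then show "E vac n i j = 0" by simp
    qed
  qed
  have d01: "d j = 0 \<or> d j = 1" for j using dd[of j] by (metis mult_cancel_left2 mult.commute)
  have "E = set_proj Q {j. d j = 1}"
  proof (rule tensor_alg_eqI[OF Q E set_proj_in])
    fix n x y
    show "E vac n x y = set_proj Q {j. d j = 1} vac n x y"
      using key[of y n x] d01[of y] by (auto simp: set_proj_vac d_def)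
  qed
  then show ?thesis by blast
qed

text \<open>If x lies in D i, then D' x, being nonempty, equals {i}, and therefore D i is contained
  in {x}. The combinatorial core shared by isometric isomorphisms and by *-automorphisms of the
  diagonal.\<close>

lemma singleton_bijection:
  fixes D :: "'a \<Rightarrow> 'b set" and D' :: "'b \<Rightarrow> 'a set"
  assumes "\<And>i. D i \<noteq> {}" "\<And>x. D' x \<noteq> {}" "\<And>i x. x \<in> D i \<Longrightarrow> D' x \<subseteq> {i}" "\<And>i x. i \<in> D' x \<Longrightarrow> D i \<subseteq> {x}"
  shows "\<exists>\<sigma>. bij \<sigma> \<and> (\<forall>i. D i = {\<sigma> i})"
proof -
  have "\<exists>x. D i = {x}" for i
  proof -
    obtain x where x: "x \<in> D i" using assms(1)[of i] by blast
    then have "i \<in> D' x" using assms(2)[of x] assms(3)[OF x] by blast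
    then show ?thesis using assms(4)[of i x] x by blast
  qed
  then obtain \<sigma> where s: "\<And>i. D i = {\<sigma> i}" by metis
  have "inj \<sigma>"
  proof (rule injI)
    fix i j assume "\<sigma> i = \<sigma> j"
    then have "D' (\<sigma> i) \<subseteq> {i}" "D' (\<sigma> i) \<subseteq> {j}" using assms(3)[of "\<sigma> i" i] assms(3)[of "\<sigma> i" j] s[of i] s[of j] by simp_all
    then show "i = j" using assms(2)[of "\<sigma> i"] by blast
  qed
  moreover have "surj \<sigma>" unfolding surj_def
  proof
    fix x
    obtain i where "i \<in> D' x" using assms(2)[of x] by blast
    then show "\<exists>i. x = \<sigma> i" using assms(4)[of i x] s[of i] by blast
  qed
  ultimately show ?thesis using s by (auto simp: bij_def)
qed

lemma alg_isometry_set_proj: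
  assumes P: "stochastic P" and Q: "stochastic Q" and g: "alg_isometry P Q \<phi>"
  shows "\<exists>D. D \<noteq> {} \<and> \<phi> (pr P i) = set_proj Q D"
proof -
  have "\<exists>D. \<phi> (pr P i) = set_proj Q D"
  proof (rule contractive_idempotent[OF Q alg_isometry_in[OF g pr_in]])
    have "pr P i \<circ> pr P i = pr P i" by (simp add: pr_set_proj set_proj_comp[OF P])
    then show "\<phi> (pr P i) \<circ> \<phi> (pr P i) = \<phi> (pr P i)" using alg_isometry_comp[OF g pr_in pr_in, of i i] by simp
    show "opnorm Q (\<phi> (pr P i)) \<le> 1" using pr_opnorm[OF P] alg_isometry_norm[OF g pr_in] by simp
  qed
  then obtain D where D: "\<phi> (pr P i) = set_proj Q D" by blast
  have "D \<noteq> {}"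
  proof
    assume "D = {}"
    then have "\<phi> (pr P i) = op_smul 0 (\<phi> (pr P i))" unfolding D
      by (intro tensor_alg_eqI[OF Q set_proj_in tensor_alg.smul[OF set_proj_in]]) (simp add: set_proj_vac op_smul_vac)
    then have "pr P i = op_smul 0 (pr P i)" using alg_isometry_smul[OF g pr_in] alg_isometry_eq[OF g pr_in tensor_alg.smul[OF pr_in]] by metis
    then have "pr P i vac 0 i i = op_smul 0 (pr P i) vac 0 i i" by simp
    then show False by (simp add: op_smul_vac pr_set_proj set_proj_vac)
  qed
  then show ?thesis using D by blast
qed

text \<open>That x lies in D i is an algebraic relation, namely pr x absorbs the image of pr i. The
  inverse isomorphism turns it into the statement that D' x is contained in {i}.\<close>

lemma alg_isometry_permutation:
  assumes P: "stochastic P" and Q: "stochastic Q" and g: "alg_isometry P Q \<phi>"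
  shows "\<exists>\<sigma>. bij \<sigma> \<and> (\<forall>i. \<phi> (pr P i) = pr Q (\<sigma> i))"
proof -
  let ?\<psi> = "alg_inverse P \<phi>"
  obtain D where D: "\<And>i. D i \<noteq> {}" "\<And>i. \<phi> (pr P i) = set_proj Q (D i)" using alg_isometry_set_proj[OF P Q g] by metis
  obtain D' where D': "\<And>x. D' x \<noteq> {}" "\<And>x. ?\<psi> (pr Q x) = set_proj P (D' x)" using alg_isometry_set_proj[OF Q P alg_isometry_alg_inverse[OF g]] by metis
  have A: "D' x \<subseteq> {i}" if "x \<in> D i" for i x
  proof -
    have "pr Q x \<circ> \<phi> (pr P i) = pr Q x" unfolding D(2) unfolding pr_set_proj set_proj_comp[OF Q] using that by simp
    then have "?\<psi> (pr Q x) \<circ> pr P i = ?\<psi> (pr Q x)"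
      using alg_isometry_comp[OF alg_isometry_alg_inverse[OF g] pr_in alg_isometry_in[OF g pr_in], of x i] alg_inverse_left[OF g pr_in] by simp
    then have "set_proj P (D' x \<inter> {i}) = set_proj P (D' x)" unfolding D'(2) unfolding pr_set_proj set_proj_comp[OF P] .
    then show ?thesis using set_proj_inj by blast
  qed
  have B: "D i \<subseteq> {x}" if "i \<in> D' x" for i x
  proof -
    have "pr P i \<circ> ?\<psi> (pr Q x) = pr P i" unfolding D'(2) unfolding pr_set_proj set_proj_comp[OF P] using that by simp
    then have "\<phi> (pr P i) \<circ> pr Q x = \<phi> (pr P i)"
      using alg_isometry_comp[OF g pr_in alg_inverse_in[OF g pr_in], of i x] alg_inverse_right[OF g pr_in] by simp
    then have "set_proj Q (D i \<inter> {x}) = set_proj Q (D i)" unfolding D(2) unfolding pr_set_proj set_proj_comp[OF Q] .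
    then show ?thesis using set_proj_inj by blast
  qed
  from singleton_bijection[of D D', OF D(1) D'(1) A B]
  obtain \<sigma> where \<sigma>: "bij \<sigma>" "\<And>i. D i = {\<sigma> i}" by blast
  have "\<phi> (pr P i) = pr Q (\<sigma> i)" for i using D(2)[of i] unfolding \<sigma>(2) pr_set_proj[of Q] .
  then show ?thesis using \<sigma>(1) by blast
qed

text \<open>A Moebius transformation moves g 0 to the origin. Then h and its inverse k both fix 0,
  the Schwarz lemma for both gives |h z| = |z|, and its equality case makes h a rotation.\<close>

lemma disc_automorphism_Moebius:
  assumes f: "f holomorphic_on ball 0 1" "f ` ball 0 1 \<subseteq> ball 0 1"
    and g: "g holomorphic_on ball 0 1" "g ` ball 0 1 \<subseteq> ball 0 1"
    and fg: "\<And>z. z \<in> ball 0 1 \<Longrightarrow> f (g z) = z" and gf: "\<And>z. z \<in> ball 0 1 \<Longrightarrow> g (f z) = z"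
  shows "\<exists>\<alpha>. cmod \<alpha> = 1 \<and> (\<forall>z\<in>ball 0 1. f z = \<alpha> * ((z - g 0) / (1 - cnj (g 0) * z)))"
proof -
  define p where "p = g 0"
  have p: "cmod p < 1" using g(2) by (auto simp: p_def image_subset_iff)
  let ?M = "Moebius_function 0 (-p)" and ?N = "Moebius_function 0 p"
  have MN: "?M (?N z) = z" "?N (?M z) = z" "cmod (?M z) < 1" "cmod (?N z) < 1" if "cmod z < 1" for z
    using Moebius_function_compose[of "-p" p z] Moebius_function_compose[of p "-p" z] Moebius_function_norm_lt_1[of p z] Moebius_function_norm_lt_1[of "-p" z] p that by auto
  have hM: "?M holomorphic_on ball 0 1" "?N holomorphic_on ball 0 1" using p by (auto intro: Moebius_function_holomorphic)
  define h where "h = f \<circ> ?M"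
  define k where "k = ?N \<circ> g"
  have f1: "cmod (f z) < 1" and g1: "cmod (g z) < 1" if "cmod z < 1" for z using f(2) g(2) that by (auto simp: image_subset_iff)
  have hh: "h holomorphic_on ball 0 1" unfolding h_def
    by (rule holomorphic_on_compose_gen[OF hM(1) f(1)]) (use MN in auto)
  have kk: "k holomorphic_on ball 0 1" unfolding k_def
    by (rule holomorphic_on_compose_gen[OF g(1) hM(2)]) (use g1 in auto)
  have h0: "h 0 = 0" using fg[of 0] by (simp add: h_def Moebius_function_of_zero p_def)
  have k0: "k 0 = 0" by (simp add: k_def Moebius_function_eq_zero flip: p_def)
  have hl: "cmod (h z) < 1" and kl: "cmod (k z) < 1" if "cmod z < 1" for z using that MN f1 g1 by (auto simp: h_def k_def)
  have kh: "k (h z) = z" if "cmod z < 1" for z using that MN[OF that] gf[of "?M z"] by (simp add: h_def k_def)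
  have "cmod (h z) = cmod z" if z: "cmod z < 1" for z
    using Schwarz_Lemma(1)[OF hh h0 hl z] Schwarz_Lemma(1)[OF kk k0 kl hl[OF z]] kh[OF z] by simp
  then have "\<exists>z. cmod z < 1 \<and> z \<noteq> 0 \<and> cmod (h z) = cmod z" by (intro exI[of _ "1/2"]) simp
  then obtain \<alpha> where a: "\<And>z. cmod z < 1 \<Longrightarrow> h z = \<alpha> * z" "cmod \<alpha> = 1"
    using Schwarz_Lemma(3)[OF hh h0 hl, of 0] by auto
  have "f z = \<alpha> * ((z - p) / (1 - cnj p * z))" if "cmod z < 1" for z
  proof -
    have "f z = h (?N z)" using MN[OF that] by (simp add: h_def)
    also have "\<dots> = \<alpha> * ?N z" by (rule a(1)[OF MN(4)[OF that]])
    finally show ?thesis by (simp add: Moebius_function_simple)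
  qed
  then show ?thesis using a(2) by (auto simp: p_def)
qed

section \<open>Isomorphisms fixing the vertex projections\<close>

text \<open>Strip the loops at x from the beginning of the path. The first vertex after them differs
  from x, and from y because there is no edge from x to y.\<close>

lemma mpow_split_off_edge:
  assumes P: "stochastic P" and "P x y = 0" "mpow P m x y > 0" "m \<ge> 2"
  shows "\<exists>z a b. z \<noteq> x \<and> z \<noteq> y \<and> a + b = m \<and> mpow P a x z > 0 \<and> mpow P b z y > 0"
  using assms(3,4)
proof (induction m)
  case (Suc m)
  have "mpow P (1 + m) x y > 0" using Suc.prems(1) by (simp only: plus_1_eq_Suc)
  then obtain z where z: "mpow P 1 x z > 0" "mpow P m z y > 0" by (rule mpow_pos_split[OF P])
  have zy: "z \<noteq> y" using z(1) assms(2) by (auto simp: mpow_1)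
  show ?case
  proof (cases "z = x")
    case False
    then show ?thesis using z zy by (intro exI[of _ z] exI[of _ 1] exI[of _ m]) simp
  next
    case True
    have "m \<noteq> 1" using z(2) True assms(2) by (auto simp: mpow_1)
    then have "m \<ge> 2" using Suc.prems(2) by simp
    then obtain z' a b where *: "z' \<noteq> x" "z' \<noteq> y" "a + b = m" "mpow P a x z' > 0" "mpow P b z' y > 0"
      using Suc.IH z(2) True by blast
    have "mpow P (1 + a) x z' > 0" using mpow_pos_add[OF P z(1)] True *(4) by blast
    then show ?thesis using * by (intro exI[of _ z'] exI[of _ "1 + a"] exI[of _ b]) simp
  qed
qed simp

lemma zz_corner: assumes "stochastic P" shows "corner P i j (zz P n i j) = zz P n i j"
  by (rule tensor_alg_eqI[OF assms corner_in[OF zz_in[OF assms]] zz_in[OF assms]])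
     (simp add: corner_vac[OF assms tensor_alg_analytic_op[OF assms zz_in[OF assms]]] zz_vac[OF assms] Zm_def)

locale vertex_iso =
  fixes P Q :: "'a \<Rightarrow> 'a \<Rightarrow> real" and \<phi> :: "'a fop \<Rightarrow> 'a fop"
  assumes P: "stochastic P" and Q: "stochastic Q" and g: "alg_isometry P Q \<phi>" and pr: "\<And>i. \<phi> (pr P i) = pr Q i"
begin

abbreviation "\<psi> \<equiv> alg_inverse P \<phi>"

text \<open>The image of a monomial as a power series. For the identity isomorphism it is
  \<open>fps_X ^ n\<close> whenever the monomial is nonzero; a lower order term records a failure to
  preserve the filtration.\<close>

definition G :: "nat \<Rightarrow> 'a \<Rightarrow> 'a \<Rightarrow> complex fps" where "G n i j = hat Q (\<phi> (zz P n i j)) i j"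

lemmas gin = alg_isometry_in[OF g] and gadd = alg_isometry_add[OF g] and gsmul = alg_isometry_smul[OF g] and gcomp = alg_isometry_comp[OF g]
  and gnorm = alg_isometry_norm[OF g] and gleft = alg_inverse_left[OF g] and gright = alg_inverse_right[OF g] and giin = alg_inverse_in[OF g]

lemma inverse: "vertex_iso Q P \<psi>"
proof (unfold_locales, rule Q, rule P, rule alg_isometry_alg_inverse[OF g])
  show "\<psi> (pr Q i) = pr P i" for i using gleft[OF pr_in, of i] by (simp only: pr)
qed

lemma analytic_op_phi: "T \<in> tensor_alg P \<Longrightarrow> analytic_op Q (\<phi> T)" by (rule tensor_alg_analytic_op[OF Q gin])

lemma phi_bound: "T \<in> tensor_alg P \<Longrightarrow> cmod (\<phi> T vac n x y) \<le> opnorm P T"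
  using cf_bound[OF analytic_op_phi] gnorm by metis

lemma phi_corner: assumes T: "T \<in> tensor_alg P" shows "\<phi> (corner P i j T) = corner Q i j (\<phi> T)"
  unfolding corner_def gcomp[OF tensor_alg.comp[OF pr_in T] pr_in] gcomp[OF pr_in T] pr ..

lemma phi_zz_vac: "\<phi> (zz P n i j) vac m x y = (if x = i \<and> y = j then \<phi> (zz P n i j) vac m i j else 0)"
  using corner_vac[OF Q analytic_op_phi[OF zz_in[OF P]], of i j n i j m x y] phi_corner[OF zz_in[OF P], of i j n i j]
  by (simp add: zz_corner[OF P])

lemma G_nth: "fps_nth (G n i j) m = \<phi> (zz P n i j) vac m i j * complex_of_real (sqrt (mpow Q m i j))"
  by (simp add: G_def hat_def)

text \<open>Monomials compose by \<open>zz_comp\<close>, and since vertex projections are fixed,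
  their images stay in the same corners, so \<open>hat_mult\<close> applies.\<close>

lemma G_mult: assumes "mpow P n i j > 0" "mpow P m j k > 0" shows "G (n + m) i k = G n i j * G m j k"
proof -
  have "\<phi> (zz P (n + m) i k) = \<phi> (zz P n i j) \<circ> \<phi> (zz P m j k)"
    using zz_comp[OF P assms] gcomp[OF zz_in[OF P] zz_in[OF P]] by metis
  then show ?thesis unfolding G_def
    using hat_mult[OF Q analytic_op_phi[OF zz_in[OF P]] analytic_op_phi[OF zz_in[OF P]], of j m j k k n i j i] phi_zz_vac[of m j k] by simp
qed

lemma G_0: "G 0 i i = 1"
proof (rule fps_ext)
  fix n show "fps_nth (G 0 i i) n = fps_nth 1 n"
    unfolding G_nth zz_0[OF P] pr by (simp add: pr_set_proj set_proj_vac)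
qed

lemma G_nonzero: assumes "mpow P n i j > 0" shows "G n i j \<noteq> 0"
proof
  assume 0: "G n i j = 0"
  have "\<phi> (zz P n i j) vac m i j = 0" for m
  proof (cases "mpow Q m i j = 0")
    case True then show ?thesis by (rule arv_supp[OF analytic_op_arv[OF analytic_op_phi[OF zz_in[OF P]]]])
  next
    case False
    then show ?thesis using arg_cong[OF 0, of "\<lambda>f. fps_nth f m"] by (simp add: G_nth)
  qed
  then have "\<phi> (zz P n i j) = op_smul 0 (\<phi> (zz P n i j))"
    by (intro tensor_alg_eqI[OF Q gin tensor_alg.smul[OF gin]] zz_in[OF P]) (subst phi_zz_vac, simp add: op_smul_vac)
  then have "zz P n i j = op_smul 0 (zz P n i j)"
    using gsmul[OF zz_in[OF P]] alg_isometry_eq[OF g zz_in[OF P] tensor_alg.smul[OF zz_in[OF P]]] by metis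
  then have "zz P n i j vac n i j = op_smul 0 (zz P n i j) vac n i j" by simp
  then show False using assms by (simp add: op_smul_vac zz_vac[OF P] Zm_def)
qed

lemma G_const_offdiag: "i \<noteq> j \<Longrightarrow> fps_nth (G n i j) 0 = 0" by (simp add: G_nth)

lemma functional_ext0:
  assumes "\<And>n. mpow P n x y > 0 \<Longrightarrow> \<phi> (zz P n x y) vac m x y = 0" and T: "T \<in> tensor_alg P"
  shows "\<phi> T vac m x y = 0"
proof -
  have "\<phi> (corner P x y T) vac m x y = 0"
    by (rule corner_functional_zero[OF P, of "\<lambda>T. \<phi> T vac m x y" 1])
       (use assms phi_bound in \<open>auto simp: gadd gsmul op_add_vac op_smul_vac\<close>)
  then show ?thesis by (simp add: phi_corner[OF T] corner_vac[OF Q analytic_op_phi[OF T]])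
qed

text \<open>Paths from \<open>x\<close> to \<open>y\<close> through a third vertex have no component of degree one, also after applying \<open>\<phi>\<close>;
  so an edge of \<open>Q\<close> from \<open>x\<close> to \<open>y\<close> can only come from an edge of \<open>P\<close>.\<close>
lemma zero_edge: assumes 0: "P x y = 0" shows "Q x y = 0"
proof (rule ccontr)
  assume q: "Q x y \<noteq> 0"
  then have qp: "mpow Q 1 x y > 0" using P_nonneg[OF Q, of x y] by (simp add: mpow_1)
  have "\<phi> (zz P m x y) vac 1 x y = 0" if m: "mpow P m x y > 0" for m
  proof -
    consider "m = 0" | "m = 1" | "m \<ge> 2" by linarith
    then show ?thesis
    proof cases
      case 1
      then have "x = y" using m by (auto split: if_splits)
      then show ?thesis using 1 by (simp only: zz_0[OF P] pr) (simp add: pr_set_proj set_proj_vac)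
    next
      case 2 then show ?thesis using m 0 by (simp add: mpow_1)
    next
      case 3
      then obtain z a b where z: "z \<noteq> x" "z \<noteq> y" "a + b = m" "mpow P a x z > 0" "mpow P b z y > 0"
        using mpow_split_off_edge[OF P 0 m 3] by (elim exE conjE)
      have "fps_nth (G m x y) 1 = 0"
        using G_mult[OF z(4,5)] z G_const_offdiag[of x z a] G_const_offdiag[of z y b] by (simp add: fps_mult_nth_1)
      then show ?thesis using qp by (simp add: G_nth)
    qed
  qed
  from functional_ext0[OF this giin[OF zz_in[OF Q]], of 1 x y] have "zz Q 1 x y vac 1 x y = 0" by (simp only: gright[OF zz_in[OF Q]])
  then show False using qp by (simp add: zz_vac[OF Q] Zm_def)
qed

text \<open>By \<open>zero_edge\<close> every edge of Q is an edge of P, so every path is. The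
  reverse inclusion comes from the inverse isomorphism.\<close>

lemma supp_mono: "mpow Q n i j > 0 \<Longrightarrow> mpow P n i j > 0"
proof (induction n arbitrary: j)
  case 0 then show ?case by (auto split: if_splits)
next
  case (Suc n)
  then have "mpow Q (n + 1) i j > 0" by (simp only: Suc_eq_plus1)
  then obtain k where k: "mpow Q n i k > 0" "mpow Q 1 k j > 0" by (rule mpow_pos_split[OF Q])
  have "P k j \<noteq> 0" using zero_edge[of k j] k(2) by (auto simp: mpow_1)
  then have "mpow P 1 k j > 0" using P_nonneg[OF P, of k j] by (simp add: mpow_1)
  then show ?case using mpow_pos_add[OF P Suc.IH[OF k(1)]] by (metis Suc_eq_plus1)
qed

lemma supp: "mpow P n i j > 0 \<longleftrightarrow> mpow Q n i j > 0"
  using supp_mono[of n i j] vertex_iso.supp_mono[OF inverse, of n i j] by argo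

lemma loop_pos: assumes "P w w > 0" shows "mpow P n w w > 0"
proof (induction n)
  case (Suc n)
  have "mpow P 1 w w > 0" using assms by (simp add: mpow_1)
  from mpow_pos_add[OF P Suc.IH this] show ?case by (simp only: Suc_eq_plus1)
qed simp

lemma G_loop: assumes "P w w > 0" shows "G n w w = G 1 w w ^ n"
proof (induction n)
  case (Suc n)
  have "mpow P 1 w w > 0" using assms by (simp add: mpow_1)
  then show ?case using G_mult[OF loop_pos[OF assms, of n], of 1 w] Suc by (simp add: mult.commute)
qed (simp add: G_0)

text \<open>G depends only on end points and length, not on the route. Lengthening a route by one
  more loop at w multiplies the series by \<open>G 1 w w\<close>, by one more loop at z by
  \<open>G 1 z z\<close>; cancel the nonzero series of the route.\<close>

lemma route_loops_eq:
  assumes w: "P w w > 0" "mpow P a i w > 0" "mpow P b w k > 0"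
    and z: "P z z > 0" "mpow P c i z > 0" "mpow P d z k > 0"
  shows "G 1 w w = G 1 z z"
proof -
  have A: "G (a + (n + b)) i k = G a i w * (G 1 w w ^ n * G b w k)" if "P w w > 0" "mpow P a i w > 0" "mpow P b w k > 0" for n a b w
    using G_mult[OF that(2) mpow_pos_add[OF P loop_pos[OF that(1), of n] that(3)]]
      G_mult[OF loop_pos[OF that(1), of n] that(3)] G_loop[OF that(1), of n] by simp
  have B: "G (Suc n + (a + b)) i k = G 1 w w * G (n + (a + b)) i k" if "P w w > 0" "mpow P a i w > 0" "mpow P b w k > 0" for n a b w
    using A[OF that, of n] A[OF that, of "Suc n"] by (simp add: ac_simps)
  \<comment> \<open>A length available on both routes: with c + d loops at w on the first, with a +
    b loops at z on the second.\<close>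
  let ?M = "(a + b) + (c + d)"
  have 1: "G (Suc ?M) i k = G 1 w w * G ?M i k" using B[OF w, of "c + d"] by (simp add: ac_simps)
  have 2: "G (Suc ?M) i k = G 1 z z * G ?M i k" using B[OF z, of "a + b"] by (simp add: ac_simps)
  have "mpow P (a + ((c + d) + b)) i k > 0" using mpow_pos_add[OF P w(2) mpow_pos_add[OF P loop_pos[OF w(1)] w(3)]] .
  then have "G ?M i k \<noteq> 0" by (intro G_nonzero) (simp add: ac_simps)
  then show ?thesis using 1 2 by simp
qed

text \<open>A closed path through another vertex factors into two off-diagonal series without
  constant term, whereas every power of \<open>G 1 w w\<close> has a nonzero constant term.\<close>

lemma bad_loop_class:
  assumes w: "P w w > 0" and c: "fps_nth (G 1 w w) 0 \<noteq> 0" and "mpow P a w y > 0" "mpow P b y w > 0"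
  shows "y = w"
proof (rule ccontr)
  assume "y \<noteq> w"
  then have "fps_nth (G (a + b) w w) 0 = 0" using G_mult[OF assms(3,4)] G_const_offdiag by simp
  then show False using c by (simp add: G_loop[OF w, of "a + b"] fps_nth_power_0)
qed

text \<open>By \<open>bad_loop_class\<close> the only way to return to w is to stay there. This
  holds for Q as well because the supports agree.\<close>

lemma bad_loop_mpow:
  assumes w: "P w w > 0" and c: "fps_nth (G 1 w w) 0 \<noteq> 0"
  shows "mpow P m w w = P w w ^ m" and "mpow Q m w w = Q w w ^ m"
proof -
  have aux: "mpow R m w w = R w w ^ m" if R: "stochastic R" and s: "\<And>n i j. mpow R n i j > 0 \<longleftrightarrow> mpow P n i j > 0" for R
  proof (induction m)
    case (Suc m)
    have "mpow R m w k * R k w = 0" if "k \<noteq> w" for k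
    proof (rule ccontr)
      assume "mpow R m w k * R k w \<noteq> 0"
      then have "mpow R m w k > 0" "mpow R 1 k w > 0" using mpow_nonneg[OF R, of m w k] P_nonneg[OF R, of k w] by (auto simp: mpow_1)
      then show False using bad_loop_class[OF w c, of m k 1] that unfolding s by simp
    qed
    then have "((\<lambda>k. mpow R m w k * R k w) has_sum (mpow R m w w * R w w)) UNIV"
      by (intro has_sum_finite_neutralI[of "{w}"]) auto
    then show ?case using Suc by (simp add: infsumI)
  qed simp
  show "mpow P m w w = P w w ^ m" by (rule aux[OF P]) simp
  show "mpow Q m w w = Q w w ^ m" by (rule aux[OF Q]) (simp add: supp)
qed

end

lemma vertex_iso_compose: assumes "vertex_iso P Q \<phi>" "vertex_iso Q R \<theta>" shows "vertex_iso P R (\<theta> \<circ> \<phi>)"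
proof -
  interpret a: vertex_iso P Q \<phi> by fact
  interpret b: vertex_iso Q R \<theta> by fact
  show ?thesis by unfold_locales (use a.P b.Q alg_isometry_compose[OF a.g b.g] a.pr b.pr in auto)
qed

lemma vertex_iso_gauge: assumes "stochastic P" "cmod z = 1" shows "vertex_iso P P (conjop z id)"
proof -
  interpret t: transport P P id z by (rule transport_gauge[OF assms])
  show ?thesis by unfold_locales (use assms t.conj_alg_iso t.conj_isometric t.conj_pr in \<open>auto simp: alg_isometry_def\<close>)
qed

lemma gauge_vac:
  fixes P :: "'a \<Rightarrow> 'a \<Rightarrow> real" and T :: "'a fop"
  assumes "stochastic P" "cmod z = 1" shows "conjop z id T vac n i j = z ^ n * T vac n i j"
proof -
  interpret t: transport P P id z by (rule transport_gauge[OF assms])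
  show ?thesis using t.conj_vac[of T n i j] by simp
qed

section \<open>Loops moved by a disc automorphism\<close>

lemma fps_bounded_conv_radius:
  fixes f :: "complex fps" assumes "\<And>n. cmod (fps_nth f n) \<le> K" shows "fps_conv_radius f \<ge> 1"
  unfolding fps_conv_radius_def
proof (rule conv_radius_geI_ex')
  fix r :: real assume r: "0 < r" "ereal r < 1"
  show "summable (\<lambda>n. fps_nth f n * complex_of_real r ^ n)"
  proof (rule summable_comparison_test'[of "\<lambda>n. K * r ^ n" 0])
    show "summable (\<lambda>n. K * r ^ n)" using r by (intro summable_mult summable_geometric) simp
    show "cmod (fps_nth f n * complex_of_real r ^ n) \<le> K * r ^ n" for n
      using r assms[of n] by (simp add: norm_mult norm_power mult_right_mono)
  qed
qed

lemma ereal_lt_radius: "fps_conv_radius f \<ge> 1 \<Longrightarrow> cmod z < 1 \<Longrightarrow> ereal (cmod z) < fps_conv_radius f"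
  by (metis ereal_less(3) less_le_trans)

lemma radius_pos: "1 \<le> fps_conv_radius f \<Longrightarrow> 0 < fps_conv_radius f"
  by (rule less_le_trans[of 0 1]) simp_all

lemma fps_bounded_eval:
  fixes f :: "complex fps" assumes K: "\<And>n. cmod (fps_nth f n) \<le> K" and z: "cmod z < 1"
  shows "cmod (eval_fps f z) \<le> K / (1 - cmod z)"
proof -
  have s: "summable (\<lambda>n. K * cmod z ^ n)" using z by (intro summable_mult summable_geometric) simp
  have "norm (\<Sum>n. fps_nth f n * z ^ n) \<le> (\<Sum>n. K * cmod z ^ n)"
    by (rule norm_suminf_le[OF _ s]) (use K in \<open>simp add: norm_mult norm_power mult_right_mono\<close>)
  also have "\<dots> = K / (1 - cmod z)" using z by (simp add: suminf_mult summable_geometric suminf_geometric)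
  finally show ?thesis by (simp add: eval_fps_def)
qed

text \<open>Coefficients without the weights of \<open>hat\<close>. Where the m-th return
  probability is P w w ^ m, the weights amount to rescaling the variable; the unweighted series has
  bounded coefficients and lives on the unit disc.\<close>

definition loop_series :: "'a \<Rightarrow> 'a fop \<Rightarrow> complex fps" where "loop_series w T = Abs_fps (\<lambda>m. T vac m w w)"

lemma loop_series_radius: "analytic_op P T \<Longrightarrow> fps_conv_radius (loop_series w T) \<ge> 1"
  by (rule fps_bounded_conv_radius[of _ "opnorm P T"]) (simp add: loop_series_def cf_bound)

lemma loop_series_eval_bound: "analytic_op P T \<Longrightarrow> cmod \<zeta> < 1 \<Longrightarrow> cmod (eval_fps (loop_series w T) \<zeta>) \<le> opnorm P T / (1 - cmod \<zeta>)"
  by (rule fps_bounded_eval) (simp_all add: loop_series_def cf_bound)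

lemma loop_series_add: "loop_series w (op_add T S) = loop_series w T + loop_series w S" by (rule fps_ext) (simp add: loop_series_def op_add_vac)
lemma loop_series_smul: "loop_series w (op_smul c T) = fps_const c * loop_series w T" by (rule fps_ext) (simp add: loop_series_def op_smul_vac)

text \<open>Multiplicativity of \<open>hat\<close> divided by the weight, which is here a geometric
  sequence and therefore splits over the convolution.\<close>

lemma loop_series_mult: assumes P: "stochastic P" and S: "analytic_op P S" and T: "analytic_op P T"
  and single: "\<And>b h. h \<noteq> w \<Longrightarrow> T vac b h w = 0"
  and p: "P w w > 0" "\<And>m. mpow P m w w = P w w ^ m"
  shows "loop_series w (S \<circ> T) = loop_series w S * loop_series w T"
proof (rule fps_ext)
  fix n
  let ?s = "\<lambda>m. complex_of_real (sqrt (P w w ^ m))"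
  have "fps_nth (hat P (S \<circ> T) w w) n = fps_nth (hat P S w w * hat P T w w) n"
    using hat_mult[OF P S T single] by simp
  then have "(S \<circ> T) vac n w w * ?s n = (\<Sum>i=0..n. (S vac i w w * ?s i) * (T vac (n - i) w w * ?s (n - i)))"
    by (simp add: hat_def fps_mult_nth p(2) del: comp_apply)
  also have "\<dots> = (\<Sum>i=0..n. S vac i w w * T vac (n - i) w w) * ?s n"
    unfolding sum_distrib_right
  proof (rule sum.cong[OF refl])
    fix i assume "i \<in> {0..n}"
    then have "?s n = ?s i * ?s (n - i)" by (simp flip: of_real_mult real_sqrt_mult power_add)
    then show "(S vac i w w * ?s i) * (T vac (n - i) w w * ?s (n - i)) = S vac i w w * T vac (n - i) w w * ?s n" by simp
  qed
  finally show "fps_nth (loop_series w (S \<circ> T)) n = fps_nth (loop_series w S * loop_series w T) n"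
    using p(1) by (simp add: loop_series_def fps_mult_nth)
qed

text \<open>Evaluation of \<open>loop_series\<close> at a point of the disc is a character of the
  corner at w; this map is the action of \<phi> on these characters. The square root normalizes the
  loop, whose own series is \<open>fps_X\<close> divided by it.\<close>

definition disc_map :: "('a \<Rightarrow> 'a \<Rightarrow> real) \<Rightarrow> ('a fop \<Rightarrow> 'a fop) \<Rightarrow> 'a \<Rightarrow> complex \<Rightarrow> complex" where
  "disc_map P \<phi> w \<zeta> = complex_of_real (sqrt (P w w)) * eval_fps (loop_series w (\<phi> (zz P 1 w w))) \<zeta>"

text \<open>Staying at w is the only way back to w, so the corner at w is generated by a single
  monomial. All bad loops are of this kind by \<open>bad_loop_mpow\<close>.\<close>

locale disc_vertex_iso = vertex_iso +
  fixes w :: 'a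
  assumes p: "P w w > 0" "\<And>m. mpow P m w w = P w w ^ m" and q: "Q w w > 0" "\<And>m. mpow Q m w w = Q w w ^ m"
begin

lemma inv_disc: "disc_vertex_iso Q P \<psi> w"
  using inverse p q by (simp add: disc_vertex_iso_def disc_vertex_iso_axioms_def)

lemma analytic_op_zz: "analytic_op Q (\<phi> (zz P m w w))" by (rule analytic_op_phi[OF zz_in[OF P]])

lemma loop_series_zz: "loop_series w (\<phi> (zz P m w w)) = loop_series w (\<phi> (zz P 1 w w)) ^ m"
proof (induction m)
  case 0
  show ?case by (rule fps_ext) (simp only: loop_series_def zz_0[OF P] pr, simp add: pr_set_proj set_proj_vac)
next
  case (Suc m)
  have "zz P (Suc m) w w = zz P m w w \<circ> zz P 1 w w"
    using zz_comp[OF P, of m w w 1 w] p by (simp add: p(2)[of 1, simplified] p(2)[of m])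
  then have "\<phi> (zz P (Suc m) w w) = \<phi> (zz P m w w) \<circ> \<phi> (zz P 1 w w)" using gcomp[OF zz_in[OF P] zz_in[OF P]] by simp
  then have "loop_series w (\<phi> (zz P (Suc m) w w)) = loop_series w (\<phi> (zz P m w w)) * loop_series w (\<phi> (zz P 1 w w))"
    using loop_series_mult[OF Q analytic_op_zz[of m] analytic_op_zz[of 1], of w] phi_zz_vac[of 1 w w] q by simp
  then show ?case using Suc by (simp add: mult.commute)
qed

lemma rad: "fps_conv_radius (loop_series w (\<phi> (zz P m w w))) \<ge> 1" by (rule loop_series_radius[OF analytic_op_zz])

text \<open>The m-th power of the value is the normalized evaluation of the image of the m-th power
  of the loop, hence bounded by 1 / (1 - |\<zeta>|) for all m at once; powers of a number of modulus
  above 1 are unbounded.\<close>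

lemma disc_map_le1: assumes z: "cmod \<zeta> < 1" shows "cmod (disc_map P \<phi> w \<zeta>) \<le> 1"
proof (rule ccontr)
  assume "\<not> ?thesis"
  then have big: "cmod (disc_map P \<phi> w \<zeta>) > 1" by simp
  have "cmod (disc_map P \<phi> w \<zeta>) ^ m \<le> 1 / (1 - cmod \<zeta>)" for m
  proof -
    let ?s = "sqrt (P w w)"
    have sp: "?s > 0" using p(1) by simp
    have "eval_fps (loop_series w (\<phi> (zz P m w w))) \<zeta> = eval_fps (loop_series w (\<phi> (zz P 1 w w))) \<zeta> ^ m"
      unfolding loop_series_zz[of m] by (rule eval_fps_power[OF ereal_lt_radius[OF rad z]])
    then have "cmod (disc_map P \<phi> w \<zeta>) ^ m = ?s ^ m * cmod (eval_fps (loop_series w (\<phi> (zz P m w w))) \<zeta>)"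
      using sp by (simp add: disc_map_def norm_mult power_mult_distrib norm_power)
    also have "\<dots> \<le> ?s ^ m * ((1 / sqrt (mpow P m w w)) / (1 - cmod \<zeta>))"
    proof (intro mult_left_mono)
      have "opnorm Q (\<phi> (zz P m w w)) \<le> 1 / sqrt (mpow P m w w)"
        using zz_opnorm[OF P] gnorm[OF zz_in[OF P]] by simp
      then show "cmod (eval_fps (loop_series w (\<phi> (zz P m w w))) \<zeta>) \<le> (1 / sqrt (mpow P m w w)) / (1 - cmod \<zeta>)"
        using loop_series_eval_bound[OF analytic_op_zz z, of w m] z by (meson diff_gt_0_iff_gt divide_right_mono less_imp_le order_trans)
    qed (use sp in simp)
    also have "\<dots> = 1 / (1 - cmod \<zeta>)" using sp by (simp add: p(2) real_sqrt_power)
    finally show ?thesis .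
  qed
  moreover obtain m where "1 / (1 - cmod \<zeta>) < cmod (disc_map P \<phi> w \<zeta>) ^ m" using real_arch_pow[OF big] by blast
  ultimately show False by (meson not_less)
qed

lemma disc_map_holomorphic: "disc_map P \<phi> w holomorphic_on ball 0 1"
proof -
  have "ball (0::complex) 1 \<subseteq> eball 0 (fps_conv_radius (loop_series w (\<phi> (zz P 1 w w))))"
  proof
    fix x :: complex assume "x \<in> ball 0 1"
    then have "cmod x < 1" by simp
    from ereal_lt_radius[OF rad[of 1] this] show "x \<in> eball 0 (fps_conv_radius (loop_series w (\<phi> (zz P 1 w w))))"
      by (simp add: in_eball_iff)
  qed
  then show ?thesis unfolding disc_map_def[abs_def]
    by (intro holomorphic_on_mult holomorphic_on_const holomorphic_on_eval_fps)
qed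

lemma disc_map_fps: assumes "cmod \<zeta> < 1"
  shows "disc_map P \<phi> w \<zeta> = eval_fps (fps_const (complex_of_real (sqrt (P w w))) * loop_series w (\<phi> (zz P 1 w w))) \<zeta>"
  using assms by (subst eval_fps_mult) (auto simp: disc_map_def ereal_lt_radius[OF rad])

lemma near0: "(\<And>z. cmod z < 1 \<Longrightarrow> R z) \<Longrightarrow> eventually R (nhds 0)"
  using eventually_nhds_in_open[of "ball 0 1" "0::complex"] by (auto elim!: eventually_mono)

text \<open>Otherwise the maximum principle makes the map constant, so \<phi> sends the loop to a
  multiple of the vertex projection at w, which is already the image of such a multiple; this
  contradicts injectivity.\<close>

lemma disc_map_lt1: assumes z: "cmod \<zeta> < 1" shows "cmod (disc_map P \<phi> w \<zeta>) < 1"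
proof (rule ccontr)
  let ?F = "fps_const (complex_of_real (sqrt (P w w))) * loop_series w (\<phi> (zz P 1 w w))"
  assume "\<not> ?thesis"
  then have e1: "cmod (disc_map P \<phi> w \<zeta>) \<ge> 1" by simp
  have "disc_map P \<phi> w constant_on ball 0 1"
  proof (rule maximum_modulus_principle[OF disc_map_holomorphic, where U = "ball 0 1" and \<xi> = \<zeta>])
    show "cmod (disc_map P \<phi> w x) \<le> cmod (disc_map P \<phi> w \<zeta>)" if "x \<in> ball 0 1" for x using disc_map_le1[of x] that e1 by simp
  qed (use z in auto)
  then obtain k where k: "\<And>x. cmod x < 1 \<Longrightarrow> disc_map P \<phi> w x = k" by (auto simp: constant_on_def)
  have "?F = fps_const k"
  proof (rule eval_fps_eqD)
    have "fps_conv_radius ?F \<ge> 1"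
      using fps_conv_radius_mult[of "fps_const (complex_of_real (sqrt (P w w)))" "loop_series w (\<phi> (zz P 1 w w))"] rad[of 1] by (simp add: min_def split: if_splits)
    then show "0 < fps_conv_radius ?F" by (rule radius_pos)
    show "\<forall>\<^sub>F z in nhds 0. eval_fps ?F z = eval_fps (fps_const k) z"
      by (rule near0) (use k disc_map_fps in simp)
  qed simp
  then have F0: "fps_nth ?F m = fps_nth (fps_const k) m" for m by simp
  let ?s = "complex_of_real (sqrt (P w w))"
  have vs: "?s * \<phi> (zz P 1 w w) vac m w w = (if m = 0 then k else 0)" for m using F0[of m] by (simp add: loop_series_def)
  have in1: "op_smul ?s (zz P 1 w w) \<in> tensor_alg P" "op_smul k (pr P w) \<in> tensor_alg P" by (intro tensor_alg.smul zz_in[OF P] pr_in)+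
  have "\<phi> (op_smul ?s (zz P 1 w w)) = \<phi> (op_smul k (pr P w))"
  proof (rule tensor_alg_eqI[OF Q gin[OF in1(1)] gin[OF in1(2)]])
    fix n x y
    have "\<phi> (op_smul ?s (zz P 1 w w)) vac n x y = (if x = w \<and> y = w then ?s * \<phi> (zz P 1 w w) vac n w w else 0)"
      unfolding gsmul[OF zz_in[OF P]] op_smul_vac by (subst phi_zz_vac) simp
    also have "\<dots> = \<phi> (op_smul k (pr P w)) vac n x y"
      unfolding gsmul[OF pr_in] op_smul_vac pr vs by (auto simp: pr_set_proj set_proj_vac)
    finally show "\<phi> (op_smul ?s (zz P 1 w w)) vac n x y = \<phi> (op_smul k (pr P w)) vac n x y" .
  qed
  then have "op_smul ?s (zz P 1 w w) = op_smul k (pr P w)" by (rule alg_isometry_eq[OF g in1])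
  then have "op_smul ?s (zz P 1 w w) vac 1 w w = op_smul k (pr P w) vac 1 w w" by simp
  then show False using p(1) by (simp add: op_smul_vac zz_vac[OF P] Zm_def pr_set_proj set_proj_vac p(2)[of 1, simplified])
qed

lemma loop_series_zz_self: "loop_series w (zz P m w w) = fps_const (complex_of_real (1 / sqrt (P w w ^ m))) * fps_X ^ m"
  by (rule fps_ext) (simp add: loop_series_def zz_vac[OF P] Zm_def p(2))

text \<open>Both evaluations are bounded functionals and agree on the powers of the loop by
  multiplicativity; \<open>corner_functional_zero\<close> does the rest.\<close>

lemma ev_transfer: assumes z: "cmod \<zeta> < 1" and T: "T \<in> tensor_alg P"
  shows "eval_fps (loop_series w (\<phi> T)) \<zeta> = eval_fps (loop_series w T) (disc_map P \<phi> w \<zeta>)"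
proof -
  let ?b = "disc_map P \<phi> w \<zeta>"
  note bl = disc_map_lt1[OF z]
  define f where "f T = eval_fps (loop_series w (\<phi> T)) \<zeta> - eval_fps (loop_series w T) ?b" for T
  have r1: "ereal (cmod \<zeta>) < fps_conv_radius (loop_series w (\<phi> T))" and r2: "ereal (cmod ?b) < fps_conv_radius (loop_series w T)" if "T \<in> tensor_alg P" for T
    by (rule ereal_lt_radius[OF loop_series_radius[OF analytic_op_phi[OF that]] z], rule ereal_lt_radius[OF loop_series_radius[OF tensor_alg_analytic_op[OF P that]] bl])
  have "f (corner P w w T) = 0"
  proof (rule corner_functional_zero[OF P, of f "1 / (1 - cmod \<zeta>) + 1 / (1 - cmod ?b)"])
    fix T S assume T: "T \<in> tensor_alg P" and S: "S \<in> tensor_alg P"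
    show "f (op_add T S) = f T + f S"
      by (simp add: f_def gadd[OF T S] loop_series_add eval_fps_add[OF r1[OF T] r1[OF S]] eval_fps_add[OF r2[OF T] r2[OF S]])
  next
    fix T c assume T: "T \<in> tensor_alg P"
    have "eval_fps (fps_const c * loop_series w (\<phi> T)) \<zeta> = c * eval_fps (loop_series w (\<phi> T)) \<zeta>"
      by (subst eval_fps_mult[OF _ r1[OF T]]) auto
    moreover have "eval_fps (fps_const c * loop_series w T) ?b = c * eval_fps (loop_series w T) ?b"
      by (subst eval_fps_mult[OF _ r2[OF T]]) auto
    ultimately show "f (op_smul c T) = c * f T" by (simp add: f_def gsmul[OF T] loop_series_smul right_diff_distrib)
  next
    fix T assume T: "T \<in> tensor_alg P"
    have "cmod (f T) \<le> cmod (eval_fps (loop_series w (\<phi> T)) \<zeta>) + cmod (eval_fps (loop_series w T) ?b)"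
      unfolding f_def by (rule norm_triangle_ineq4)
    also have "\<dots> \<le> opnorm P T / (1 - cmod \<zeta>) + opnorm P T / (1 - cmod ?b)"
      using loop_series_eval_bound[OF analytic_op_phi[OF T] z, of w] loop_series_eval_bound[OF tensor_alg_analytic_op[OF P T] bl, of w] gnorm[OF T] by simp
    finally show "cmod (f T) \<le> (1 / (1 - cmod \<zeta>) + 1 / (1 - cmod ?b)) * opnorm P T" by (simp add: distrib_right)
  next
    fix m
    let ?s = "sqrt (P w w)"
    have sp: "?s > 0" using p(1) by simp
    have "eval_fps (loop_series w (\<phi> (zz P m w w))) \<zeta> = eval_fps (loop_series w (\<phi> (zz P 1 w w))) \<zeta> ^ m"
      unfolding loop_series_zz[of m] by (rule eval_fps_power[OF ereal_lt_radius[OF rad z]])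
    moreover have "eval_fps (loop_series w (zz P m w w)) ?b = complex_of_real (1 / ?s ^ m) * ?b ^ m"
      unfolding loop_series_zz_self by (subst eval_fps_mult) (auto simp: real_sqrt_power fps_conv_radius_fps_X_power)
    ultimately show "f (zz P m w w) = 0" using sp by (simp add: f_def disc_map_def power_mult_distrib)
  qed (rule T)
  moreover have "loop_series w (corner P w w T) = loop_series w T" by (rule fps_ext) (simp add: loop_series_def corner_vac[OF P tensor_alg_analytic_op[OF P T]])
  moreover have "loop_series w (\<phi> (corner P w w T)) = loop_series w (\<phi> T)"
    by (rule fps_ext) (simp add: loop_series_def phi_corner[OF T] corner_vac[OF Q analytic_op_phi[OF T]])
  ultimately show ?thesis by (simp add: f_def)
qed

text \<open>\<open>ev_transfer\<close> for the preimage of the loop of Q, since the series of that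
  loop is a multiple of \<open>fps_X\<close>.\<close>

lemma disc_map_inverse: assumes z: "cmod \<zeta> < 1" shows "disc_map Q \<psi> w (disc_map P \<phi> w \<zeta>) = \<zeta>"
proof -
  interpret i: disc_vertex_iso Q P \<psi> w by (rule inv_disc)
  have "loop_series w (zz Q 1 w w) = fps_const (complex_of_real (1 / sqrt (Q w w))) * fps_X" using i.loop_series_zz_self[of 1] by simp
  then have "eval_fps (loop_series w (zz Q 1 w w)) \<zeta> = complex_of_real (1 / sqrt (Q w w)) * \<zeta>"
    by (simp only:) (subst eval_fps_mult, auto)
  moreover have "eval_fps (loop_series w (\<phi> (\<psi> (zz Q 1 w w)))) \<zeta> = eval_fps (loop_series w (\<psi> (zz Q 1 w w))) (disc_map P \<phi> w \<zeta>)"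
    by (rule ev_transfer[OF z giin[OF zz_in[OF Q]]])
  ultimately have "eval_fps (loop_series w (\<psi> (zz Q 1 w w))) (disc_map P \<phi> w \<zeta>) = complex_of_real (1 / sqrt (Q w w)) * \<zeta>"
    by (simp only: gright[OF zz_in[OF Q]])
  then show ?thesis using q(1) by (simp add: disc_map_def[of Q])
qed

lemma disc_map_Moebius: "\<exists>\<alpha>. cmod \<alpha> = 1 \<and> (\<forall>z. cmod z < 1 \<longrightarrow> disc_map P \<phi> w z = \<alpha> * ((z - disc_map Q \<psi> w 0) / (1 - cnj (disc_map Q \<psi> w 0) * z)))"
proof -
  interpret i: disc_vertex_iso Q P \<psi> w by (rule inv_disc)
  have inv2: "disc_map P \<phi> w (disc_map Q \<psi> w z) = z" if "cmod z < 1" for z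
  proof -
    have "disc_map P (alg_inverse Q \<psi>) w (disc_map Q \<psi> w z) = z" by (rule i.disc_map_inverse[OF that])
    moreover have "alg_inverse Q \<psi> (zz P 1 w w) = \<phi> (zz P 1 w w)"
      using i.gleft[OF gin[OF zz_in[OF P]], of 1 w w] gleft[OF zz_in[OF P], of 1 w w] by simp
    ultimately show ?thesis by (simp add: disc_map_def[of P])
  qed
  have "\<exists>\<alpha>. cmod \<alpha> = 1 \<and> (\<forall>z\<in>ball 0 1. disc_map P \<phi> w z = \<alpha> * ((z - disc_map Q \<psi> w 0) / (1 - cnj (disc_map Q \<psi> w 0) * z)))"
    by (rule disc_automorphism_Moebius[OF disc_map_holomorphic _ i.disc_map_holomorphic]) (auto simp: disc_map_lt1 i.disc_map_lt1 inv2 disc_map_inverse)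
  then show ?thesis by auto
qed

text \<open>The last equation determines \<open>r\<close> from the power series \<^term>\<open>G 1 w w\<close> alone, so \<open>r\<close> is shared by all loops
  with the same series.\<close>
lemma disc_map_coeffs:
  obtains r where "0 \<le> r" "r < 1" "cmod (disc_map Q \<psi> w 0) = r" "cmod (fps_nth (G 1 w w) 0) * sqrt (P w w) = r"
    "fps_nth (G 1 w w) 1 \<noteq> 0"
    "cmod (fps_nth (G 1 w w) 0) * cmod (fps_nth (G 1 w w) 2) * (1 - r\<^sup>2) = r\<^sup>2 * (cmod (fps_nth (G 1 w w) 1))\<^sup>2"
proof -
  interpret i: disc_vertex_iso Q P \<psi> w by (rule inv_disc)
  obtain \<alpha> where a: "cmod \<alpha> = 1" "\<And>z. cmod z < 1 \<Longrightarrow> disc_map P \<phi> w z = \<alpha> * ((z - disc_map Q \<psi> w 0) / (1 - cnj (disc_map Q \<psi> w 0) * z))"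
    using disc_map_Moebius by blast
  define c where "c = disc_map Q \<psi> w 0"
  have c1: "cmod c < 1" unfolding c_def by (rule i.disc_map_lt1) simp
  let ?s = "sqrt (P w w)"
  define F where "F = fps_const (complex_of_real ?s) * loop_series w (\<phi> (zz P 1 w w))"
  have Fr: "fps_conv_radius F \<ge> 1" unfolding F_def
    using fps_conv_radius_mult[of "fps_const (complex_of_real ?s)" "loop_series w (\<phi> (zz P 1 w w))"] rad[of 1] by (simp add: min_def split: if_splits)
  let ?L = "1 - fps_const (cnj c) * fps_X :: complex fps"
  have Lr: "fps_conv_radius (fps_const (cnj c) * fps_X :: complex fps) \<ge> \<infinity>"
    using fps_conv_radius_mult[of "fps_const (cnj c)" "fps_X :: complex fps"] by simp
  have Lr': "fps_conv_radius ?L \<ge> \<infinity>"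
    using fps_conv_radius_diff[of 1 "fps_const (cnj c) * fps_X :: complex fps"] Lr by simp
  have ratio: "fps_conv_radius (fps_const \<alpha> * (fps_X - fps_const c)) \<ge> \<infinity>"
    using fps_conv_radius_mult[of "fps_const \<alpha>" "fps_X - fps_const c"] fps_conv_radius_diff[of fps_X "fps_const c"] by simp
  \<comment> \<open>The Moebius formula with cleared denominator, as an identity of power series.
    Only its coefficients 0, 1 and 2 are used.\<close>
  have eq: "F * ?L = fps_const \<alpha> * (fps_X - fps_const c)"
  proof (rule eval_fps_eqD)
    have "fps_conv_radius (F * ?L) \<ge> 1" using fps_conv_radius_mult[of F ?L] Fr Lr' by (simp add: min_def split: if_splits)
    then show "0 < fps_conv_radius (F * ?L)" by (rule radius_pos)
    show "0 < fps_conv_radius (fps_const \<alpha> * (fps_X - fps_const c))" using ratio by simp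
    show "\<forall>\<^sub>F z in nhds 0. eval_fps (F * ?L) z = eval_fps (fps_const \<alpha> * (fps_X - fps_const c)) z"
    proof (rule near0)
      fix z :: complex assume z: "cmod z < 1"
      have nz: "1 - cnj c * z \<noteq> 0"
      proof
        assume "1 - cnj c * z = 0"
        then have "cmod c * cmod z = 1" by (metis complex_mod_cnj norm_mult norm_one right_minus_eq)
        moreover have "cmod c * cmod z < 1" using mult_left_le[of "cmod z" "cmod c"] z c1 by simp
        ultimately show False by simp
      qed
      have "eval_fps (fps_const (cnj c) * fps_X) z = cnj c * z" by (subst eval_fps_mult) auto
      then have "eval_fps ?L z = 1 - cnj c * z" by (subst eval_fps_diff) (use Lr in auto)
      moreover have "eval_fps F z = \<alpha> * ((z - c) / (1 - cnj c * z))" using a(2)[OF z] disc_map_fps[OF z] by (simp add: F_def c_def)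
      moreover have "eval_fps (F * ?L) z = eval_fps F z * eval_fps ?L z"
        by (rule eval_fps_mult) (use ereal_lt_radius[OF Fr z] Lr' in auto)
      moreover have "eval_fps (fps_const \<alpha> * (fps_X - fps_const c)) z = \<alpha> * (z - c)"
        using fps_conv_radius_diff[of fps_X "fps_const c"] by (subst eval_fps_mult) (auto simp: eval_fps_diff)
      ultimately show "eval_fps (F * ?L) z = eval_fps (fps_const \<alpha> * (fps_X - fps_const c)) z" using nz by simp
    qed
  qed
  have co: "fps_nth (F * ?L) n = fps_nth (fps_const \<alpha> * (fps_X - fps_const c)) n" for n using eq by simp
  have FL: "fps_nth (F * ?L) n = fps_nth F n - (if n = 0 then 0 else cnj c * fps_nth F (n - 1))" for n
    by (simp add: right_diff_distrib mult.left_commute[of F])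
  have b0: "fps_nth F 0 = - \<alpha> * c" using co[of 0] unfolding FL by simp
  have b1: "fps_nth F 1 = \<alpha> * (1 - cnj c * c)" using co[of 1] b0 unfolding FL by (simp add: algebra_simps)
  have b2: "fps_nth F 2 = cnj c * fps_nth F 1" using co[of 2] unfolding FL by (simp add: fps_X_def numeral_2_eq_2)
  define r where "r = cmod c"
  have cc: "1 - cnj c * c = complex_of_real (1 - r\<^sup>2)" unfolding r_def using complex_norm_square[of c] by (simp add: mult.commute)
  have r: "0 \<le> r" "r < 1" using c1 by (auto simp: r_def)
  have r2: "r\<^sup>2 < 1" using r by (simp add: power_less_one_iff)
  have m0: "cmod (fps_nth F 0) = r" by (simp add: b0 norm_mult a(1) r_def)
  have m1: "cmod (fps_nth F 1) = 1 - r\<^sup>2" unfolding b1 cc using r2 by (simp only: norm_mult a(1) norm_of_real) simp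
  have m2: "cmod (fps_nth F 2) = r * (1 - r\<^sup>2)" unfolding b2 norm_mult m1 by (simp add: r_def)
  have sp: "?s > 0" using p(1) by simp
  \<comment> \<open>Passing from F to \<open>G 1 w w\<close> rescales the m-th coefficient. In the
    final identity each side contains two coefficients with indices summing to two, so the scale
    factors agree on both sides.\<close>
  have Gn: "cmod (fps_nth (G 1 w w) m) = cmod (fps_nth F m) * sqrt (Q w w ^ m) / ?s" for m
    using sp q(1) by (simp add: G_nth F_def loop_series_def q(2) norm_mult)
  show ?thesis
  proof (rule that[of r])
    show "0 \<le> r" "r < 1" by fact+
    show "cmod (disc_map Q \<psi> w 0) = r" by (simp add: r_def c_def)
    show "cmod (fps_nth (G 1 w w) 0) * sqrt (P w w) = r" unfolding Gn m0 using sp by simp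
    have "cmod (fps_nth (G 1 w w) 1) > 0" unfolding Gn m1 using r2 q(1) sp by simp
    then show "fps_nth (G 1 w w) 1 \<noteq> 0" by simp
    show "cmod (fps_nth (G 1 w w) 0) * cmod (fps_nth (G 1 w w) 2) * (1 - r\<^sup>2) = r\<^sup>2 * (cmod (fps_nth (G 1 w w) 1))\<^sup>2"
      unfolding Gn m0 m1 m2 using q(1) sp by (simp add: power2_eq_square field_simps real_sqrt_mult)
  qed
qed

end

section \<open>Isometric isomorphisms preserve the ratios\<close>

lemma loop_series_gauge_eval:
  fixes P :: "'a \<Rightarrow> 'a \<Rightarrow> real" and T :: "'a fop"
  assumes "stochastic P" "cmod z = 1"
  shows "eval_fps (loop_series w (conjop z id T)) \<zeta> = eval_fps (loop_series w T) (z * \<zeta>)"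
  unfolding eval_fps_def loop_series_def by (simp add: gauge_vac[OF assms] power_mult_distrib mult_ac)

lemma rotation_parameters:
  assumes "0 \<le> r" "r < (1::real)"
  obtains a b :: complex where "cmod a = 1" "cmod b = 1" "1 - a \<noteq> 0" "1 - a * complex_of_real (r\<^sup>2) = b * (1 - a)"
proof -
  have r2: "0 \<le> r\<^sup>2" "r\<^sup>2 < 1" using assms by (auto simp: power_less_one_iff)
  \<comment> \<open>The real part of a unimodular a with |1 - a r^2| = |1 - a|: expanding gives 2 (1
    - r^2) Re a = 1 - r^4. The quotient b is then unimodular.\<close>
  define x where "x = (1 + r\<^sup>2) / 2"
  have x: "0 \<le> x" "x < 1" using r2 by (auto simp: x_def)
  have x1: "x\<^sup>2 \<le> 1" using x by (simp add: power_le_one)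
  define a where "a = Complex x (sqrt (1 - x\<^sup>2))"
  have ca: "(cmod a)\<^sup>2 = 1" using x1 by (simp add: a_def cmod_power2)
  have a1: "cmod a = 1" using ca norm_ge_zero[of a] by (metis power2_eq_1_iff abs_norm_cancel abs_1 abs_minus_cancel)
  have nz: "1 - a \<noteq> 0" using x by (auto simp: a_def complex_eq_iff)
  define b where "b = (1 - a * complex_of_real (r\<^sup>2)) / (1 - a)"
  have im: "(Im a)\<^sup>2 = 1 - (Re a)\<^sup>2" using ca by (simp add: cmod_power2)
  have "(cmod (1 - a))\<^sup>2 = 2 - 2 * x" unfolding cmod_power2 using im by (simp add: power2_diff a_def)
  moreover have "(cmod (1 - a * complex_of_real (r\<^sup>2)))\<^sup>2 = (1 - Re a * r\<^sup>2)\<^sup>2 + (Im a)\<^sup>2 * (r\<^sup>2)\<^sup>2"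
    unfolding cmod_power2 by (simp add: power_mult_distrib)
  moreover have "(1 - Re a * r\<^sup>2)\<^sup>2 + (Im a)\<^sup>2 * (r\<^sup>2)\<^sup>2 = 2 - 2 * x"
    unfolding im by (simp add: a_def x_def power2_eq_square field_simps)
  ultimately have "(cmod (1 - a * complex_of_real (r\<^sup>2)))\<^sup>2 = (cmod (1 - a))\<^sup>2" by simp
  then have "cmod (1 - a * complex_of_real (r\<^sup>2)) = cmod (1 - a)" by (rule power2_eq_imp_eq) auto
  then have "cmod b = 1" using nz by (simp add: b_def norm_divide)
  then show ?thesis using a1 nz by (intro that[of a b]) (auto simp: b_def)
qed

context disc_vertex_iso begin

text \<open>With \<open>c\<close> the zero of \<^term>\<open>disc_map P \<phi> w\<close>, the conditions on \<open>a\<close> and \<open>b\<close> say that the composition of disc maps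
  belonging to the left-hand side sends \<open>0\<close> to \<open>c\<close> before the final \<^term>\<open>disc_map P \<phi> w\<close> is applied.\<close>
lemma rotated_loop_vanishes:
  assumes a: "cmod a = 1" "1 - a \<noteq> 0" and b: "cmod b = 1" and ab: "1 - a * complex_of_real ((cmod (disc_map Q \<psi> w 0))\<^sup>2) = b * (1 - a)"
  shows "(\<phi> \<circ> (conjop a id \<circ> (\<psi> \<circ> (conjop b id \<circ> \<phi>)))) (zz P 1 w w) vac 0 w w = 0"
proof -
  interpret i: disc_vertex_iso Q P \<psi> w by (rule inv_disc)
  obtain \<alpha> where al: "cmod \<alpha> = 1" "\<And>z. cmod z < 1 \<Longrightarrow> disc_map P \<phi> w z = \<alpha> * ((z - disc_map Q \<psi> w 0) / (1 - cnj (disc_map Q \<psi> w 0) * z))"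
    using disc_map_Moebius by blast
  define c where "c = disc_map Q \<psi> w 0"
  have c1: "cmod c < 1" unfolding c_def by (rule i.disc_map_lt1) simp
  note al2 = al(2)[folded c_def]
  let ?r2 = "complex_of_real ((cmod c)\<^sup>2)"
  have ab': "1 - a * ?r2 = b * (1 - a)" using ab by (simp add: c_def)
  have bnz: "b \<noteq> 0" using b by auto
  have dnz: "1 - a * ?r2 \<noteq> 0" unfolding ab' using bnz a(2) by simp
  have cc: "cnj c * c = ?r2" using complex_norm_square[of c] by (simp add: mult.commute)
  have r2: "(cmod c)\<^sup>2 < 1" using c1 by (simp add: power_less_one_iff)
  then have rnz: "1 - ?r2 \<noteq> 0" by (metis eq_iff_diff_eq_0 less_irrefl of_real_1 of_real_eq_iff)
  \<comment> \<open>The point that \<open>disc_map P \<phi> w\<close> sends to a times its value at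
    0. The evaluation point travels 0, B 0, a B 0, z, b z = c for B the disc map of \<phi>, and B c
    = 0.\<close>
  define z where "z = c * (1 - a) / (1 - a * ?r2)"
  have bz: "b * z = c" using bnz a(2) by (simp add: z_def ab' del: of_real_power)
  have zl: "cmod z < 1" using bz c1 b by (metis mult_1 norm_mult)
  have "disc_map P \<phi> w z = a * disc_map P \<phi> w 0"
  proof -
    have n: "z - c = - (c * a * (1 - ?r2)) / (1 - a * ?r2)" using dnz by (simp add: z_def field_simps)
    have "1 - cnj c * z = 1 - (cnj c * c) * (1 - a) / (1 - a * ?r2)" by (simp add: z_def)
    also have "\<dots> = (1 - ?r2) / (1 - a * ?r2)" unfolding cc using dnz by (simp add: field_simps)
    finally have d: "1 - cnj c * z = (1 - ?r2) / (1 - a * ?r2)" .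
    have "(z - c) / (1 - cnj c * z) = - (c * a)" unfolding n d using dnz rnz by simp
    then show ?thesis using al2[OF zl] al2[of 0] by simp
  qed
  then have bb: "disc_map Q \<psi> w (a * disc_map P \<phi> w 0) = z" using disc_map_inverse[OF zl] by simp
  have ab0: "cmod (a * disc_map P \<phi> w 0) < 1" using disc_map_lt1[of 0] a(1) by (simp add: norm_mult)
  define T where "T = \<phi> (zz P 1 w w)"
  have T: "T \<in> tensor_alg Q" unfolding T_def by (rule gin[OF zz_in[OF P]])
  interpret ga: vertex_iso P P "conjop a id" by (rule vertex_iso_gauge[OF P a(1)])
  interpret gb: vertex_iso Q Q "conjop b id" by (rule vertex_iso_gauge[OF Q b])
  have T1: "conjop b id T \<in> tensor_alg Q" by (rule gb.gin[OF T])
  have T2: "\<psi> (conjop b id T) \<in> tensor_alg P" by (rule giin[OF T1])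
  have T3: "conjop a id (\<psi> (conjop b id T)) \<in> tensor_alg P" by (rule ga.gin[OF T2])
  have "(\<phi> \<circ> (conjop a id \<circ> (\<psi> \<circ> (conjop b id \<circ> \<phi>)))) (zz P 1 w w) vac 0 w w
      = eval_fps (loop_series w (\<phi> (conjop a id (\<psi> (conjop b id T))))) 0"
    by (simp add: eval_fps_at_0 loop_series_def T_def)
  also have "\<dots> = eval_fps (loop_series w (conjop a id (\<psi> (conjop b id T)))) (disc_map P \<phi> w 0)" by (rule ev_transfer[OF _ T3]) simp
  also have "\<dots> = eval_fps (loop_series w (\<psi> (conjop b id T))) (a * disc_map P \<phi> w 0)" by (rule loop_series_gauge_eval[OF P a(1)])
  also have "\<dots> = eval_fps (loop_series w (conjop b id T)) z" using i.ev_transfer[OF ab0 T1] by (simp add: bb)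
  also have "\<dots> = eval_fps (loop_series w T) c" using loop_series_gauge_eval[OF Q b] by (simp add: bz)
  also have "\<dots> = 0" using al2[OF c1] p(1) by (simp add: disc_map_def T_def)
  finally show ?thesis .
qed

end

lemma (in vertex_iso) bad_loop_disc: assumes "P w w > 0" "fps_nth (G 1 w w) 0 \<noteq> 0" shows "disc_vertex_iso P Q \<phi> w"
proof -
  have "Q w w > 0" using supp[of 1 w w] assms(1) by (simp add: mpow_1)
  then show ?thesis using assms bad_loop_mpow[OF assms] by (intro disc_vertex_iso.intro vertex_iso_axioms disc_vertex_iso_axioms.intro) auto
qed

text \<open>No loop on a path from i to k is bad. This weaker form of preserving the filtration is
  enough to compare the ratios with end points i and k.\<close>

locale vertex_iso_route = vertex_iso +
  fixes i k :: 'a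
  assumes good_loops: "\<And>w a b. P w w > 0 \<Longrightarrow> mpow P a i w > 0 \<Longrightarrow> mpow P b w k > 0 \<Longrightarrow> fps_nth (G 1 w w) 0 = 0"
begin

text \<open>Peel off the last edge: every edge contributes a series without constant term, either
  because it joins distinct vertices or because it is a good loop.\<close>

lemma order:
  assumes "mpow P a i x > 0" "mpow P b y k > 0" "mpow P n x y > 0" "l < n"
  shows "fps_nth (G n x y) l = 0"
  using assms(2,3,4)
proof (induction n arbitrary: y b l)
  case (Suc n)
  have "mpow P (n + 1) x y > 0" using Suc.prems(2) by (simp only: Suc_eq_plus1)
  then obtain z where z: "mpow P n x z > 0" "mpow P 1 z y > 0" by (rule mpow_pos_split[OF P])
  have zk: "mpow P (1 + b) z k > 0" by (rule mpow_pos_add[OF P z(2) Suc.prems(1)])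
  have G: "G (Suc n) x y = G n x z * G 1 z y" using G_mult[OF z] by simp
  have c0: "fps_nth (G 1 z y) 0 = 0"
  proof (cases "z = y")
    case True
    then have "P y y > 0" using z(2) by (simp add: mpow_1)
    then show ?thesis using good_loops[OF _ mpow_pos_add[OF P assms(1) z(1)]] zk True by blast
  qed (rule G_const_offdiag)
  have "fps_nth (G n x z) m * fps_nth (G 1 z y) (l - m) = 0" if "m \<le> l" for m
  proof (cases "m < n")
    case True then show ?thesis using Suc.IH[OF zk z(1)] by simp
  next
    case False then have "l - m = 0" using that Suc.prems(3) by simp
    then show ?thesis using c0 by simp
  qed
  then show ?case unfolding G fps_mult_nth by (intro sum.neutral) auto
qed simp

text \<open>The difference of the two sides vanishes on monomials: in degree 0 projections are
  fixed, and in positive degree neither side has a constant term. It is used to show that the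
  inverse has only good loops on these routes.\<close>

lemma pres: assumes w: "P w w > 0" "mpow P a i w > 0" "mpow P b w k > 0" and T: "T \<in> tensor_alg P"
  shows "\<phi> T vac 0 w w = T vac 0 w w"
proof -
  let ?f = "\<lambda>T. \<phi> T vac 0 w w - T vac 0 w w"
  have "?f (corner P w w T) = 0"
  proof (rule corner_functional_zero[OF P, of ?f 2])
    fix T assume T: "T \<in> tensor_alg P"
    show "cmod (?f T) \<le> 2 * opnorm P T"
      using norm_triangle_ineq4[of "\<phi> T vac 0 w w" "T vac 0 w w"] phi_bound[OF T, of 0 w w] cf_bound[OF tensor_alg_analytic_op[OF P T], of 0 w w] by linarith
  next
    fix n
    show "?f (zz P n w w) = 0"
    proof (cases "n = 0")
      case True
      show ?thesis unfolding True zz_0[OF P] pr by (simp add: pr_set_proj set_proj_vac)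
    next
      case False
      have "fps_nth (G n w w) 0 = 0" unfolding G_loop[OF w(1), of n] fps_nth_power_0 using False good_loops[OF w] by simp
      then show ?thesis using False by (simp add: G_nth zz_vac[OF P])
    qed
  qed (use T in \<open>simp_all add: gadd gsmul op_add_vac op_smul_vac right_diff_distrib\<close>)
  then show ?thesis by (simp add: phi_corner[OF T] corner_vac[OF Q analytic_op_phi[OF T]] corner_vac[OF P tensor_alg_analytic_op[OF P T]])
qed

lemma inverse_route: "vertex_iso_route Q P \<psi> i k"
proof -
  interpret i: vertex_iso Q P \<psi> by (rule inverse)
  show ?thesis
  proof
    fix w a b assume w: "Q w w > 0" "mpow Q a i w > 0" "mpow Q b w k > 0"
    have "P w w > 0" using supp[of 1 w w] w(1) by (simp add: mpow_1)
    then have "\<psi> (zz Q 1 w w) vac 0 w w = \<phi> (\<psi> (zz Q 1 w w)) vac 0 w w"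
      using pres[of w a b] w supp giin[OF zz_in[OF Q]] by metis
    then show "fps_nth (i.G 1 w w) 0 = 0" by (simp add: i.G_nth gright[OF zz_in[OF Q]] zz_vac[OF Q])
  qed
qed

lemma lead_bound: assumes "mpow P n x y > 0"
  shows "cmod (fps_nth (G n x y) n) \<le> sqrt (mpow Q n x y) / sqrt (mpow P n x y)"
proof -
  have "cmod (\<phi> (zz P n x y) vac n x y) \<le> 1 / sqrt (mpow P n x y)"
    using phi_bound[OF zz_in[OF P]] zz_opnorm[OF P] order_trans by blast
  then show ?thesis using mult_right_mono[of _ _ "sqrt (mpow Q n x y)"] mpow_nonneg[OF Q, of n x y]
    by (fastforce simp: G_nth norm_mult)
qed

text \<open>Since neither \<phi> nor its inverse lowers degrees between these vertices, their
  leading coefficients multiply to one. \<open>lead_bound\<close> for both directions gives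
  reciprocal upper bounds, so both are attained.\<close>

lemma lead_norm:
  assumes x: "mpow P a i x > 0" and y: "mpow P b y k > 0" and n: "mpow P n x y > 0"
  shows "cmod (fps_nth (G n x y) n) = sqrt (mpow Q n x y) / sqrt (mpow P n x y)"
proof -
  interpret i: vertex_iso_route Q P \<psi> i k by (rule inverse_route)
  have x': "mpow Q a i x > 0" and y': "mpow Q b y k > 0" and n': "mpow Q n x y > 0" using x y n by (auto simp: supp)
  define X where "X m = \<psi> (zz Q m x y) vac n x y" for m
  let ?s = "\<lambda>m. complex_of_real (sqrt (mpow Q m x y))"
  \<comment> \<open>The vanishing of \<open>h\<close> says that the n-th coefficient of \<psi> S is
    determined by the coefficients of S up to degree n, as it would be if \<psi> could be applied to
    the series of S term by term.\<close>
  define h where "h S = \<psi> S vac n x y - (\<Sum>m\<le>n. S vac m x y * ?s m * X m)" for S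
  have "h (corner Q x y (\<phi> (zz P n x y))) = 0"
  proof (rule corner_functional_zero[OF Q, of h "1 + (\<Sum>m\<le>n. cmod (?s m * X m))"])
    fix T S assume TS: "T \<in> tensor_alg Q" "S \<in> tensor_alg Q"
    show "h (op_add T S) = h T + h S"
      by (simp add: h_def i.gadd[OF TS] op_add_vac distrib_right sum.distrib)
  next
    fix T c assume T: "T \<in> tensor_alg Q"
    show "h (op_smul c T) = c * h T"
      by (simp add: h_def i.gsmul[OF T] op_smul_vac right_diff_distrib sum_distrib_left mult.assoc)
  next
    fix T assume T: "T \<in> tensor_alg Q"
    have "cmod (\<Sum>m\<le>n. T vac m x y * ?s m * X m) \<le> (\<Sum>m\<le>n. opnorm Q T * cmod (?s m * X m))"
      by (rule sum_norm_le) (simp add: norm_mult mult.assoc mult_right_mono cf_bound[OF tensor_alg_analytic_op[OF Q T]])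
    then have "cmod (h T) \<le> opnorm Q T + (\<Sum>m\<le>n. opnorm Q T * cmod (?s m * X m))"
      unfolding h_def using norm_triangle_ineq4[of "\<psi> T vac n x y" "\<Sum>m\<le>n. T vac m x y * ?s m * X m"] i.phi_bound[OF T, of n x y] by linarith
    also have "opnorm Q T + (\<Sum>m\<le>n. opnorm Q T * cmod (?s m * X m)) = (1 + (\<Sum>m\<le>n. cmod (?s m * X m))) * opnorm Q T"
      by (simp add: distrib_right sum_distrib_right mult.commute[of "opnorm Q T"])
    finally show "cmod (h T) \<le> (1 + (\<Sum>m\<le>n. cmod (?s m * X m))) * opnorm Q T" .
  next
    fix m assume m: "mpow Q m x y > 0"
    have zv: "zz Q m x y vac m' x y * ?s m' * X m' = (if m' = m then X m else 0)" for m'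
      using m by (simp add: zz_vac[OF Q] Zm_def)
    have "(\<Sum>m'\<le>n. zz Q m x y vac m' x y * ?s m' * X m') = (if m \<le> n then X m else 0)"
      unfolding zv by (simp add: sum.delta)
    moreover have "X m = 0" if "n < m"
      using i.order[OF x' y' m that] n by (simp add: X_def i.G_nth)
    ultimately show "h (zz Q m x y) = 0" by (auto simp: h_def X_def)
  qed (rule gin[OF zz_in[OF P]])
  then have "h (\<phi> (zz P n x y)) = 0" using phi_corner[OF zz_in[OF P], of x y n x y] by (simp add: zz_corner[OF P])
  moreover have "h (\<phi> (zz P n x y)) = zz P n x y vac n x y - (\<Sum>m\<le>n. fps_nth (G n x y) m * X m)"
    by (simp add: h_def gleft[OF zz_in[OF P]] G_nth)
  moreover have "(\<Sum>m\<le>n. fps_nth (G n x y) m * X m) = fps_nth (G n x y) n * X n"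
  proof -
    have "(\<Sum>m\<le>n. fps_nth (G n x y) m * X m) = (\<Sum>m\<le>n. if m = n then fps_nth (G n x y) n * X n else 0)"
      by (rule sum.cong) (auto simp: order[OF x y n])
    then show ?thesis by (simp add: sum.delta)
  qed
  ultimately have "fps_nth (G n x y) n * X n = complex_of_real (1 / sqrt (mpow P n x y))" by (simp add: zz_vac[OF P] Zm_def)
  then have "fps_nth (G n x y) n * fps_nth (i.G n x y) n = 1" using n by (simp add: i.G_nth X_def field_simps)
  then have one: "cmod (fps_nth (G n x y) n) * cmod (fps_nth (i.G n x y) n) = 1" by (metis norm_mult norm_one)
  let ?t = "sqrt (mpow Q n x y) / sqrt (mpow P n x y)"
  have t: "?t > 0" using n n' by simp
  have "1 \<le> cmod (fps_nth (G n x y) n) * (sqrt (mpow P n x y) / sqrt (mpow Q n x y))"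
    using mult_left_mono[OF i.lead_bound[OF n'], of "cmod (fps_nth (G n x y) n)"] one by simp
  then have "?t \<le> cmod (fps_nth (G n x y) n)" using n n' by (simp add: field_simps)
  then show ?thesis using lead_bound[OF n] by simp
qed

text \<open>The leading coefficient of a product of series is the product of the leading
  coefficients; take moduli from \<open>lead_norm\<close> and square.\<close>

lemma ratio_eq: assumes "mpow P n i j > 0" "mpow P m j k > 0" shows "ratio P n m i j k = ratio Q n m i j k"
proof -
  have nm: "mpow P (n + m) i k > 0" by (rule mpow_pos_add[OF P assms])
  have i0: "mpow P 0 i i > 0" and k0: "mpow P 0 k k > 0" by auto
  have "fps_nth (G (n + m) i k) (n + m) = (\<Sum>a=0..n + m. fps_nth (G n i j) a * fps_nth (G m j k) (n + m - a))"
    by (simp add: G_mult[OF assms] fps_mult_nth)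
  also have "\<dots> = (\<Sum>a=0..n + m. if a = n then fps_nth (G n i j) n * fps_nth (G m j k) m else 0)"
  proof (rule sum.cong[OF refl])
    fix a assume a: "a \<in> {0..n + m}"
    consider "a < n" | "a = n" | "a > n" by linarith
    then show "fps_nth (G n i j) a * fps_nth (G m j k) (n + m - a) = (if a = n then fps_nth (G n i j) n * fps_nth (G m j k) m else 0)"
    proof cases
      case 1 then show ?thesis using order[OF i0 assms(2,1), of a] by simp
    next
      case 3 then have "n + m - a < m" using a by auto
      then show ?thesis using order[OF assms(1) k0 assms(2)] 3 by simp
    qed simp
  qed
  also have "\<dots> = fps_nth (G n i j) n * fps_nth (G m j k) m" by (simp add: sum.delta)
  finally have "cmod (fps_nth (G (n + m) i k) (n + m)) = cmod (fps_nth (G n i j) n) * cmod (fps_nth (G m j k) m)" by (simp add: norm_mult)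
  then have "sqrt (mpow Q (n + m) i k) / sqrt (mpow P (n + m) i k)
     = sqrt (mpow Q n i j) / sqrt (mpow P n i j) * (sqrt (mpow Q m j k) / sqrt (mpow P m j k))"
    unfolding lead_norm[OF i0 k0 nm] lead_norm[OF i0 assms(2,1)] lead_norm[OF assms(1) k0 assms(2)] .
  then have "mpow Q (n + m) i k / mpow P (n + m) i k = mpow Q n i j / mpow P n i j * (mpow Q m j k / mpow P m j k)"
    by (simp flip: real_sqrt_divide real_sqrt_mult)
  moreover have "mpow Q (n + m) i k > 0" using nm by (simp add: supp)
  ultimately show ?thesis using nm assms unfolding ratio_def by (simp add: field_simps)
qed

end

context vertex_iso begin

lemma same_ratios_id: "same_ratios P Q id"
proof -
  have R: "ratio P n m i j k = ratio Q n m i j k" for n m i j k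
  proof (cases "mpow P n i j > 0 \<and> mpow P m j k > 0")
    case False
    then have "\<not> ratio P n m i j k > 0" "\<not> ratio Q n m i j k > 0" by (auto simp: ratio_pos P Q supp)
    then show ?thesis using ratio_nonneg[OF P, of n m i j k] ratio_nonneg[OF Q, of n m i j k] by linarith
  next
    case True
    \<comment> \<open>The loops that can occur on a path from i to k.\<close>
    define route where "route w \<longleftrightarrow> P w w > 0 \<and> (\<exists>a. mpow P a i w > 0) \<and> (\<exists>b. mpow P b w k > 0)" for w
    show ?thesis
    proof (cases "\<exists>w. route w \<and> fps_nth (G 1 w w) 0 \<noteq> 0")
      case False
      then interpret r: vertex_iso_route P Q \<phi> i k by unfold_locales (auto simp: route_def)
      show ?thesis using r.ratio_eq True by blast
    next
      case bad: True
      then obtain v where v: "route v" "fps_nth (G 1 v v) 0 \<noteq> 0" by blast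
      interpret v: disc_vertex_iso P Q \<phi> v using bad_loop_disc v by (auto simp: route_def)
      obtain r where r: "0 \<le> r" "r < 1" "fps_nth (G 1 v v) 1 \<noteq> 0"
          "cmod (fps_nth (G 1 v v) 0) * cmod (fps_nth (G 1 v v) 2) * (1 - r\<^sup>2) = r\<^sup>2 * (cmod (fps_nth (G 1 v v) 1))\<^sup>2"
        by (rule v.disc_map_coeffs) auto
      obtain a b where ab: "cmod a = 1" "cmod b = 1" "1 - a \<noteq> 0" "1 - a * complex_of_real (r\<^sup>2) = b * (1 - a)"
        by (rule rotation_parameters[OF r(1,2)])
      \<comment> \<open>The rotations depend on i and k through r, so \<theta> is specific to this
        pair.\<close>
      define \<theta> where "\<theta> = \<phi> \<circ> (conjop a id \<circ> (\<psi> \<circ> (conjop b id \<circ> \<phi>)))"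
      have s: "vertex_iso P Q \<theta>" unfolding \<theta>_def
        by (rule vertex_iso_compose[OF vertex_iso_compose[OF vertex_iso_compose[OF vertex_iso_compose[OF vertex_iso_axioms vertex_iso_gauge[OF Q ab(2)]] inverse] vertex_iso_gauge[OF P ab(1)]] vertex_iso_axioms])
      interpret t: vertex_iso P Q \<theta> by (rule s)
      interpret t: vertex_iso_route P Q \<theta> i k
      proof
        fix w c d assume w: "P w w > 0" "mpow P c i w > 0" "mpow P d w k > 0"
        have eq: "G 1 w w = G 1 v v" using route_loops_eq[OF w] v(1) unfolding route_def by blast
        then have "fps_nth (G 1 w w) 0 \<noteq> 0" using v(2) by simp
        then interpret w: disc_vertex_iso P Q \<phi> w using bad_loop_disc[OF w(1)] by blast
        obtain r' where r': "0 \<le> r'" "r' < 1" "cmod (disc_map Q \<psi> w 0) = r'"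
          "cmod (fps_nth (G 1 w w) 0) * cmod (fps_nth (G 1 w w) 2) * (1 - r'\<^sup>2) = r'\<^sup>2 * (cmod (fps_nth (G 1 w w) 1))\<^sup>2"
          by (rule w.disc_map_coeffs) auto
        define A where "A = cmod (fps_nth (G 1 v v) 0) * cmod (fps_nth (G 1 v v) 2)"
        define B where "B = (cmod (fps_nth (G 1 v v) 1))\<^sup>2"
        have "A * (1 - r\<^sup>2) = r\<^sup>2 * B" "A * (1 - r'\<^sup>2) = r'\<^sup>2 * B" using r(4) r'(4) unfolding eq A_def B_def by auto
        \<comment> \<open>Both equations read r^2 (A + B) = A with the same A and B, because the
          loops at v and w have the same series.\<close>
        then have "r\<^sup>2 * (A + B) = r'\<^sup>2 * (A + B)" by (simp add: algebra_simps)
        moreover have "A + B > 0" using r(3) by (simp add: A_def B_def add_nonneg_pos)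
        ultimately have "r\<^sup>2 = r'\<^sup>2" by simp
        then have "1 - a * complex_of_real ((cmod (disc_map Q \<psi> w 0))\<^sup>2) = b * (1 - a)" using ab(4) r'(3) by simp
        from w.rotated_loop_vanishes[OF ab(1,3,2) this] show "fps_nth (t.G 1 w w) 0 = 0"
          unfolding t.G_nth by (simp add: \<theta>_def)
      qed
      show ?thesis using t.ratio_eq True by blast
    qed
  qed
  have "mpow P n i j = 0 \<longleftrightarrow> mpow Q n i j = 0" for n i j using supp[of n i j] mpow_neq0[OF P] mpow_neq0[OF Q] by blast
  then show ?thesis using R by (simp add: same_ratios_def)
qed

end

lemma permuted_stochastic:
  assumes Q: "stochastic Q" and s: "bij \<sigma>"
  shows "stochastic (\<lambda>i j. Q (\<sigma> i) (\<sigma> j))" and "mpow (\<lambda>i j. Q (\<sigma> i) (\<sigma> j)) n i j = mpow Q n (\<sigma> i) (\<sigma> j)"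
proof -
  have "((\<lambda>j. Q (\<sigma> i) (\<sigma> j)) has_sum 1) UNIV" for i
    using Q has_sum_reindex_bij_betw[OF s, of "Q (\<sigma> i)" 1] by (simp add: stochastic_def)
  then show "stochastic (\<lambda>i j. Q (\<sigma> i) (\<sigma> j))" using Q by (simp add: stochastic_def)
  show "mpow (\<lambda>i j. Q (\<sigma> i) (\<sigma> j)) n i j = mpow Q n (\<sigma> i) (\<sigma> j)"
  proof (induction n arbitrary: j)
    case 0 then show ?case using bij_is_inj[OF s] by (simp add: inj_eq)
  next
    case (Suc n)
    then show ?case using infsum_reindex_bij_betw[OF s, of "\<lambda>k. mpow Q n (\<sigma> i) k * Q k (\<sigma> j)"] by simp
  qed
qed

lemma same_ratios_permuted: assumes Q: "stochastic Q" and s: "bij \<sigma>" shows "same_ratios (\<lambda>i j. Q (\<sigma> i) (\<sigma> j)) Q \<sigma>"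
  using s by (simp add: same_ratios_def ratio_def permuted_stochastic(2)[OF assms])

text \<open>Relabelling Q by the permutation of the vertices makes the isomorphism fix all vertex
  projections.\<close>

lemma isometric_imp_same_ratios:
  fixes P Q :: "'a \<Rightarrow> 'a \<Rightarrow> real"
  assumes P: "stochastic P" and Q: "stochastic Q" and "alg_iso P Q \<phi>" "isometric P Q \<phi>"
  shows "\<exists>\<sigma>. same_ratios P Q \<sigma>"
proof -
  have g: "alg_isometry P Q \<phi>" using assms by (simp add: alg_isometry_def)
  obtain \<sigma> where s: "bij \<sigma>" "\<And>i. \<phi> (pr P i) = pr Q (\<sigma> i)" using alg_isometry_permutation[OF P Q g] by blast
  let ?Q = "\<lambda>i j. Q (\<sigma> i) (\<sigma> j)"
  note st = permuted_stochastic[OF Q s(1)]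
  interpret t: transport ?Q Q \<sigma> 1 by unfold_locales (use st(1) Q same_ratios_permuted[OF Q s(1)] in auto)
  have tg: "alg_isometry ?Q Q (conjop 1 \<sigma>)" by (simp add: alg_isometry_def t.conj_alg_iso t.conj_isometric)
  let ?\<theta> = "alg_inverse ?Q (conjop 1 \<sigma>) \<circ> \<phi>"
  have "vertex_iso P ?Q ?\<theta>"
  proof (unfold_locales, rule P, rule st(1), rule alg_isometry_compose[OF g alg_isometry_alg_inverse[OF tg]])
    show "?\<theta> (pr P i) = pr ?Q i" for i using alg_inverse_left[OF tg pr_in, of i] by (simp add: s(2) t.conj_pr)
  qed
  then interpret vertex_iso P ?Q ?\<theta> .
  have "same_ratios P ?Q id" by (rule same_ratios_id)
  then have "same_ratios P Q \<sigma>" using s(1) by (simp add: same_ratios_def ratio_def st(2))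
  then show ?thesis by blast
qed

section \<open>Fourier coefficients and unitary isomorphisms\<close>

lemma cis_integral:
  "((\<lambda>t. cis (2 * pi * of_int l * t)) has_integral (if l = 0 then 1 else 0)) {0..1::real}"
proof (cases "l = 0")
  case True
  then show ?thesis using has_integral_const_real[of "1::complex" 0 1] by simp
next
  case False
  define c where "c = \<i> * (2 * pi * of_int l)"
  have c: "c \<noteq> 0" using False by (simp add: c_def)
  have e: "cis (2 * pi * of_int l * t) = exp (c * of_real t)" for t by (simp add: cis_conv_exp c_def mult_ac)
  have "((\<lambda>t. exp (c * of_real t)) has_integral exp (c * of_real 1) / c - exp (c * of_real 0) / c) {0..1}"
  proof (rule fundamental_theorem_of_calculus)
    fix x :: real
    have "((\<lambda>z. exp (c * z) / c) has_field_derivative exp (c * of_real x)) (at (of_real x))"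
      using c by (auto intro!: derivative_eq_intros)
    then show "((\<lambda>t. exp (c * of_real t) / c) has_vector_derivative exp (c * of_real x)) (at x within {0..1})"
      by (rule has_vector_derivative_real_field)
  qed simp
  moreover have "exp c = 1"
    using exp_integer_2pi[of "of_int l"] by (simp add: c_def mult_ac)
  ultimately show ?thesis using False by (simp add: e)
qed

lemma gaugeW_fock: assumes "cmod z = 1" "\<xi> \<in> fock P" shows "gaugeW z \<xi> \<in> fock P"
proof -
  have "l2b (\<lambda>p. gaugeW z \<xi> (fst p) (snd p) j) (fnorm \<xi>)" for j
    by (rule l2b_dominated[OF mbD[OF fock_mb[OF assms(2)], of j]]) (simp add: gaugeW_def norm_mult norm_power assms(1))
  then have "mb (gaugeW z \<xi>) (fnorm \<xi>)" by (simp add: mb_def)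
  then show ?thesis using fock_supp[OF assms(2)] by (auto simp: fock_iff gaugeW_def)
qed

text \<open>By the Fourier identity each entry of the rotated operator is a trigonometric polynomial
  in t; the integral selects the summand with m - a = n. Negative n selects nothing.\<close>

lemma Phi_tensor_alg:
  assumes P: "stochastic P" and T: "T \<in> tensor_alg P"
  shows "Phi P n T = (if n \<ge> 0 then shift_op P (nat n) (T vac (nat n)) else (\<lambda>\<xi>. fzero))"
proof
  fix \<xi>
  note g = tensor_alg_analytic_op[OF P T]
  show "Phi P n T \<xi> = (if n \<ge> 0 then shift_op P (nat n) (T vac (nat n)) else (\<lambda>\<xi>. fzero)) \<xi>"
  proof (cases "\<xi> \<in> fock P")
    case False then show ?thesis by (simp add: Phi_def shift_op_def)
  next
    case x: True
    show ?thesis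
    proof (intro ext)
      fix m i j
      define u where "u a = U P (m - a) a (T vac (m - a)) (\<xi> a) i j" for a
      have I: "cis (- 2 * pi * of_int n * t) * gauge_alpha (cis (2 * pi * t)) T \<xi> m i j
         = (\<Sum>a\<le>m. u a * cis (2 * pi * of_int (int (m - a) - n) * t))" for t :: real
      proof -
        let ?z = "cis (2 * pi * t)"
        have gf: "gaugeW (cnj ?z) \<xi> \<in> fock P" by (rule gaugeW_fock[OF _ x]) simp
        have "gauge_alpha ?z T \<xi> m i j = ?z ^ m * T (gaugeW (cnj ?z) \<xi>) m i j"
          by (simp add: gauge_alpha_def gaugeW_def[of ?z])
        also have "T (gaugeW (cnj ?z) \<xi>) m i j = (\<Sum>a\<le>m. cnj ?z ^ a * u a)"
          unfolding analytic_op_fourier[OF g gf] u_def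
          by (intro sum.cong refl) (simp add: gaugeW_def U_scale_right[OF P analytic_op_arv[OF g] fock_slice(1)[OF x]])
        finally have ga: "gauge_alpha ?z T \<xi> m i j = ?z ^ m * (\<Sum>a\<le>m. cnj ?z ^ a * u a)" .
        show ?thesis unfolding ga sum_distrib_left
        proof (rule sum.cong[OF refl])
          fix a assume "a \<in> {..m}"
          then have am: "real (m - a) = real m - real a" by simp
          have eq: "cis (- 2 * pi * of_int n * t) * (?z ^ m * cnj ?z ^ a) = cis (2 * pi * of_int (int (m - a) - n) * t)"
          proof -
            have "?z ^ m = cis (real m * (2 * pi * t))" "cnj ?z ^ a = cis (real a * (- (2 * pi * t)))"
              by (simp_all only: cis_cnj Complex.DeMoivre)
            moreover have "- 2 * pi * of_int n * t + (real m * (2 * pi * t) + real a * (- (2 * pi * t))) = 2 * pi * of_int (int (m - a) - n) * t"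
              by (simp add: am algebra_simps)
            ultimately show ?thesis by (simp only: cis_mult)
          qed
          then show "cis (- 2 * pi * of_int n * t) * (?z ^ m * (cnj ?z ^ a * u a)) = u a * cis (2 * pi * of_int (int (m - a) - n) * t)"
            using arg_cong[OF eq, of "\<lambda>x. x * u a"] by (simp only: mult_ac)
        qed
      qed
      have "((\<lambda>t. \<Sum>a\<le>m. u a * cis (2 * pi * of_int (int (m - a) - n) * t)) has_integral
          (\<Sum>a\<le>m. u a * (if int (m - a) - n = 0 then 1 else 0))) {0..1::real}"
        by (intro has_integral_sum has_integral_mult_right cis_integral) simp
      then have "Phi P n T \<xi> m i j = (\<Sum>a\<le>m. u a * (if int (m - a) - n = 0 then 1 else 0))"
        unfolding Phi_def using x by (simp only: I if_True integral_unique)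
      also have "\<dots> = (\<Sum>a\<le>m. if n \<ge> 0 \<and> nat n \<le> m \<and> a = m - nat n then u a else 0)"
        by (intro sum.cong refl) auto
      also have "\<dots> = (if n \<ge> 0 \<and> nat n \<le> m then u (m - nat n) else 0)" by (auto simp: sum.delta)
      also have "\<dots> = (if n \<ge> 0 then shift_op P (nat n) (T vac (nat n)) else (\<lambda>\<xi>. fzero)) \<xi> m i j"
        using x by (auto simp: shift_op_def u_def fzero_def)
      finally show "Phi P n T \<xi> m i j = (if n \<ge> 0 then shift_op P (nat n) (T vac (nat n)) else (\<lambda>\<xi>. fzero)) \<xi> m i j" .
    qed
  qed
qed

lemma zero_op_in: assumes "stochastic P" "T \<in> tensor_alg P" shows "(\<lambda>\<xi>. fzero) \<in> tensor_alg P"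
proof -
  have "(\<lambda>\<xi>. fzero) = op_smul 0 T" by (simp add: op_smul_def fzero_def)
  then show ?thesis using tensor_alg.smul[OF assms(2), of 0] by simp
qed

lemma Phi_in: assumes "stochastic P" "T \<in> tensor_alg P" shows "Phi P n T \<in> tensor_alg P"
  unfolding Phi_tensor_alg[OF assms]
  using tensor_alg.gen_shift[OF analytic_op_arv[OF tensor_alg_analytic_op[OF assms]], of "nat n"] zero_op_in[OF assms] by simp

lemma Phi_idem: assumes P: "stochastic P" and T: "T \<in> tensor_alg P" shows "Phi P n (Phi P n T) = Phi P n T"
proof -
  note a = analytic_op_arv[OF tensor_alg_analytic_op[OF P T]]
  show ?thesis
  proof (cases "n \<ge> 0")
    case True
    then show ?thesis
      using Phi_tensor_alg[OF P Phi_in[OF P T], of n n] by (simp add: Phi_tensor_alg[OF P T] shift_vac[OF P a])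
  next
    case False
    then show ?thesis
      using Phi_tensor_alg[OF P Phi_in[OF P T], of n n] by (simp add: Phi_tensor_alg[OF P T])
  qed
qed

text \<open>The permutation unitary preserves degrees, so conjugation by it commutes with
  \<open>Phi\<close>, and gradedness reduces to idempotency of \<open>Phi\<close>.\<close>

lemma same_ratios_imp_graded_iso:
  assumes P: "stochastic P" and Q: "stochastic Q" and c: "same_ratios P Q \<sigma>"
  shows "alg_iso P Q (conjop 1 \<sigma>) \<and> graded P Q (conjop 1 \<sigma>) \<and> completely_isometric P Q (conjop 1 \<sigma>)"
proof -
  interpret transport P Q \<sigma> 1 by unfold_locales (use P Q c in auto)
  have ph: "Phi Q n (conjop 1 \<sigma> T) = conjop 1 \<sigma> (Phi P n T)" if T: "T \<in> tensor_alg P" for n T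
  proof -
    have v: "conjop 1 \<sigma> T vac m = (\<lambda>i j. T vac m (\<tau> i) (\<tau> j))" for m by (intro ext) (simp add: conj_vac)
    have z: "conjop 1 \<sigma> (\<lambda>\<xi>. fzero) = (\<lambda>\<xi>. fzero)" by (intro ext) (simp add: conjop_apply W_def fzero_def)
    show ?thesis
      using conj_shift[OF analytic_op_arv[OF tensor_alg_analytic_op[OF P T]], of "nat n"]
      by (simp add: Phi_tensor_alg[OF Q conj_tensor_alg[OF T]] Phi_tensor_alg[OF P T] v z)
  qed
  have "graded P Q (conjop 1 \<sigma>)" unfolding graded_def
    by (simp add: ph Phi_in[OF P] Phi_idem[OF P])
  then show ?thesis using conj_alg_iso conj_completely_isometric by blast
qed

lemma matnorm_1: "matnorm P 1 (\<lambda>r s. T) = opnorm P T"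
proof -
  have f: "fknorm 1 \<xi> = fnorm (\<xi> 0)" for \<xi> :: "nat \<Rightarrow> 'a fvec" by (simp add: fknorm_def fnorm_def)
  have "{fknorm 1 (\<lambda>r n i j. \<Sum>s<1. T (\<xi> s) n i j) |\<xi>. (\<forall>s<1. \<xi> s \<in> fock P) \<and> fknorm 1 \<xi> \<le> 1}
      = {fnorm (T \<xi>) |\<xi>. \<xi> \<in> fock P \<and> fnorm \<xi> \<le> 1}" (is "?L = ?R")
  proof (intro equalityI subsetI)
    fix x assume "x \<in> ?L"
    then show "x \<in> ?R" unfolding f by auto
  next
    fix x assume "x \<in> ?R"
    then obtain \<xi> where "x = fnorm (T \<xi>)" "\<xi> \<in> fock P" "fnorm \<xi> \<le> 1" by blast
    then show "x \<in> ?L" unfolding f by (intro CollectI exI[of _ "\<lambda>s. \<xi>"]) simp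
  qed
  then show ?thesis unfolding matnorm_def opnorm_def by (simp only:)
qed

lemma completely_isometric_imp_isometric:
  fixes P Q :: "'a \<Rightarrow> 'a \<Rightarrow> real"
  assumes "completely_isometric P Q \<phi>" shows "isometric P Q \<phi>"
  unfolding isometric_def
proof
  fix T assume "T \<in> tensor_alg P"
  then have "matnorm Q 1 (\<lambda>r s. \<phi> T) = matnorm P 1 (\<lambda>r s. T)"
    using assms unfolding completely_isometric_def by (elim allE[of _ 1] allE[of _ "\<lambda>r s. T"]) simp
  then show "opnorm Q (\<phi> T) = opnorm P T" by (simp only: matnorm_1)
qed

section \<open>Unitary isomorphisms of the subproduct systems\<close>

lemma linf_comp: "a \<in> linf \<Longrightarrow> (\<lambda>i. a (\<tau> i)) \<in> linf"
  by (auto simp: linf_def bounded_iff)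

lemma same_ratios_imp_unitary:
  assumes P: "stochastic P" and Q: "stochastic Q" and c: "same_ratios P Q \<sigma>"
  shows "\<exists>\<rho> V. star_automorphism \<rho> \<and> rho_unitary_iso P Q \<rho> V"
proof -
  interpret transport P Q \<sigma> 1 by unfold_locales (use P Q c in auto)
  interpret i: transport Q P \<tau> 1 using transport_inv by simp
  have ii: "inv \<tau> = \<sigma>" by (rule inv_inv_eq[OF bs])
  define \<rho> :: "('a \<Rightarrow> complex) \<Rightarrow> 'a \<Rightarrow> complex" where "\<rho> a = (\<lambda>i. a (\<tau> i))" for a
  define V :: "nat \<Rightarrow> 'a mat \<Rightarrow> 'a mat" where "V n A = (\<lambda>i j. A (\<tau> i) (\<tau> j))" for n A
  have "bij_betw \<rho> linf linf"
    by (rule bij_betwI[where g = "\<lambda>a i. a (\<sigma> i)"]) (auto simp: \<rho>_def linf_comp)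
  then have "star_automorphism \<rho>" by (simp add: star_automorphism_def \<rho>_def)
  moreover have "rho_unitary_iso P Q \<rho> V"
    unfolding rho_unitary_iso_def
  proof (intro conjI ballI allI impI)
    fix A assume A: "A \<in> arv P 0"
    have "A x y = 0" if "x \<noteq> y" for x y using arv_supp[OF A, of x y] that by simp
    moreover have "\<tau> x = \<tau> y \<longleftrightarrow> x = y" for x y by (metis st(1))
    ultimately show "V 0 A = diag_of (\<rho> (\<lambda>i. A i i))" by (auto simp: V_def diag_of_def \<rho>_def fun_eq_iff)
  next
    fix n :: nat
    show "V n ` arv P n = arv Q n"
    proof (intro equalityI subsetI)
      show "B \<in> arv Q n" if "B \<in> V n ` arv P n" for B using that arv_perm by (auto simp: V_def)
      fix B assume "B \<in> arv Q n"
      then have "(\<lambda>i j. B (\<sigma> i) (\<sigma> j)) \<in> arv P n" using i.arv_perm[of B n] by (simp add: ii)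
      moreover have "V n (\<lambda>i j. B (\<sigma> i) (\<sigma> j)) = B" by (simp add: V_def)
      ultimately show "B \<in> V n ` arv P n" by force
    qed
    fix A B assume "A \<in> arv P n" "B \<in> arv P n"
    have "ip (V n A) (V n B) j = \<rho> (ip A B) j" for j
      using infsum_reindex_bij_betw[OF bt, of "\<lambda>i. cnj (A i (\<tau> j)) * B i (\<tau> j)"] by (simp add: ip_def V_def \<rho>_def)
    then show "ip (V n A) (V n B) = \<rho> (ip A B)" by blast
  next
    fix n m A B assume A: "A \<in> arv P n" and B: "B \<in> arv P m"
    show "V (n + m) (U P n m A B) = U Q n m (V n A) (V m B)"
      by (intro ext) (simp add: V_def U_perm[OF A B])
  qed (simp_all add: V_def \<rho>_def rmul_def lmul_def)
  ultimately show ?thesis by blast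
qed

definition ind :: "'a set \<Rightarrow> 'a \<Rightarrow> complex" where "ind D = (\<lambda>x. if x \<in> D then 1 else 0)"

lemma ind_in: "ind D \<in> linf" unfolding ind_def by (rule ind_linf)
lemma ind_mult: "(\<lambda>x. ind D x * ind D' x) = ind (D \<inter> D')" by (auto simp: ind_def)
lemma ind_inj: "ind D = ind D' \<Longrightarrow> D = D'"
proof (rule set_eqI)
  fix x assume "ind D = ind D'"
  then have "ind D x = ind D' x" by simp
  then show "x \<in> D \<longleftrightarrow> x \<in> D'" by (auto simp: ind_def split: if_splits)
qed
lemma idem_ind: assumes "(\<lambda>x. a x * a x) = a" shows "\<exists>D. a = ind D"
proof -
  have "a x = 0 \<or> a x = 1" for x using fun_cong[OF assms, of x] by simp
  then have "a = ind {x. a x = 1}" by (auto simp: ind_def fun_eq_iff)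
  then show ?thesis by blast
qed

lemma linf_mult: "a \<in> linf \<Longrightarrow> b \<in> linf \<Longrightarrow> (\<lambda>x. a x * b x) \<in> linf"
proof -
  assume "a \<in> linf" "b \<in> linf"
  then obtain A B where A: "\<And>x. cmod (a x) \<le> A" and B: "\<And>x. cmod (b x) \<le> B" by (auto simp: linf_def bounded_iff)
  have "cmod (a x * b x) \<le> A * B" for x
    unfolding norm_mult using A[of x] B[of x] by (intro mult_mono) (auto intro: order_trans[OF norm_ge_zero])
  then show ?thesis by (auto simp: linf_def bounded_iff)
qed

text \<open>Idempotents of the diagonal algebra are indicators, and containment of sets is expressed
  by products. Hence indicators of points go to indicators of points by
  \<open>singleton_bijection\<close>.\<close>

lemma star_automorphism_permutation:
  assumes "star_automorphism \<rho>"
  shows "\<exists>\<sigma>. bij \<sigma> \<and> (\<forall>i. \<rho> (ind {i}) = ind {\<sigma> i})"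
proof -
  have b: "bij_betw \<rho> linf linf" and m: "\<And>a b. a \<in> linf \<Longrightarrow> b \<in> linf \<Longrightarrow> \<rho> (\<lambda>i. a i * b i) = (\<lambda>i. \<rho> a i * \<rho> b i)"
    and sc: "\<And>a c. a \<in> linf \<Longrightarrow> \<rho> (\<lambda>i. c * a i) = (\<lambda>i. c * \<rho> a i)"
    using assms by (auto simp: star_automorphism_def)
  define \<rho>' where "\<rho>' = inv_into linf \<rho>"
  have l: "\<And>a. a \<in> linf \<Longrightarrow> \<rho>' (\<rho> a) = a" "\<And>a. a \<in> linf \<Longrightarrow> \<rho> (\<rho>' a) = a" "\<And>a. a \<in> linf \<Longrightarrow> \<rho> a \<in> linf" "\<And>a. a \<in> linf \<Longrightarrow> \<rho>' a \<in> linf"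
    unfolding \<rho>'_def using bij_betw_inv_into_left[OF b] bij_betw_inv_into_right[OF b] bij_betwE[OF b] bij_betwE[OF bij_betw_inv_into[OF b]] by auto
  have m': "\<rho>' (\<lambda>i. a i * b i) = (\<lambda>i. \<rho>' a i * \<rho>' b i)" if "a \<in> linf" "b \<in> linf" for a b
  proof -
    have "\<rho> (\<lambda>i. \<rho>' a i * \<rho>' b i) = (\<lambda>i. a i * b i)" using m[OF l(4)[OF that(1)] l(4)[OF that(2)]] l(2) that by simp
    then show ?thesis using l(1)[OF linf_mult[OF l(4)[OF that(1)] l(4)[OF that(2)]]] by metis
  qed
  have z: "\<rho> (ind {}) = ind {}" using sc[OF ind_in[of "{}"], of 0] by (simp add: ind_def)
  have z': "\<rho>' (ind {}) = ind {}" using l(1)[OF ind_in[of "{}"]] z by simp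
  have "\<exists>D. \<rho> (ind {i}) = ind D" for i by (rule idem_ind) (use m[OF ind_in ind_in, of "{i}" "{i}"] in \<open>simp add: ind_mult\<close>)
  then obtain D where D: "\<And>i. \<rho> (ind {i}) = ind (D i)" by metis
  have "\<exists>D. \<rho>' (ind {i}) = ind D" for i by (rule idem_ind) (use m'[OF ind_in ind_in, of "{i}" "{i}"] in \<open>simp add: ind_mult\<close>)
  then obtain D' where D': "\<And>i. \<rho>' (ind {i}) = ind (D' i)" by metis
  have "D i \<noteq> {}" for i
  proof
    assume "D i = {}"
    then have "ind {i} = ind {}" using l(1)[OF ind_in[of "{i}"]] D[of i] z' by simp
    then show False using ind_inj by blast
  qed
  moreover have "D' i \<noteq> {}" for i
  proof
    assume "D' i = {}"
    then have "ind {i} = ind {}" using l(2)[OF ind_in[of "{i}"]] D'[of i] z by simp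
    then show False using ind_inj by blast
  qed
  moreover have "D' x \<subseteq> {i}" if "x \<in> D i" for i x
  proof -
    have "(\<lambda>y. ind {x} y * \<rho> (ind {i}) y) = ind {x}" unfolding D ind_mult using that by simp
    then have "(\<lambda>y. \<rho>' (ind {x}) y * ind {i} y) = \<rho>' (ind {x})" using m'[OF ind_in l(3)[OF ind_in], of "{x}" "{i}"] l(1)[OF ind_in[of "{i}"]] by simp
    then have "ind (D' x \<inter> {i}) = ind (D' x)" unfolding D' ind_mult .
    then show ?thesis using ind_inj by blast
  qed
  moreover have "D i \<subseteq> {x}" if "i \<in> D' x" for i x
  proof -
    have "(\<lambda>y. ind {i} y * \<rho>' (ind {x}) y) = ind {i}" unfolding D' ind_mult using that by simp
    then have "(\<lambda>y. \<rho> (ind {i}) y * ind {x} y) = \<rho> (ind {i})" using m[OF ind_in l(4)[OF ind_in], of "{i}" "{x}"] l(2)[OF ind_in[of "{x}"]] by simp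
    then have "ind (D i \<inter> {x}) = ind (D i)" unfolding D ind_mult .
    then show ?thesis using ind_inj by blast
  qed
  ultimately have "\<exists>\<sigma>. bij \<sigma> \<and> (\<forall>i. D i = {\<sigma> i})" by (rule singleton_bijection)
  then show ?thesis using D by metis
qed

definition Em :: "'a \<Rightarrow> 'a \<Rightarrow> 'a mat" where "Em i j = (\<lambda>x y. if x = i \<and> y = j then 1 else 0)"

lemma Em_arv: assumes "mpow P n i j \<noteq> 0" shows "Em i j \<in> arv P n"
proof -
  have "l2b (\<lambda>x. Em i j x y) 1" for y
    by (rule l2b_dominated[OF l2b_indicator[of i]]) (auto simp: Em_def)
  then show ?thesis using assms by (auto simp: arv_iff ab_def Em_def)
qed

text \<open>On matrix units the product displays the ratio itself, which is how the ratios are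
  recovered from the subproduct system.\<close>

lemma U_Em: assumes P: "stochastic P" and "mpow P n i j \<noteq> 0" "mpow P m j k \<noteq> 0"
  shows "U P n m (Em i j) (Em j k) = (\<lambda>x y. rt P n m i j k * Em i k x y)"
proof (intro ext)
  fix x y
  have "U P n m (Em i j) (Em j k) x y = rt P n m x j y * (Em i j x j * Em j k j y)"
    unfolding U_entry[OF P Em_arv[OF assms(2)] Em_arv[OF assms(3)]] by (rule infsum_single) (simp add: Em_def)
  then show "U P n m (Em i j) (Em j k) x y = rt P n m i j k * Em i k x y" by (simp add: Em_def)
qed

lemma unitary_imp_same_ratios:
  assumes P: "stochastic P" and Q: "stochastic Q" and rho: "star_automorphism \<rho>" and V: "rho_unitary_iso P Q \<rho> V"
  shows "\<exists>\<sigma>. same_ratios P Q \<sigma>"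
proof -
  obtain \<sigma> where s: "bij \<sigma>" and rs: "\<And>i. \<rho> (ind {i}) = ind {\<sigma> i}" using star_automorphism_permutation[OF rho] by blast
  have si: "\<sigma> x = \<sigma> y \<longleftrightarrow> x = y" for x y using bij_is_inj[OF s] by (simp add: inj_eq)
  have Vn: "V n ` arv P n = arv Q n"
    and Vs: "\<And>A c. A \<in> arv P n \<Longrightarrow> V n (\<lambda>i j. c * A i j) = (\<lambda>i j. c * V n A i j)"
    and Vm: "\<And>a b A. a \<in> linf \<Longrightarrow> b \<in> linf \<Longrightarrow> A \<in> arv P n \<Longrightarrow> V n (rmul (lmul a A) b) = rmul (lmul (\<rho> a) (V n A)) (\<rho> b)"
    and Vi: "\<And>A B. A \<in> arv P n \<Longrightarrow> B \<in> arv P n \<Longrightarrow> ip (V n A) (V n B) = \<rho> (ip A B)"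
    if "n \<ge> 1" for n using V that unfolding rho_unitary_iso_def by simp_all
  have VU: "V (n + m) (U P n m A B) = U Q n m (V n A) (V m B)" if "A \<in> arv P n" "B \<in> arv P m" for n m A B
    using V that unfolding rho_unitary_iso_def by simp
  \<comment> \<open>Multiplying by point indicators on both sides isolates one entry, and the
    bimodule property moves it to the position given by \<sigma>; \<open>V n\<close> never mixes
    entries.\<close>
  have cut: "V n (\<lambda>x y. A i j * Em i j x y) = (\<lambda>x y. V n A (\<sigma> i) (\<sigma> j) * Em (\<sigma> i) (\<sigma> j) x y)" if n: "n \<ge> 1" and A: "A \<in> arv P n" for n A i j
  proof -
    have "rmul (lmul (ind {i}) A) (ind {j}) = (\<lambda>x y. A i j * Em i j x y)" by (auto simp: rmul_def lmul_def ind_def Em_def fun_eq_iff)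
    moreover have "rmul (lmul (ind {\<sigma> i}) (V n A)) (ind {\<sigma> j}) = (\<lambda>x y. V n A (\<sigma> i) (\<sigma> j) * Em (\<sigma> i) (\<sigma> j) x y)" by (auto simp: rmul_def lmul_def ind_def Em_def fun_eq_iff)
    ultimately show ?thesis using Vm[OF n ind_in ind_in A, of "{i}" "{j}"] by (simp add: rs)
  qed
  define v where "v n i j = V n (Em i j) (\<sigma> i) (\<sigma> j)" for n i j
  have VE: "V n (Em i j) = (\<lambda>x y. v n i j * Em (\<sigma> i) (\<sigma> j) x y)" and v1: "cmod (v n i j) = 1"
    if n: "n \<ge> 1" and p: "mpow P n i j \<noteq> 0" for n i j
  proof -
    have E: "Em i j \<in> arv P n" by (rule Em_arv[OF p])
    have one: "Em i j i j = 1" by (simp add: Em_def)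
    show e: "V n (Em i j) = (\<lambda>x y. v n i j * Em (\<sigma> i) (\<sigma> j) x y)"
      using cut[OF n E, of i j] unfolding one mult_1 v_def .
    have "ip (Em i j) (Em i j) = ind {j}"
    proof
      fix y
      have "ip (Em i j) (Em i j) y = cnj (Em i j i y) * Em i j i y" unfolding ip_def by (rule infsum_single) (simp add: Em_def)
      then show "ip (Em i j) (Em i j) y = ind {j} y" by (simp add: Em_def ind_def)
    qed
    then have "ip (V n (Em i j)) (V n (Em i j)) (\<sigma> j) = 1" using Vi[OF n E E] rs[of j] by (simp add: ind_def)
    moreover have "ip (V n (Em i j)) (V n (Em i j)) (\<sigma> j) = cnj (V n (Em i j) (\<sigma> i) (\<sigma> j)) * V n (Em i j) (\<sigma> i) (\<sigma> j)"
      unfolding ip_def e by (rule infsum_single) (simp add: Em_def)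
    ultimately have "cnj (v n i j) * v n i j = 1" by (simp add: v_def)
    then have "complex_of_real ((cmod (v n i j))\<^sup>2) = 1" unfolding complex_norm_square by (simp add: mult.commute)
    then have "(cmod (v n i j))\<^sup>2 = 1" by (simp only: of_real_eq_1_iff)
    moreover have "cmod (v n i j) = sqrt ((cmod (v n i j))\<^sup>2)" by simp
    ultimately show "cmod (v n i j) = 1" by (simp only: real_sqrt_one)
  qed
  have supp: "mpow P n i j = 0 \<longleftrightarrow> mpow Q n (\<sigma> i) (\<sigma> j) = 0" for n i j
  proof (cases "n = 0")
    case True then show ?thesis by (simp add: si)
  next
    case False
    then have n: "n \<ge> 1" by simp
    show ?thesis
    proof
      assume q: "mpow Q n (\<sigma> i) (\<sigma> j) = 0"
      show "mpow P n i j = 0"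
      proof (rule ccontr)
        assume p: "mpow P n i j \<noteq> 0"
        have "V n (Em i j) \<in> arv Q n" using Vn[OF n] Em_arv[OF p] by blast
        then have "v n i j = 0" using arv_supp[OF _ q] by (auto simp: v_def)
        then show False using v1[OF n p] by simp
      qed
    next
      assume p: "mpow P n i j = 0"
      show "mpow Q n (\<sigma> i) (\<sigma> j) = 0"
      proof (rule ccontr)
        assume "mpow Q n (\<sigma> i) (\<sigma> j) \<noteq> 0"
        \<comment> \<open>A preimage of the matrix unit has (i, j) entry zero because of the support
          of P, and \<open>cut\<close> transfers this zero to the image.\<close>
        from Em_arv[OF this] Vn[OF n] obtain A where A: "A \<in> arv P n" "V n A = Em (\<sigma> i) (\<sigma> j)" by (metis imageE)
        have "A i j = 0" by (rule arv_supp[OF A(1) p])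
        then have "V n (\<lambda>x y. 0 * A x y) = (\<lambda>x y. V n A (\<sigma> i) (\<sigma> j) * Em (\<sigma> i) (\<sigma> j) x y)" using cut[OF n A(1), of i j] by simp
        then have "(\<lambda>x y. 0 * V n A x y) = (\<lambda>x y. V n A (\<sigma> i) (\<sigma> j) * Em (\<sigma> i) (\<sigma> j) x y)" unfolding Vs[OF n A(1)] .
        from fun_cong[OF fun_cong[OF this, of "\<sigma> i"], of "\<sigma> j"] show False by (simp add: A(2) Em_def)
      qed
    qed
  qed
  have "ratio P n m i j k = ratio Q n m (\<sigma> i) (\<sigma> j) (\<sigma> k)" for n m i j k
  proof -
    \<comment> \<open>Exponent 0 is separate because the clauses about matrix units hold for n \<ge>
      1; there the ratios are indicators determined by the supports.\<close>
    consider "n = 0" | "m = 0" | "mpow P n i j = 0 \<or> mpow P m j k = 0" | "n \<ge> 1" "m \<ge> 1" "mpow P n i j \<noteq> 0" "mpow P m j k \<noteq> 0" by linarith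
    then show ?thesis
    proof cases
      case 1 show ?thesis unfolding 1 ratio_0_left[OF P] ratio_0_left[OF Q] si supp by (rule refl)
    next
      case 2 show ?thesis unfolding 2 ratio_0_right[OF P] ratio_0_right[OF Q] si supp by (rule refl)
    next
      case 3 then show ?thesis using supp[of n i j] supp[of m j k] by (auto simp: ratio_def)
    next
      case 4
      then have q: "mpow Q n (\<sigma> i) (\<sigma> j) \<noteq> 0" "mpow Q m (\<sigma> j) (\<sigma> k) \<noteq> 0" by (auto simp flip: supp)
      have nm: "n + m \<ge> 1" using 4 by simp
      have pnm: "mpow P (n + m) i k \<noteq> 0"
        using 4(3,4) mpow_pos_add[OF P, of n i j m k] mpow_neq0[OF P, of n i j] mpow_neq0[OF P, of m j k] by auto
      have "V (n + m) (U P n m (Em i j) (Em j k)) (\<sigma> i) (\<sigma> k) = rt P n m i j k * v (n + m) i k"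
        unfolding U_Em[OF P 4(3,4)] Vs[OF nm Em_arv[OF pnm]] by (simp add: v_def)
      moreover have "U Q n m (V n (Em i j)) (V m (Em j k)) (\<sigma> i) (\<sigma> k) = v n i j * v m j k * rt Q n m (\<sigma> i) (\<sigma> j) (\<sigma> k)"
        unfolding VE[OF 4(1,3)] VE[OF 4(2,4)]
        by (simp add: U_scale_left[OF Q] U_scale_right[OF Q] arv_scale Em_arv q U_Em[OF Q q]) (simp add: Em_def)
      ultimately have "rt P n m i j k * v (n + m) i k = v n i j * v m j k * rt Q n m (\<sigma> i) (\<sigma> j) (\<sigma> k)"
        using VU[OF Em_arv[OF 4(3)] Em_arv[OF 4(4)]] by simp
      then have "cmod (rt P n m i j k * v (n + m) i k) = cmod (v n i j * v m j k * rt Q n m (\<sigma> i) (\<sigma> j) (\<sigma> k))" by simp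
      then have "sqrt (ratio P n m i j k) = sqrt (ratio Q n m (\<sigma> i) (\<sigma> j) (\<sigma> k))"
        using ratio_nonneg[OF P, of n m i j k] ratio_nonneg[OF Q, of n m "\<sigma> i" "\<sigma> j" "\<sigma> k"]
        by (simp add: norm_mult v1[OF 4(1,3)] v1[OF 4(2,4)] v1[OF nm pnm])
      then show ?thesis by simp
    qed
  qed
  then have "same_ratios P Q \<sigma>" using s supp by (simp add: same_ratios_def)
  then show ?thesis by blast
qed

section \<open>Recurrent matrices\<close>

lemma has_sum_diff:
  fixes f g :: "'b \<Rightarrow> real" assumes "(f has_sum a) A" "(g has_sum b) A"
  shows "((\<lambda>x. f x - g x) has_sum (a - b)) A"
  using has_sum_add[OF assms(1), of "\<lambda>x. - g x" "- b"] assms(2) by (simp add: has_sum_uminus)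

text \<open>A defect \<open>g = w - Q w \<ge> 0\<close> satisfies \<open>(\<Sum>n. Q\<^sup>n g) \<le> w\<close>, which is incompatible with \<open>g k > 0\<close> at a recurrent \<open>k\<close>.\<close>
lemma superharmonic_is_harmonic:
  assumes Q: "stochastic Q" and r: "recurrent Q" and w0: "\<And>j. 0 \<le> w j" and w1: "\<And>j. w j \<le> (1::real)"
    and sup: "\<And>k. infsum (\<lambda>j. Q k j * w j) UNIV \<le> w k"
  shows "((\<lambda>j. Q i j * w j) has_sum w i) UNIV"
proof -
  have Qw: "(\<lambda>j. Q k j * w j) summable_on UNIV" for k
    by (rule summable_on_comparison_test[of "Q k"])
       (use Q w0 w1 in \<open>auto simp: stochastic_def has_sum_iff mult_left_le\<close>)
  define g where "g k = w k - infsum (\<lambda>j. Q k j * w j) UNIV" for k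
  have g0: "0 \<le> g k" for k using sup[of k] by (simp add: g_def)
  define A where "A n k = infsum (\<lambda>j. mpow Q n k j * w j) UNIV" for n k
  have S: "(\<lambda>j. mpow Q n k j * w j) summable_on UNIV" for n k
    by (rule summable_on_comparison_test[OF mpow_summable[OF Q, of n k]]) (use w0 w1 mpow_nonneg[OF Q] in \<open>auto simp: mult_left_le\<close>)
  have A0: "0 \<le> A n k" for n k unfolding A_def by (intro infsum_nonneg mult_nonneg_nonneg mpow_nonneg Q w0)
  \<comment> \<open>A n k - A (n + 1) k is the n-th power of Q applied to the defect g, at k. Only
    its diagonal term is kept, since recurrence concerns the diagonal.\<close>
  have Adec: "A (Suc n) k \<le> A n k - mpow Q n k k * g k" for n k
  proof -
    let ?f = "\<lambda>j h. mpow Q n k j * (Q j h * w h)"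
    let ?b = "\<lambda>j. mpow Q n k j * infsum (\<lambda>h. Q j h * w h) UNIV"
    have 1: "(?f j has_sum ?b j) UNIV" for j by (intro has_sum_cmult_right has_sum_infsum Qw)
    have bs: "?b summable_on UNIV"
      by (rule summable_on_comparison_test[OF S[of n k]])
         (use sup mpow_nonneg[OF Q] in \<open>auto intro!: mult_left_mono mult_nonneg_nonneg infsum_nonneg simp: P_nonneg[OF Q] w0\<close>)
    have 2: "((\<lambda>h. infsum (\<lambda>j. ?f j h) UNIV) has_sum infsum ?b UNIV) UNIV"
      by (rule swap_nonneg_has_sum(1)[OF _ 1]) (use bs in \<open>auto intro!: mult_nonneg_nonneg simp: mpow_nonneg[OF Q] P_nonneg[OF Q] w0\<close>)
    have "infsum (\<lambda>j. ?f j h) UNIV = mpow Q (Suc n) k h * w h" for h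
      by (simp add: infsum_cmult_left' flip: mult.assoc)
    then have "A (Suc n) k = infsum ?b UNIV" using infsumI[OF 2] by (simp add: A_def)
    also have "\<dots> \<le> A n k - mpow Q n k k * g k"
    proof -
      have hs: "((\<lambda>j. mpow Q n k j * w j - (if k = j then mpow Q n k k * g k else 0)) has_sum (A n k - mpow Q n k k * g k)) UNIV"
        unfolding A_def by (rule has_sum_diff[OF has_sum_infsum[OF S] has_sum_single])
      show ?thesis
      proof (rule has_sum_mono[OF has_sum_infsum[OF bs] hs])
        fix j
        have "?b j \<le> mpow Q n k j * w j" by (rule mult_left_mono[OF sup mpow_nonneg[OF Q]])
        then show "?b j \<le> mpow Q n k j * w j - (if k = j then mpow Q n k k * g k else 0)"
          by (auto simp: g_def right_diff_distrib)
      qed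
    qed
    finally show ?thesis .
  qed
  have part: "(\<Sum>n<N. mpow Q n k k * g k) \<le> A 0 k - A N k" for N k
  proof (induction N)
    case (Suc N) then show ?case using Adec[of N k] by simp
  qed simp
  have "g k = 0" for k
  proof (rule ccontr)
    assume "g k \<noteq> 0"
    then have gp: "g k > 0" using g0[of k] by simp
    have "summable (\<lambda>n. mpow Q n k k)"
    proof (rule summableI_nonneg_bounded)
      show "0 \<le> mpow Q n k k" for n by (rule mpow_nonneg[OF Q])
      fix N
      have "(\<Sum>n<N. mpow Q n k k) * g k \<le> A 0 k" using part[where N=N and k=k] A0[where n=N and k=k] by (simp add: sum_distrib_right)
      then show "(\<Sum>n<N. mpow Q n k k) \<le> A 0 k / g k" using gp by (simp add: field_simps)
    qed
    then have "summable (\<lambda>n. mpow Q (Suc n) k k)" using summable_Suc_iff[of "\<lambda>n. mpow Q n k k"] by blast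
    then show False using r by (simp add: recurrent_def)
  qed
  from this[of i] have e: "w i = infsum (\<lambda>j. Q i j * w j) UNIV" unfolding g_def by linarith
  show ?thesis by (subst e, rule has_sum_infsum[OF Qw])
qed

text \<open>The terms Q i j (1 - w j) are nonnegative and sum to zero.\<close>

lemma harmonic_maximum:
  assumes Q: "stochastic Q" and h: "((\<lambda>j. Q i j * w j) has_sum 1) UNIV" and w1: "\<And>j. w j \<le> (1::real)" and "Q i j > 0"
  shows "w j = 1"
proof -
  have "((\<lambda>j. Q i j - Q i j * w j) has_sum (1 - 1)) UNIV"
    by (rule has_sum_diff[OF _ h]) (use Q in \<open>auto simp: stochastic_def\<close>)
  then have s: "((\<lambda>j. Q i j - Q i j * w j) has_sum 0) UNIV" by simp
  have "Q i j - Q i j * w j = 0"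
    by (rule nonneg_has_sum_le_0D[OF s order_refl]) (auto simp: mult_left_le w1 P_nonneg[OF Q])
  then show ?thesis using assms(4) by (simp add: algebra_simps)
qed

text \<open>The indicator w of the vertices that lead to i is superharmonic, because no vertex
  outside this set can step into it. By recurrence it is harmonic, so the set is also closed under
  successors, and it contains i.\<close>

lemma recurrent_return:
  assumes Q: "stochastic Q" and r: "recurrent Q" and "mpow Q n i k > 0"
  shows "\<exists>m. mpow Q m k i > 0"
proof -
  define w where "w k = (if \<exists>m. mpow Q m k i > 0 then 1 else 0 :: real)" for k
  have sup: "infsum (\<lambda>j. Q k j * w j) UNIV \<le> w k" for k
  proof (cases "\<exists>m. mpow Q m k i > 0")
    case True
    have "(\<lambda>j. Q k j * w j) summable_on UNIV"
      by (rule summable_on_comparison_test[of "Q k"]) (use Q in \<open>auto simp: stochastic_def has_sum_iff w_def\<close>)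
    then have "infsum (\<lambda>j. Q k j * w j) UNIV \<le> infsum (Q k) UNIV"
      by (rule infsum_mono) (use Q in \<open>auto simp: stochastic_def has_sum_iff w_def\<close>)
    also have "\<dots> = 1" using Q by (auto simp: stochastic_def intro: infsumI)
    finally show ?thesis using True by (simp add: w_def)
  next
    case False
    have z: "Q k j * w j = 0" for j
    proof (rule ccontr)
      assume "Q k j * w j \<noteq> 0"
      then have "mpow Q 1 k j > 0" "\<exists>m. mpow Q m j i > 0" using P_nonneg[OF Q, of k j] by (auto simp: w_def mpow_1 split: if_splits)
      then show False using False mpow_pos_add[OF Q] by blast
    qed
    show ?thesis using False infsum_0[of UNIV "\<lambda>j. Q k j * w j", OF z] by (simp add: w_def)
  qed
  have H: "((\<lambda>j. Q k j * w j) has_sum w k) UNIV" for k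
    by (rule superharmonic_is_harmonic[OF Q r _ _ sup]) (auto simp: w_def)
  have step: "w j = 1" if "w k = 1" "Q k j > 0" for k j
    by (rule harmonic_maximum[OF Q _ _ that(2)]) (use H[of k] that(1) in \<open>auto simp: w_def\<close>)
  have "w i = 1" using zero_less_one by (auto simp: w_def intro!: exI[of _ 0])
  then have "mpow Q n i k > 0 \<Longrightarrow> w k = 1" for n k
  proof (induction n arbitrary: k)
    case 0 then show ?case by (auto split: if_splits)
  next
    case (Suc n)
    have "mpow Q (n + 1) i k > 0" using Suc.prems(1) by (simp only: Suc_eq_plus1)
    then obtain j where "mpow Q n i j > 0" "mpow Q 1 j k > 0" by (rule mpow_pos_split[OF Q])
    then show ?case using Suc.IH[of j] Suc.prems(2) step[of j k] by (simp add: mpow_1)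
  qed
  from this[OF assms(3)] show ?thesis by (rule contrapos_pp) (simp add: w_def)
qed

lemma recurrent_same_ratios_id_eq:
  assumes P: "stochastic P" and Q: "stochastic Q" and c: "same_ratios P Q id" and rP: "recurrent P" and rQ: "recurrent Q"
  shows "P = Q"
proof -
  have supp: "mpow P n i j > 0 \<longleftrightarrow> mpow Q n i j > 0" for n i j
    using c mpow_neq0[OF P, of n i j] mpow_neq0[OF Q, of n i j] by (simp add: same_ratios_def)
  have R: "ratio P n m i j k = ratio Q n m i j k" for n m i j k using c by (simp add: same_ratios_def)
  define r where "r n i j = mpow P n i j / mpow Q n i j" for n i j
  have rpos: "r n i j > 0" if "mpow P n i j > 0" for n i j using that by (simp add: r_def supp)
  have rm: "r (n + m) i k = r n i j * r m j k" if "mpow P n i j > 0" "mpow P m j k > 0" for n m i j k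
  proof -
    have "mpow P (n + m) i k > 0" using mpow_pos_add[OF P that] .
    moreover from this that have "mpow Q (n + m) i k > 0" "mpow Q n i j > 0" "mpow Q m j k > 0" by (simp_all only: supp)
    ultimately show ?thesis using R[of n m i j k] that by (simp add: r_def ratio_def field_simps)
  qed
  \<comment> \<open>A positive function multiplicative in the return times is exponential, and a
    rate below 1 would bound the return probabilities by a geometric series. It is applied to r,
    which dominates the diagonal of the powers of P because those of Q are at most 1, and to 1 / r
    with P and Q exchanged.\<close>
  have not_less: "\<not> f n < 1" if S: "stochastic S" and rS: "recurrent S" and f0: "\<And>m. mpow S m i i > 0 \<Longrightarrow> f m > 0"
      and fm: "\<And>n m. mpow S n i i > 0 \<Longrightarrow> mpow S m i i > 0 \<Longrightarrow> f (n + m) = f n * (f m :: real)"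
      and fb: "\<And>m. mpow S m i i > 0 \<Longrightarrow> mpow S m i i \<le> f m" and n: "mpow S n i i > 0" "n \<ge> 1" for S f n and i :: 'a
  proof
    assume lt: "f n < 1"
    have f00: "f 0 = 1" using fm[of 0 0] f0[of 0] by simp
    have pw: "mpow S (k * m) i i > 0 \<and> f (k * m) = f m ^ k" if "mpow S m i i > 0" for k m
    proof (induction k)
      case (Suc k)
      have "mpow S (m + k * m) i i > 0" using mpow_pos_add[OF S that] Suc by blast
      then show ?case using Suc fm[OF that, of "k * m"] by simp
    qed (simp add: f00)
    \<comment> \<open>The rate: f m ^ n and f n ^ m are both the value of f at m * n, so f m = q ^ m
      at every return time m.\<close>
    define q where "q = root n (f n)"
    have q: "0 \<le> q" "q < 1" and qn: "q ^ n = f n" using lt n f0[OF n(1)] by (auto simp: q_def real_root_lt_1_iff)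
    have fq: "f m = q ^ m" if m: "mpow S m i i > 0" for m
    proof -
      have "f m ^ n = f n ^ m" using pw[OF m, of n] pw[OF n(1), of m] by (simp add: mult.commute)
      then have "f m ^ n = (q ^ m) ^ n" by (simp add: qn[symmetric] power_mult[symmetric] mult.commute)
      then show ?thesis using power_eq_iff_eq_base[of n "f m" "q ^ m"] n(2) f0[OF m] q(1) by simp
    qed
    have "summable (\<lambda>m. mpow S m i i)"
    proof (rule summable_comparison_test'[of "\<lambda>m. q ^ m" 0])
      show "summable (\<lambda>m. q ^ m)" using q by (intro summable_geometric) simp
      show "norm (mpow S m i i) \<le> q ^ m" for m
        using fb[of m] fq[of m] mpow_nonneg[OF S, of m i i] q(1) by (cases "mpow S m i i = 0") auto
    qed
    then have "summable (\<lambda>m. mpow S (Suc m) i i)" using summable_Suc_iff[of "\<lambda>m. mpow S m i i"] by blast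
    then show False using rS by (simp add: recurrent_def)
  qed
  have r1: "r n i i = 1" if n: "mpow P n i i > 0" for n i
  proof (cases "n = 0")
    case True then show ?thesis by (simp add: r_def)
  next
    case False
    then have n1: "n \<ge> 1" by simp
    have "\<not> r n i i < 1"
    proof (rule not_less[OF P rP, of i "\<lambda>m. r m i i" n])
      show "mpow P m i i \<le> r m i i" if "mpow P m i i > 0" for m
        using that mpow_le1[OF Q, of m i i] by (simp add: r_def supp le_divide_eq mult_left_le)
    qed (use rpos rm n n1 in auto)
    moreover have "\<not> 1 / r n i i < 1"
    proof (rule not_less[OF Q rQ, of i "\<lambda>m. 1 / r m i i" n])
      show "mpow Q m i i \<le> 1 / r m i i" if "mpow Q m i i > 0" for m
      proof -
        have "mpow P m i i > 0" using that by (simp add: supp)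
        then show ?thesis using that mpow_le1[OF P, of m i i] by (simp add: r_def le_divide_eq mult_left_le)
      qed
    qed (use rpos rm n n1 supp in auto)
    ultimately show ?thesis using rpos[OF n] by (simp add: field_simps)
  qed
  have eq: "P i j = Q i j" if q: "Q i j > 0" for i j
  proof -
    define reach where "reach k \<longleftrightarrow> (\<exists>n. mpow P n i k > 0)" for k
    \<comment> \<open>Any n serves: appending a fixed path of length m from k back to i gives r n i
      k * r m k i = 1 for each of them.\<close>
    define u where "u k = r (SOME n. mpow P n i k > 0) i k" for k
    have ru: "r n i k = u k" if n: "mpow P n i k > 0" for n k
    proof -
      obtain m where m: "mpow P m k i > 0" using recurrent_return[OF P rP n] by blast
      have "r n' i k * r m k i = 1" if "mpow P n' i k > 0" for n'
        using rm[OF that m] r1[OF mpow_pos_add[OF P that m]] by simp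
      from this[OF n] this[OF someI[of "\<lambda>n. mpow P n i k > 0", OF n]]
      have "r n i k * r m k i = r (SOME n. mpow P n i k > 0) i k * r m k i" by simp
      then show ?thesis using rpos[OF m] by (simp add: u_def)
    qed
    have up: "u k > 0" if "reach k" for k
    proof -
      obtain n where n: "mpow P n i k > 0" using \<open>reach k\<close> by (auto simp: reach_def)
      show ?thesis using ru[OF n] rpos[OF n] by simp
    qed
    have ri: "reach i" by (auto simp: reach_def intro!: exI[of _ 0])
    have ui: "u i = 1" using ru[of 0 i] by (simp add: r_def)
    have next_reach: "reach h" if "reach k" "Q k h > 0" for k h
    proof -
      obtain n where n: "mpow P n i k > 0" using \<open>reach k\<close> by (auto simp: reach_def)
      have "mpow P 1 k h > 0" using that(2) supp[of 1 k h] by (simp add: mpow_1)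
      from mpow_pos_add[OF P n this] show ?thesis unfolding reach_def by blast
    qed
    have Qu: "Q k h * u h = P k h * u k" if k: "reach k" for k h
    proof (cases "Q k h > 0")
      case True
      obtain n where n: "mpow P n i k > 0" using k by (auto simp: reach_def)
      have 1: "mpow P 1 k h > 0" using True supp[of 1 k h] by (simp add: mpow_1)
      have "r 1 k h = P k h / Q k h" by (simp add: r_def mpow_1)
      then have "u h = u k * (P k h / Q k h)"
        using rm[OF n 1] ru[OF n] ru[OF mpow_pos_add[OF P n 1]] by metis
      then show ?thesis using up[OF k] up[OF next_reach[OF k True]] True by (simp add: field_simps)
    next
      case False
      then have "\<not> P k h > 0" using supp[of 1 k h] by (simp add: mpow_1)
      then show ?thesis using False P_nonneg[OF P, of k h] P_nonneg[OF Q, of k h] by simp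
    qed
    have Qus: "((\<lambda>h. Q k h * u h) has_sum u k) UNIV" if "reach k" for k
    proof -
      have "((\<lambda>h. P k h) has_sum 1) UNIV" using P by (simp add: stochastic_def)
      from has_sum_cmult_left[OF this, of "u k"] show ?thesis by (simp add: Qu[OF that])
    qed
    \<comment> \<open>u is positive and harmonic only on the vertices reachable from i and may be
      unbounded. Truncating at 1 and extending by 1 gives a superharmonic function with values in
      [0, 1] that attains its maximum 1 at i.\<close>
    define w where "w k = (if reach k then min (u k) 1 else 1)" for k
    have w01: "0 \<le> w k" "w k \<le> 1" for k using up[of k] by (auto simp: w_def)
    have Qk1: "(Q k has_sum 1) UNIV" for k using Q by (simp add: stochastic_def)
    have Qws: "(\<lambda>h. Q k h * w h) summable_on UNIV" for k
      by (rule summable_on_comparison_test[OF has_sum_imp_summable[OF Qk1[of k]]]) (auto simp: mult_left_le w01 P_nonneg[OF Q])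
    have le1: "infsum (\<lambda>h. Q k h * w h) UNIV \<le> 1" for k
      by (rule has_sum_mono[OF has_sum_infsum[OF Qws[of k]] Qk1[of k]]) (auto simp: mult_left_le w01 P_nonneg[OF Q])
    have sup: "infsum (\<lambda>h. Q k h * w h) UNIV \<le> w k" for k
    proof (cases "reach k")
      case True
      have "infsum (\<lambda>h. Q k h * w h) UNIV \<le> u k"
      proof (rule has_sum_mono[OF has_sum_infsum[OF Qws] Qus[OF True]])
        fix h
        show "Q k h * w h \<le> Q k h * u h"
        proof (cases "Q k h > 0")
          case q: True
          then show ?thesis using next_reach[OF True q] by (simp add: w_def)
        next
          case False
          then show ?thesis using P_nonneg[OF Q, of k h] by simp
        qed
      qed
      then show ?thesis using le1[of k] True by (simp add: w_def)
    next
      case False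
      then show ?thesis using le1[of k] by (simp add: w_def)
    qed
    have wi: "w i = 1" using ri ui by (simp add: w_def)
    have w1: "w h = 1" if "Q i h > 0" for h
      using harmonic_maximum[OF Q _ w01(2) that] superharmonic_is_harmonic[OF Q rQ w01 sup, of i] wi by simp
    \<comment> \<open>The truncation only yields u \<ge> 1 at the successors of i. Since their
      average with weights Q i h is u i = 1, equality follows.\<close>
    have uge: "u h \<ge> 1" if "Q i h > 0" for h
      using w1[OF that] next_reach[OF ri that] by (simp add: w_def min_def split: if_splits)
    have "((\<lambda>h. Q i h * u h - Q i h) has_sum (u i - 1)) UNIV" by (rule has_sum_diff[OF Qus[OF ri] Qk1])
    then have hs0: "((\<lambda>h. Q i h * u h - Q i h) has_sum 0) UNIV" by (simp add: ui)
    have nn: "0 \<le> Q i h * u h - Q i h" for h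
      using uge[of h] P_nonneg[OF Q, of i h] mult_left_mono[of 1 "u h" "Q i h"] by (cases "Q i h = 0") auto
    have "Q i j * u j - Q i j = 0" by (rule nonneg_has_sum_le_0D[OF hs0 order_refl nn]) simp
    then have "u j = 1" using q by simp
    then show ?thesis using Qu[OF ri, of j] ui by simp
  qed
  show ?thesis
  proof (intro ext)
    fix i j
    show "P i j = Q i j"
    proof (cases "Q i j > 0")
      case False
      then have "\<not> P i j > 0" using supp[of 1 i j] by (simp add: mpow_1)
      then show ?thesis using False P_nonneg[OF P, of i j] P_nonneg[OF Q, of i j] by simp
    qed (rule eq)
  qed
qed

lemma recurrent_same_ratios_eq:
  assumes P: "stochastic P" and Q: "stochastic Q" and c: "same_ratios P Q \<sigma>" and rP: "recurrent P" and rQ: "recurrent Q"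
  shows "P i j = Q (\<sigma> i) (\<sigma> j)"
proof -
  have s: "bij \<sigma>" using c by (simp add: same_ratios_def)
  note st = permuted_stochastic[OF Q s]
  have "P = (\<lambda>i j. Q (\<sigma> i) (\<sigma> j))"
  proof (rule recurrent_same_ratios_id_eq[OF P st(1) _ rP])
    show "same_ratios P (\<lambda>i j. Q (\<sigma> i) (\<sigma> j)) id" using c by (simp add: same_ratios_def ratio_def st(2))
    show "recurrent (\<lambda>i j. Q (\<sigma> i) (\<sigma> j))" using rQ unfolding recurrent_def st(2) by blast
  qed
  then show ?thesis by metis
qed

theorem mainTheorem1:
  fixes P Q :: "'a::countable \<Rightarrow> 'a \<Rightarrow> real"
  assumes "stochastic P" and "stochastic Q"
  shows "((\<exists>\<rho> V. star_automorphism \<rho> \<and> rho_unitary_iso P Q \<rho> V)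
            \<longleftrightarrow> (\<exists>\<phi>. alg_iso P Q \<phi> \<and> graded P Q \<phi> \<and> completely_isometric P Q \<phi>))
       \<and> ((\<exists>\<phi>. alg_iso P Q \<phi> \<and> graded P Q \<phi> \<and> completely_isometric P Q \<phi>)
            \<longleftrightarrow> (\<exists>\<phi>. alg_iso P Q \<phi> \<and> isometric P Q \<phi>))
       \<and> (recurrent P \<and> recurrent Q \<longrightarrow>
            ((\<exists>\<rho> V. star_automorphism \<rho> \<and> rho_unitary_iso P Q \<rho> V)
              \<longleftrightarrow> (\<exists>\<sigma>. bij \<sigma> \<and> (\<forall>i j. P i j = Q (\<sigma> i) (\<sigma> j)))))"
proof -
  let ?A = "\<exists>\<rho> V. star_automorphism \<rho> \<and> rho_unitary_iso P Q \<rho> V"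
  let ?B = "\<exists>\<phi>. alg_iso P Q \<phi> \<and> graded P Q \<phi> \<and> completely_isometric P Q \<phi>"
  let ?C = "\<exists>\<phi>. alg_iso P Q \<phi> \<and> isometric P Q \<phi>"
  let ?R = "\<exists>\<sigma>. same_ratios P Q \<sigma>"
  have A: "?A \<longleftrightarrow> ?R" using unitary_imp_same_ratios[OF assms] same_ratios_imp_unitary[OF assms] by blast
  have RB: "?R \<Longrightarrow> ?B" using same_ratios_imp_graded_iso[OF assms] by blast
  have BC: "?B \<Longrightarrow> ?C" using completely_isometric_imp_isometric by blast
  have CR: "?C \<Longrightarrow> ?R" using isometric_imp_same_ratios[OF assms] by blast
  have "?R \<longleftrightarrow> (\<exists>\<sigma>. bij \<sigma> \<and> (\<forall>i j. P i j = Q (\<sigma> i) (\<sigma> j)))" if rec: "recurrent P" "recurrent Q"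
  proof
    assume ?R
    then obtain \<sigma> where c: "same_ratios P Q \<sigma>" by blast
    then have "bij \<sigma>" by (simp add: same_ratios_def)
    then show "\<exists>\<sigma>. bij \<sigma> \<and> (\<forall>i j. P i j = Q (\<sigma> i) (\<sigma> j))" using recurrent_same_ratios_eq[OF assms c rec] by blast
  next
    assume "\<exists>\<sigma>. bij \<sigma> \<and> (\<forall>i j. P i j = Q (\<sigma> i) (\<sigma> j))"
    then obtain \<sigma> where s: "bij \<sigma>" "\<And>i j. P i j = Q (\<sigma> i) (\<sigma> j)" by blast
    have "P = (\<lambda>i j. Q (\<sigma> i) (\<sigma> j))" by (intro ext s(2))
    then show ?R using same_ratios_permuted[OF assms(2) s(1)] by blast
  qed
  then show ?thesis using A RB BC CR by blast
qed

end
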